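(* Let $d\ge 3$ and $L>0$. Let $a\ge1$ and $x,y\in\mathbb{Z}^d$ with $x\notin V_a(y)$. Then: (i) $$\mathrm{P}_x\bigl(T_{V_a(y)}<\infty\bigr)=\Bigl(\frac a{|x-y|}\Bigr)^{d-2}\bigl(1+O(a^{-1})\bigr).$$ (ii) There exists $C>0$, independent of $a$, such that for $x,y\in V_L$ with $|x-y|>7a$, $$\mathrm{P}_x\bigl(T_{V_a(y)}<\tau_L\bigr)\le C\,\frac{a^{d-2}\max\{a,d_L(y)\}\max\{1,d_L(x)\}}{|x-y|^d}.$$ Moreover: (iii) There exists $C>0$ such that for all $x\in V_L$ and $y\in\partial V_L$, $$C^{-1}\frac{d_L(x)}{|x-y|^d}\le\pi_L(x,y)\le C\,\frac{\max\{1,d_L(x)\}}{|x-y|^d}.$$ All constants, including the one in the $O$-notation, depend only on $d$.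
   Context: $|\cdot|$ is the Euclidean norm, $V_L=\{x\in\mathbb{Z}^d:|x|\le L\}$, $V_a(y)=y+V_a$, $d_L(x)=L-|x|$. For $V\subset\mathbb{Z}^d$, $\partial V$ is the set of points of $\mathbb{Z}^d\setminus V$ at distance exactly $1$ from $V$. $\mathrm{P}_x$ is the law of simple random walk $(X_n)$ on $\mathbb{Z}^d$ started at $x$; $T_V=\inf\{n\ge0:X_n\in V\}$, $\tau_L=\inf\{n\ge0:X_n\notin V_L\}$, and $\pi_L(x,y)=\mathrm{P}_x(X_{\tau_L}=y)$. *)

theory Defs
  imports "HOL-Probability.Probability"
begin

text \<open>
  The lattice \<open>\<int>\<^sup>d\<close> is the type \<open>int ^ 'd\<close> with \<open>d = CARD('d)\<close>. It carries no library metric, so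
  lengths and distances are taken after embedding it into \<open>real ^ 'd\<close>.
\<close>

definition emb :: "int ^ 'd::finite \<Rightarrow> real ^ 'd" where
  "emb x = (\<chi> i. real_of_int (x $ i))"

definition lnorm :: "int ^ 'd::finite \<Rightarrow> real" where
  "lnorm x = norm (emb x)"

definition lball :: "real \<Rightarrow> (int ^ 'd::finite) set" where
  "lball L = {x. lnorm x \<le> L}"

definition lball_at :: "real \<Rightarrow> int ^ 'd::finite \<Rightarrow> (int ^ 'd) set" where
  "lball_at a y = (+) y ` lball a"

definition bdist :: "real \<Rightarrow> int ^ 'd::finite \<Rightarrow> real" where
  "bdist L x = L - lnorm x"

definition outer_boundary :: "(int ^ 'd::finite) set \<Rightarrow> (int ^ 'd) set" where
  "outer_boundary A = {y. y \<notin> A \<and> infdist (emb y) (emb ` A) = 1}"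

definition unit_steps :: "(int ^ 'd::finite) set" where
  "unit_steps = {axis i s | i s. s \<in> {1, -1}}"

text \<open>
  The law, on the path space \<open>nat \<Rightarrow> int ^ 'd\<close>, of \<open>X n = x + \<xi> 0 + \<dots> + \<xi> (n - 1)\<close> for independent
  steps \<open>\<xi> k\<close>, each uniform on the \<open>2d\<close> unit lattice vectors.
\<close>

definition srw :: "int ^ 'd::finite \<Rightarrow> (nat \<Rightarrow> int ^ 'd) measure" where
  "srw x =
     distr (\<Pi>\<^sub>M k\<in>(UNIV :: nat set). measure_pmf (pmf_of_set unit_steps))
       (\<Pi>\<^sub>M n\<in>(UNIV :: nat set). count_space UNIV)
       (\<lambda>\<xi> n. x + (\<Sum>k<n. \<xi> k))"

text \<open>The infimum is taken in \<open>enat\<close>, so it is \<open>\<infinity>\<close> if the set is never visited.\<close>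

definition hit_time :: "'a set \<Rightarrow> (nat \<Rightarrow> 'a) \<Rightarrow> enat" where
  "hit_time A X = Inf {enat n | n. X n \<in> A}"

definition exit_time :: "real \<Rightarrow> (nat \<Rightarrow> int ^ 'd::finite) \<Rightarrow> enat" where
  "exit_time L X = Inf {enat n | n. X n \<notin> lball L}"

definition exit_prob :: "real \<Rightarrow> int ^ 'd::finite \<Rightarrow> int ^ 'd \<Rightarrow> real" where
  "exit_prob L x y = \<P>(X in srw x. \<exists>n. exit_time L X = enat n \<and> X n = y)"

lemma finite_unit_steps: "finite (unit_steps :: (int ^ 'd::finite) set)"
proof -
  have "unit_steps \<subseteq> (\<lambda>(i, s). axis i s :: int ^ 'd) ` (UNIV \<times> {1, -1})"
    unfolding unit_steps_def by auto
  then show ?thesis by (rule finite_subset) auto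
qed

lemma unit_steps_nonempty: "unit_steps \<noteq> {}"
  unfolding unit_steps_def by auto

lemma card_unit_steps: "card (unit_steps :: (int ^ 'd::finite) set) = 2 * CARD('d)"
proof -
  have eq: "unit_steps = (\<lambda>(i, s). axis i s :: int ^ 'd) ` (UNIV \<times> {1, -1})"
    unfolding unit_steps_def by auto
  have "inj_on (\<lambda>(i, s). axis i s :: int ^ 'd) (UNIV \<times> {1, -1})"
    by (auto simp: inj_on_def axis_eq_axis)
  then show ?thesis
    unfolding eq by (simp add: card_image)
qed

lemma space_srw: "space (srw x) = UNIV"
  by (simp add: srw_def space_PiM)

lemma prob_space_srw: "prob_space (srw x)"
  unfolding srw_def
proof (rule prob_space.prob_space_distr)
  show "prob_space (\<Pi>\<^sub>M k\<in>(UNIV :: nat set). measure_pmf (pmf_of_set unit_steps))"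
    by (intro prob_space_PiM prob_space_measure_pmf)
  have "(\<lambda>\<xi>. x + (\<Sum>k<n. \<xi> k)) \<in>
      (\<Pi>\<^sub>M k\<in>(UNIV :: nat set). measure_pmf (pmf_of_set unit_steps)) \<rightarrow>\<^sub>M count_space UNIV" for n
  proof (induction n)
    case 0
    show ?case by simp
  next
    case (Suc n)
    have c: "(\<lambda>\<xi>. \<xi> n) \<in>
      (\<Pi>\<^sub>M k\<in>(UNIV :: nat set). measure_pmf (pmf_of_set unit_steps)) \<rightarrow>\<^sub>M count_space UNIV"
      using measurable_component_singleton[of n UNIV "\<lambda>_. measure_pmf (pmf_of_set unit_steps)"]
      by (simp cong: measurable_cong_sets)
    have "(\<lambda>\<xi>. (\<lambda>z w. z + w) (x + (\<Sum>k<n. \<xi> k)) (\<xi> n)) \<in>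
      (\<Pi>\<^sub>M k\<in>(UNIV :: nat set). measure_pmf (pmf_of_set unit_steps)) \<rightarrow>\<^sub>M count_space UNIV"
      by (rule measurable_compose_countable[OF _ Suc.IH])
        (use c in \<open>auto intro: measurable_compose\<close>)
    then show ?case by (simp add: add.assoc)
  qed
  then show "(\<lambda>\<xi> n. x + (\<Sum>k<n. \<xi> k)) \<in>
      (\<Pi>\<^sub>M k\<in>(UNIV :: nat set). measure_pmf (pmf_of_set unit_steps)) \<rightarrow>\<^sub>M
      (\<Pi>\<^sub>M n\<in>(UNIV :: nat set). count_space UNIV)"
    by (intro measurable_PiM_single') (auto simp: space_PiM)
qed

end

theory Submission
  imports Defs
begin

text \<open>
  Everything is deduced from the minimum principle for the lattice Laplacian
  (\<open>lap_nonneg_minimum_principle\<close>) and explicit comparison functions; no local limit theorem and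
  no asymptotics of the Green function enter. First-step analysis shows that each of the three
  probabilities is, as a function of the starting point, harmonic away from its target and has
  known values there, so it only has to be compared with a super- or subharmonic function having
  suitable boundary values.

  The comparison functions are continuum harmonic functions with a small correction. Taylor
  expansion to second order shows that a continuum harmonic function which is a power or a dipole
  with pole \<open>v\<close> has a lattice Laplacian of relative size \<open>O(\<rho>\<^sup>-\<^sup>3)\<close>, where \<open>\<rho>\<close> is the distance to
  \<open>v\<close>. The power \<open>\<rho>\<^sup>-\<^sup>n\<close> with \<open>n > d - 2\<close> is strictly subharmonic with Laplacian of order
  \<open>\<rho>\<^sup>-\<^sup>n\<^sup>-\<^sup>2\<close>. Subtracting or adding a multiple of such a power, small compared with the main
  term, therefore makes the main term exactly super- or subharmonic on the lattice.

  For (i) the main term is \<open>\<rho>\<^sup>2\<^sup>-\<^sup>d\<close> and the correction is \<open>K \<rho>\<^sup>1\<^sup>-\<^sup>d\<close>, which is exactly the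
  relative error \<open>O(1/a)\<close> claimed; the walk enters \<open>V\<^sub>a(y)\<close> at distance between \<open>a - 1\<close> and \<open>a\<close>
  from \<open>y\<close>, which costs another factor of the same form.

  For (iii) the main term is the Poisson kernel \<open>(R\<^sup>2 - |x|\<^sup>2) / (R |x - v|\<^sup>d)\<close> of the ball of radius
  \<open>R = |v|\<close>, with \<open>v\<close> on the ray through the exit point, and the correction is
  \<open>\<kappa> |x - v|\<^sup>-\<^sup>d\<close>. The radius differs from \<open>L\<close> by a constant. For the upper bound
  \<open>R = L + c\<close>: then \<open>R - |x| \<ge> c - 1\<close> up to the outer boundary and the kernel dominates its
  correction. For the lower bound
  \<open>R = L - c\<close>: the kernel plus correction is then nonpositive outside \<open>V\<^sub>L\<close>, and a ball of bounded
  radius around the pole has to be removed. There, and within bounded distance of the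
  boundary, a Harnack chain of bounded length replaces the barrier (\<open>harnack_lball\<close>).

  For (ii), let \<open>b = max a (d\<^sub>L(y)/4)\<close>. By (i) the probability is at most \<open>C (a/b)\<^sup>d\<^sup>-\<^sup>2\<close> from distance
  \<open>b/2\<close> to \<open>y\<close> on, so after division by this it remains to bound a function \<open>u\<close> which is at most
  one at these distances, is harmonic in \<open>V\<^sub>L\<close> off \<open>V\<^sub>b(y)\<close> and vanishes outside \<open>V\<^sub>L\<close>. An exterior-ball barrier at scale \<open>b\<close> gives \<open>u \<le> C max 1 d\<^sub>L / b\<close>
  (\<open>killed_harmonic_boundary_decay\<close>), which at distance about \<open>3b\<close> from \<open>y\<close> is dominated by
  a multiple of \<open>b\<^sup>d\<^sup>-\<^sup>1\<close> times the Poisson kernel with pole on the ray through \<open>y\<close>; comparison with that kernel further away gives the decay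
  \<open>|x - y|\<^sup>-\<^sup>d\<close> (\<open>killed_harmonic_bound\<close>).
\<close>

section \<open>The lattice Laplacian\<close>

text \<open>
  The coefficient ring is left open so that one definition serves functions on the lattice and
  functions on \<open>\<real>\<^sup>d\<close>, where the barriers are defined; \<open>lap_emb\<close> transfers between the two.
  It is \<open>2d\<close> times the generator of the walk.
\<close>

definition lap :: "('a::ring_1 ^ 'd::finite \<Rightarrow> real) \<Rightarrow> 'a ^ 'd \<Rightarrow> real" where
  "lap f x = (\<Sum>i\<in>UNIV. f (x + axis i 1) + f (x - axis i 1) - 2 * f x)"

lemma lap_add: "lap (\<lambda>x. f x + g x) x = lap f x + lap g x"
  by (simp add: lap_def sum.distrib sum_subtractf algebra_simps)

lemma lap_diff: "lap (\<lambda>x. f x - g x) x = lap f x - lap g x"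
  by (simp add: lap_def sum.distrib sum_subtractf algebra_simps)

lemma lap_cmult: "lap (\<lambda>x. c * f x) x = c * lap f x"
  by (simp add: lap_def sum_distrib_left algebra_simps)

lemma lap_const: "lap (\<lambda>x. c) x = 0"
  by (simp add: lap_def)

lemma emb_add: "emb (x + y) = emb x + emb y"
  by (simp add: emb_def vec_eq_iff)

lemma emb_diff: "emb (x - y) = emb x - emb y"
  by (simp add: emb_def vec_eq_iff)

lemma emb_axis: "emb (axis i 1) = axis i 1"
  by (simp add: emb_def vec_eq_iff axis_def)

lemma lap_emb: "lap (\<lambda>x. f (emb x)) x = lap f (emb x)"
  by (simp add: lap_def emb_add emb_diff emb_axis)

lemma lap_shift: "lap (\<lambda>x. f (x - v)) x = lap f (x - v)"
  by (simp add: lap_def algebra_simps)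

lemma lap_emb_shift: "lap (\<lambda>z. g (emb z - v)) x = lap g (emb x - v)"
  using lap_emb[of "\<lambda>w. g (w - v)" x] lap_shift[of g v "emb x"] by simp

lemma lnorm_diff: "lnorm (x - y) = norm (emb x - emb y)"
  by (simp add: lnorm_def emb_diff)

lemma lnorm_minus_commute: "lnorm (x - y) = lnorm (y - x)"
  by (simp add: lnorm_diff norm_minus_commute)

lemma lnorm_triangle: "lnorm (x - z) \<le> lnorm (x - y) + lnorm (y - z)"
  using norm_triangle_ineq[of "emb x - emb y" "emb y - emb z"] by (simp add: lnorm_diff)

lemma component_le_lnorm: "\<bar>real_of_int (x $ i)\<bar> \<le> lnorm x"
  using component_le_norm_cart[of "emb x" i] by (simp add: lnorm_def emb_def)

lemma lnorm_ge_1: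
  assumes "x \<noteq> 0"
  shows "lnorm x \<ge> 1"
proof -
  obtain i where "x $ i \<noteq> 0" using assms by (auto simp: vec_eq_iff)
  then have "1 \<le> \<bar>real_of_int (x $ i)\<bar>" by linarith
  then show ?thesis using component_le_lnorm[of x i] by linarith
qed

lemma finite_lball: "finite (lball L :: (int ^ 'd::finite) set)"
proof -
  define N where "N = \<lfloor>\<bar>L\<bar>\<rfloor>"
  have "(lball L :: (int ^ 'd) set) \<subseteq> (\<lambda>f. \<chi> i. f i) ` (\<Pi>\<^sub>E i\<in>UNIV. {-N..N})"
  proof
    fix x :: "int ^ 'd" assume "x \<in> lball L"
    then have "\<bar>real_of_int (x $ i)\<bar> \<le> \<bar>L\<bar>" for i
      using component_le_lnorm[of x i] by (simp add: lball_def)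
    then have "\<bar>x $ i\<bar> \<le> N" for i
      unfolding N_def by (metis le_floor_iff of_int_abs)
    then have "(\<lambda>i. x $ i) \<in> (\<Pi>\<^sub>E i\<in>UNIV. {-N..N})"
      by (auto simp: abs_le_iff minus_le_iff)
    then show "x \<in> (\<lambda>f. \<chi> i. f i) ` (\<Pi>\<^sub>E i\<in>UNIV. {-N..N})"
      by (intro image_eqI[where x="\<lambda>i. x $ i"]) auto
  qed
  then show ?thesis
    by (rule finite_subset) (auto intro!: finite_imageI finite_PiE)
qed

lemma mem_lball_at: "x \<in> lball_at a y \<longleftrightarrow> lnorm (x - y) \<le> a"
proof -
  have "x \<in> lball_at a y \<longleftrightarrow> x - y \<in> lball a"
    by (auto simp: lball_at_def image_iff algebra_simps intro!: bexI[where x="x - y"])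
  then show ?thesis by (simp add: lball_def)
qed

lemma finite_lball_at: "finite (lball_at a y)"
  unfolding lball_at_def by (intro finite_imageI finite_lball)

definition nbrs :: "int ^ 'd::finite \<Rightarrow> (int ^ 'd) set" where
  "nbrs x = (\<Union>i. {x + axis i 1, x - axis i 1})"

lemma nbrs_plus [simp]: "x + axis i 1 \<in> nbrs x" and nbrs_minus [simp]: "x - axis i 1 \<in> nbrs x"
  by (auto simp: nbrs_def)

lemma nbrs_sym: "z \<in> nbrs x \<longleftrightarrow> x \<in> nbrs z"
  by (force simp: nbrs_def)

lemma norm_diff_radial_rescale:
  fixes p :: "real ^ 'd::finite"
  assumes "p \<noteq> 0"
  shows "norm (p - (s / norm p) *\<^sub>R p) = \<bar>norm p - s\<bar>"
proof -
  have "p - (s / norm p) *\<^sub>R p = (1 - s / norm p) *\<^sub>R p" by (simp add: scaleR_diff_left)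
  then have "norm (p - (s / norm p) *\<^sub>R p) = \<bar>(1 - s / norm p) * norm p\<bar>" by (simp add: abs_mult)
  also have "(1 - s / norm p) * norm p = norm p - s" using assms by (simp add: field_simps)
  finally show ?thesis .
qed

lemma lnorm_nbr: "z \<in> nbrs x \<Longrightarrow> lnorm (z - x) = 1"
  by (auto simp: nbrs_def lnorm_def emb_add emb_diff emb_axis)

lemma lnorm_nbr_le: "z \<in> nbrs x \<Longrightarrow> lnorm (z - y) \<le> lnorm (x - y) + 1"
  using lnorm_nbr[of z x] lnorm_triangle[of z y x] by linarith

section \<open>Minimum principle and Harnack inequality\<close>

lemma lap_nonneg_minimum_principle:
  fixes h :: "int ^ 'd::finite \<Rightarrow> real"
  assumes fin: "finite V"
    and super: "\<And>x. x \<in> V \<Longrightarrow> lap h x \<le> 0"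
    and bdry: "\<And>x z. x \<in> V \<Longrightarrow> z \<in> nbrs x \<Longrightarrow> z \<notin> V \<Longrightarrow> 0 \<le> h z"
    and "x \<in> V"
  shows "0 \<le> h x"
proof (rule ccontr)
  assume neg: "\<not> 0 \<le> h x"
  define m where "m = Min (h ` V)"
  have mV: "m \<le> h z" if "z \<in> V" for z
    unfolding m_def using fin that by auto
  have m_neg: "m < 0" using mV[OF \<open>x \<in> V\<close>] neg by linarith
  define W where "W = {z \<in> V. h z = m}"
  have "m \<in> h ` V" unfolding m_def using fin \<open>x \<in> V\<close> by (intro Min_in) auto
  then have W: "finite W" "W \<noteq> {}" using fin by (auto simp: W_def)
  \<comment> \<open>Any fixed coordinate direction serves.\<close>
  define j :: 'd where "j = undefined"
  \<comment> \<open>Among the minimisers, one that is extremal in a fixed coordinate direction has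
      a neighbour that is not a minimiser.\<close>
  obtain z where z: "z \<in> W" and z_max: "\<And>w. w \<in> W \<Longrightarrow> w $ j \<le> z $ j"
  proof -
    have "Max ((\<lambda>w. w $ j) ` W) \<in> (\<lambda>w. w $ j) ` W" using W by (intro Max_in) auto
    then obtain z where "z \<in> W" "z $ j = Max ((\<lambda>w. w $ j) ` W)" by auto
    then show thesis using W(1) by (intro that[of z]) auto
  qed
  have zV: "z \<in> V" "h z = m" using z by (auto simp: W_def)
  have ge: "m \<le> h w" if "w \<in> nbrs z" for w
    using mV[of w] bdry[OF zV(1) that] m_neg by (cases "w \<in> V") auto
  have strict: "m < h (z + axis j 1)"
  proof -
    have n: "z + axis j 1 \<in> nbrs z" by (auto simp: nbrs_def)
    have "z + axis j 1 \<notin> W" using z_max[of "z + axis j 1"] by auto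
    then show ?thesis using ge[OF n] bdry[OF zV(1) n] m_neg
      by (cases "z + axis j 1 \<in> V") (auto simp: W_def)
  qed
  have "0 < lap h z"
    unfolding lap_def
  proof (rule sum_pos2[where i=j])
    show "0 < h (z + axis j 1) + h (z - axis j 1) - 2 * h z"
      using strict ge[of "z - axis j 1"] zV by auto
    show "0 \<le> h (z + axis i 1) + h (z - axis i 1) - 2 * h z" for i
      using ge[of "z - axis i 1"] ge[of "z + axis i 1"] zV by auto
  qed auto
  then show False using super[OF zV(1)] by simp
qed

text \<open>
  A nonnegative harmonic function is at least the contribution of a single neighbour to its mean.
\<close>

lemma harmonic_ge_nbr:
  fixes h :: "int ^ 'd::finite \<Rightarrow> real"
  assumes nn: "\<And>x. 0 \<le> h x" and "lap h x = 0" "z \<in> nbrs x"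
  shows "h z \<le> (2 * CARD('d)) * h x"
proof -
  have eq: "(\<Sum>i\<in>UNIV. h (x + axis i 1) + h (x - axis i 1)) = (2 * CARD('d)) * h x"
    using assms(2) by (simp add: lap_def sum_subtractf)
  obtain j where j: "z = x + axis j 1 \<or> z = x - axis j 1"
    using assms(3) by (auto simp: nbrs_def)
  have "h z \<le> h (x + axis j 1) + h (x - axis j 1)"
    using j nn[of "x + axis j 1"] nn[of "x - axis j 1"] by auto
  also have "\<dots> \<le> (\<Sum>i\<in>UNIV. h (x + axis i 1) + h (x - axis i 1))"
    by (rule member_le_sum) (auto simp: nn)
  finally show ?thesis using eq by simp
qed

definition dist1 :: "int ^ 'd::finite \<Rightarrow> int ^ 'd \<Rightarrow> int" where
  "dist1 x y = (\<Sum>i\<in>UNIV. \<bar>x $ i - y $ i\<bar>)"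

lemma dist1_commute: "dist1 x y = dist1 y x"
  by (simp add: dist1_def abs_minus_commute)

text \<open>
  Lattice balls are geodesically connected for the \<open>\<ell>\<^sup>1\<close> distance: the endpoint with the larger
  coordinate in absolute value can move towards the other one without increasing its norm.
\<close>

lemma dist1_step:
  assumes "\<bar>y $ i\<bar> \<le> \<bar>x $ i\<bar>" "x $ i \<noteq> y $ i" "x \<in> lball L"
  obtains z where "z \<in> nbrs x" "z \<in> lball L" "dist1 z y = dist1 x y - 1"
proof -
  define s where "s = sgn (x $ i)"
  have s: "s = 1 \<or> s = -1" using assms by (auto simp: s_def sgn_if)
  have s1: "\<bar>x $ i - s\<bar> \<le> \<bar>x $ i\<bar>" "\<bar>x $ i - s - y $ i\<bar> = \<bar>x $ i - y $ i\<bar> - 1"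
    using assms by (auto simp: s_def sgn_if)
  define z where "z = x - axis i s"
  have zc: "z $ k = (if k = i then x $ i - s else x $ k)" for k
    by (simp add: z_def axis_def)
  have "axis i (-1) = - axis i (1::int)" by (simp add: vec_eq_iff axis_def)
  then have "z \<in> nbrs x" using s by (auto simp: nbrs_def z_def)
  moreover have "lnorm z \<le> lnorm x"
    unfolding lnorm_def using s1(1) by (intro norm_le_componentwise_cart) (auto simp: emb_def zc simp flip: of_int_diff of_int_abs)
  then have "z \<in> lball L" using assms(3) by (simp add: lball_def)
  moreover have "dist1 z y = dist1 x y - 1"
  proof -
    have "dist1 w y = \<bar>w $ i - y $ i\<bar> + (\<Sum>k\<in>UNIV - {i}. \<bar>w $ k - y $ k\<bar>)" for w
      unfolding dist1_def by (rule sum.remove) auto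
    then show ?thesis using s1(2) by (simp add: zc)
  qed
  ultimately show thesis using that by blast
qed

text \<open>
  Harnack inequality along an \<open>\<ell>\<^sup>1\<close> geodesic inside the ball. The constant does not
  depend on how close the points are to the boundary, so it can be used right up to it.
\<close>

lemma harnack_lball:
  fixes h :: "int ^ 'd::finite \<Rightarrow> real"
  assumes nn: "\<And>x. 0 \<le> h x" and harm: "\<And>x. x \<in> lball L \<Longrightarrow> lap h x = 0"
    and "x \<in> lball L" "y \<in> lball L" "dist1 x y \<le> int n"
  shows "h y \<le> (2 * CARD('d)) ^ n * h x"
  using assms(3-5)
proof (induction n arbitrary: x y)
  case 0
  then have "dist1 x y = 0" by (simp add: dist1_def order_antisym sum_nonneg)
  then have "x = y" by (simp add: dist1_def sum_nonneg_eq_0_iff vec_eq_iff)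
  then show ?case by simp
next
  case (Suc n)
  have d1: "1 \<le> real (2 * CARD('d))"
    using zero_less_card_finite[where 'a='d] by linarith
  show ?case
  proof (cases "x = y")
    case True
    then show ?thesis using mult_right_mono[OF one_le_power[OF d1] nn[of x], of "Suc n"] by simp
  next
    case False
    then obtain i where i: "x $ i \<noteq> y $ i" by (auto simp: vec_eq_iff)
    show ?thesis
    proof (cases "\<bar>y $ i\<bar> \<le> \<bar>x $ i\<bar>")
      case True
      obtain z where z: "z \<in> nbrs x" "z \<in> lball L" "dist1 z y = dist1 x y - 1"
        using dist1_step[OF True i Suc.prems(1)] by blast
      have "h y \<le> (2 * CARD('d)) ^ n * h z"
        using Suc.IH[of z y] Suc.prems z by simp
      also have "\<dots> \<le> (2 * CARD('d)) ^ n * ((2 * CARD('d)) * h x)"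
        using harmonic_ge_nbr[OF nn harm[OF Suc.prems(1)] z(1)] by (intro mult_left_mono) auto
      finally show ?thesis by (simp add: mult_ac)
    next
      case False
      then have le: "\<bar>x $ i\<bar> \<le> \<bar>y $ i\<bar>" by simp
      obtain z where z: "z \<in> nbrs y" "z \<in> lball L" "dist1 z x = dist1 y x - 1"
        using dist1_step[OF le i[symmetric] Suc.prems(2)] by blast
      have "h y \<le> (2 * CARD('d)) * h z"
        using harmonic_ge_nbr[OF nn harm[OF z(2)], of y] z(1) nbrs_sym by blast
      also have "\<dots> \<le> (2 * CARD('d)) * ((2 * CARD('d)) ^ n * h x)"
        using Suc.IH[of x z] Suc.prems z by (intro mult_left_mono) (auto simp: dist1_commute)
      finally show ?thesis by (simp add: mult_ac)
    qed
  qed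
qed

lemma dist1_le_lnorm: "dist1 x y \<le> CARD('d) * lnorm (x - y)" for x y :: "int ^ 'd::finite"
proof -
  have "dist1 x y \<le> (\<Sum>i\<in>(UNIV::'d set). lnorm (x - y))"
    unfolding dist1_def of_int_sum
    by (intro sum_mono) (use component_le_lnorm[of "x - y"] in auto)
  then show ?thesis by simp
qed

section \<open>Laplacians of powers and dipoles\<close>

text \<open>
  Applied with \<open>1 + u\<close> equal to the squared ratio of the lengths of \<open>w \<plusminus> e\<^sub>i\<close> and \<open>w\<close>, where
  \<open>u = O(1/|w|)\<close>, so that the error is \<open>O(|w|\<^sup>-\<^sup>3)\<close>.
\<close>

lemma powr_neg_taylor:
  fixes \<alpha> :: real
  obtains K where "K > 0" "\<And>u. \<bar>u\<bar> \<le> 1/2 \<Longrightarrow>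
     \<bar>(1 + u) powr (-\<alpha>) - (1 - \<alpha> * u + \<alpha> * (\<alpha> + 1) / 2 * u\<^sup>2)\<bar> \<le> K * \<bar>u\<bar> ^ 3"
proof -
  define D :: "nat \<Rightarrow> real \<Rightarrow> real" where
    "D n t = (if n = 0 then (1 + t) powr (-\<alpha>)
      else if n = 1 then -\<alpha> * (1 + t) powr (-\<alpha> - 1)
      else if n = 2 then \<alpha> * (\<alpha> + 1) * (1 + t) powr (-\<alpha> - 2)
      else - \<alpha> * (\<alpha> + 1) * (\<alpha> + 2) * (1 + t) powr (-\<alpha> - 3))" for n t
  have D: "(D m has_real_derivative D (Suc m) t) (at t)" if "m < 3" "\<bar>t\<bar> \<le> 1/2" for m t
  proof -
    have t: "1 + t > 0" using that by linarith
    have "m = 0 \<or> m = 1 \<or> m = 2" using that(1) by arith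
    then consider "m = 0" | "m = 1" | "m = 2" by blast
    then show ?thesis
    proof cases
      case 1
      then show ?thesis unfolding D_def using t
        by (auto intro!: derivative_eq_intros simp: powr_diff)
    next
      case 2
      have "((\<lambda>t. -\<alpha> * (1 + t) powr (-\<alpha> - 1)) has_real_derivative
          \<alpha> * (\<alpha> + 1) * (1 + t) powr (-\<alpha> - 2)) (at t)"
        using t by (auto intro!: derivative_eq_intros simp: algebra_simps)
      then show ?thesis unfolding D_def using 2 by simp
    next
      case 3
      have "((\<lambda>t. \<alpha> * (\<alpha> + 1) * (1 + t) powr (-\<alpha> - 2)) has_real_derivative
          - \<alpha> * (\<alpha> + 1) * (\<alpha> + 2) * (1 + t) powr (-\<alpha> - 3)) (at t)"
        using t by (auto intro!: derivative_eq_intros simp: algebra_simps)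
      then show ?thesis unfolding D_def using 3 by simp
    qed
  qed
  have "compact {-1/2..1/2::real}" by simp
  moreover have "continuous_on {-1/2..1/2} (D 3)"
    unfolding D_def by (auto intro!: continuous_intros)
  ultimately have "bounded (D 3 ` {-1/2..1/2})"
    by (intro compact_imp_bounded compact_continuous_image)
  then obtain B where B: "\<And>t. t \<in> {-1/2..1/2} \<Longrightarrow> \<bar>D 3 t\<bar> \<le> B" "B > 0"
    unfolding bounded_pos by (metis image_eqI real_norm_def)
  show thesis
  proof (rule that[of B])
    fix u :: real assume u: "\<bar>u\<bar> \<le> 1/2"
    have "\<exists>t. \<bar>t\<bar> \<le> \<bar>u\<bar> \<and> D 0 u = (\<Sum>m<3. D m 0 / fact m * u ^ m) + D 3 t / fact 3 * u ^ 3"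
      using D u by (intro Maclaurin_bi_le) auto
    then obtain t where t: "\<bar>t\<bar> \<le> \<bar>u\<bar>"
      "D 0 u = (\<Sum>m<3. D m 0 / fact m * u ^ m) + D 3 t / fact 3 * u ^ 3" by blast
    have "(\<Sum>m<3. D m 0 / fact m * u ^ m) = 1 - \<alpha> * u + \<alpha> * (\<alpha> + 1) / 2 * u\<^sup>2"
      by (simp add: D_def numeral_3_eq_3 lessThan_Suc power2_eq_square)
    then have "(1 + u) powr (-\<alpha>) - (1 - \<alpha> * u + \<alpha> * (\<alpha> + 1) / 2 * u\<^sup>2) = D 3 t / 6 * u ^ 3"
      using t(2) by (simp add: D_def fact_numeral)
    moreover have "\<bar>D 3 t / 6 * u ^ 3\<bar> \<le> B * \<bar>u\<bar> ^ 3"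
    proof -
      have "t \<in> {-1/2..1/2}" unfolding atLeastAtMost_iff using t(1) u by linarith
      then have "\<bar>D 3 t\<bar> \<le> B" by (rule B(1))
      then have "\<bar>D 3 t / 6\<bar> \<le> B" by linarith
      then show ?thesis unfolding abs_mult power_abs by (rule mult_right_mono) auto
    qed
    ultimately show "\<bar>(1 + u) powr (-\<alpha>) - (1 - \<alpha> * u + \<alpha> * (\<alpha> + 1) / 2 * u\<^sup>2)\<bar> \<le> B * \<bar>u\<bar> ^ 3"
      by simp
  qed (rule B(2))
qed
lemma norm_unit_step:
  fixes w :: "real ^ 'd::finite"
  assumes "s = 1 \<or> s = -1"
  shows "(norm (w + s *\<^sub>R axis i 1))\<^sup>2 = (norm w)\<^sup>2 + (2 * s * w $ i + 1)"
  using assms by (auto simp: power2_norm_eq_inner inner_add_left inner_add_right inner_axis inner_axis' inner_axis_axis inner_diff_left inner_diff_right)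

text \<open>
  The second-order approximation of \<open>(|w| / |w + s e\<^sub>i|)\<^sup>2\<^sup>\<alpha>\<close> for a sign \<open>s\<close>.
\<close>

definition step_taylor :: "real \<Rightarrow> real ^ 'd::finite \<Rightarrow> 'd \<Rightarrow> real \<Rightarrow> real" where
  "step_taylor \<alpha> w i s = 1 - \<alpha> * ((2 * s * w $ i + 1) / (norm w)\<^sup>2)
     + \<alpha> * (\<alpha> + 1) / 2 * ((2 * s * w $ i + 1) / (norm w)\<^sup>2)\<^sup>2"

lemma step_taylor_error:
  fixes n :: nat
  obtains K where "K > 0" "\<And>(w :: real ^ 'd::finite) i s. norm w \<ge> 6 \<Longrightarrow> s = 1 \<or> s = -1 \<Longrightarrow>
     \<bar>norm w ^ n / norm (w + s *\<^sub>R axis i 1) ^ n - step_taylor (n / 2) w i s\<bar> \<le> K / norm w ^ 3"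
proof -
  define \<alpha> :: real where "\<alpha> = n / 2"
  obtain K where K: "K > 0" "\<And>u. \<bar>u\<bar> \<le> 1/2 \<Longrightarrow>
     \<bar>(1 + u) powr (-\<alpha>) - (1 - \<alpha> * u + \<alpha> * (\<alpha> + 1) / 2 * u\<^sup>2)\<bar> \<le> K * \<bar>u\<bar> ^ 3"
    using powr_neg_taylor[of \<alpha>] by blast
  show thesis
  proof (rule that[of "K * 27"])
    fix w :: "real ^ 'd" and i and s :: real
    assume w: "norm w \<ge> 6" and s: "s = 1 \<or> s = -1"
    define \<rho> where "\<rho> = norm w"
    have \<rho>: "\<rho> \<ge> 6" using w by (simp add: \<rho>_def)
    define u where "u = (2 * s * w $ i + 1) / \<rho>\<^sup>2"
    have "\<bar>w $ i\<bar> \<le> \<rho>" unfolding \<rho>_def by (rule component_le_norm_cart)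
    then have "\<bar>2 * s * w $ i + 1\<bar> \<le> 3 * \<rho>" using s \<rho> by auto
    then have "\<bar>u\<bar> \<le> 3 * \<rho> / \<rho>\<^sup>2"
      unfolding u_def abs_divide by (intro divide_mono) (use \<rho> in auto)
    also have "\<dots> = 3 / \<rho>" using \<rho> by (simp add: power2_eq_square)
    finally have u: "\<bar>u\<bar> \<le> 3 / \<rho>" .
    also have "\<dots> \<le> 1 / 2" using \<rho> by (simp add: field_simps)
    finally have u2: "\<bar>u\<bar> \<le> 1 / 2" .
    have "(norm (w + s *\<^sub>R axis i 1))\<^sup>2 = \<rho>\<^sup>2 * (1 + u)"
      unfolding norm_unit_step[OF s] \<rho>_def[symmetric] u_def distrib_left using \<rho> by simp
    then have "norm (w + s *\<^sub>R axis i 1) = \<rho> * sqrt (1 + u)"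
      using \<rho> by (metis abs_norm_cancel abs_of_nonneg order_trans real_sqrt_abs real_sqrt_mult zero_le_numeral)
    then have "\<rho> ^ n / norm (w + s *\<^sub>R axis i 1) ^ n = 1 / sqrt (1 + u) ^ n"
      using \<rho> by (simp add: power_mult_distrib)
    also have "\<dots> = (1 + u) powr (-\<alpha>)"
      using u2 by (simp add: \<alpha>_def powr_minus_divide powr_half_sqrt[symmetric] powr_powr flip: powr_realpow)
    finally have eq: "\<rho> ^ n / norm (w + s *\<^sub>R axis i 1) ^ n = (1 + u) powr (-\<alpha>)" .
    have "K * \<bar>u\<bar> ^ 3 \<le> K * (3 / \<rho>) ^ 3"
      using u K(1) by (intro mult_left_mono power_mono) auto
    also have "\<dots> = K * 27 / \<rho> ^ 3" by (simp add: power_divide)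
    finally show "\<bar>norm w ^ n / norm (w + s *\<^sub>R axis i 1) ^ n - step_taylor (n / 2) w i s\<bar> \<le> K * 27 / norm w ^ 3"
      using K(2)[OF u2] eq unfolding step_taylor_def \<alpha>_def u_def \<rho>_def by linarith
  qed (use K in auto)
qed

lemma norm_sq_eq_sum: "(norm w)\<^sup>2 = (\<Sum>i\<in>UNIV. (w $ i)\<^sup>2)" for w :: "real ^ 'd::finite"
  by (simp add: norm_vec_def L2_set_def sum_nonneg)

text \<open>
  The main term is the coefficient \<open>n (n + 2 - d)\<close>, \<open>n = 2\<alpha>\<close>, of the continuum Laplacian of
  \<open>|w|\<^sup>-\<^sup>n\<close>.
\<close>

lemma sum_step_taylor_even:
  fixes w :: "real ^ 'd::finite"
  assumes "w \<noteq> 0"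
  shows "(\<Sum>i\<in>UNIV. step_taylor \<alpha> w i 1 + step_taylor \<alpha> w i (-1) - 2)
      = 2 * \<alpha> * (2 * \<alpha> + 2 - CARD('d)) / (norm w)\<^sup>2 + \<alpha> * (\<alpha> + 1) * CARD('d) / norm w ^ 4"
proof -
  have "step_taylor \<alpha> w i 1 + step_taylor \<alpha> w i (-1) - 2
     = - 2 * \<alpha> / (norm w)\<^sup>2 + \<alpha> * (\<alpha> + 1) / norm w ^ 4 * (4 * (w $ i)\<^sup>2 + 1)" for i
    using assms by (simp add: step_taylor_def power_divide) (simp add: power2_eq_square field_simps power4_eq_xxxx)
  then have "(\<Sum>i\<in>UNIV. step_taylor \<alpha> w i 1 + step_taylor \<alpha> w i (-1) - 2)
     = (\<Sum>i\<in>UNIV. - 2 * \<alpha> / (norm w)\<^sup>2 + \<alpha> * (\<alpha> + 1) / norm w ^ 4 * (4 * (w $ i)\<^sup>2 + 1))"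
    by (intro sum.cong refl)
  also have "\<dots> = - 2 * \<alpha> / (norm w)\<^sup>2 * CARD('d) + \<alpha> * (\<alpha> + 1) / norm w ^ 4 * (4 * (\<Sum>i\<in>UNIV. (w $ i)\<^sup>2) + CARD('d))"
    by (simp only: sum.distrib sum_distrib_left[symmetric] sum_constant) simp
  also have "(\<Sum>i\<in>UNIV. (w $ i)\<^sup>2) = (norm w)\<^sup>2" by (rule norm_sq_eq_sum[symmetric])
  also have "- 2 * \<alpha> / (norm w)\<^sup>2 * CARD('d) + \<alpha> * (\<alpha> + 1) / norm w ^ 4 * (4 * (norm w)\<^sup>2 + CARD('d))
     = 2 * \<alpha> * (2 * \<alpha> + 2 - CARD('d)) / (norm w)\<^sup>2 + \<alpha> * (\<alpha> + 1) * CARD('d) / norm w ^ 4"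
    using assms by (simp add: field_simps power2_eq_square power4_eq_xxxx)
  finally show ?thesis .
qed

lemma sum_step_taylor_odd:
  fixes w v :: "real ^ 'd::finite"
  assumes "w \<noteq> 0"
  shows "(\<Sum>i\<in>UNIV. v $ i * (step_taylor \<alpha> w i 1 - step_taylor \<alpha> w i (-1)))
      = - 4 * \<alpha> * (w \<bullet> v) / (norm w)\<^sup>2 + 4 * \<alpha> * (\<alpha> + 1) * (w \<bullet> v) / norm w ^ 4"
proof -
  have "v $ i * (step_taylor \<alpha> w i 1 - step_taylor \<alpha> w i (-1))
     = (- 4 * \<alpha> / (norm w)\<^sup>2 + 4 * \<alpha> * (\<alpha> + 1) / norm w ^ 4) * (w $ i * v $ i)" for i
    using assms by (simp add: step_taylor_def power_divide) (simp add: power2_eq_square field_simps power4_eq_xxxx)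
  then have "(\<Sum>i\<in>UNIV. v $ i * (step_taylor \<alpha> w i 1 - step_taylor \<alpha> w i (-1)))
     = (\<Sum>i\<in>UNIV. (- 4 * \<alpha> / (norm w)\<^sup>2 + 4 * \<alpha> * (\<alpha> + 1) / norm w ^ 4) * (w $ i * v $ i))"
    by (intro sum.cong refl)
  also have "\<dots> = (- 4 * \<alpha> / (norm w)\<^sup>2 + 4 * \<alpha> * (\<alpha> + 1) / norm w ^ 4) * (w \<bullet> v)"
    by (simp only: sum_distrib_left[symmetric] inner_vec_def inner_real_def)
  finally show ?thesis by (simp add: algebra_simps)
qed

lemma lap_inverse_power:
  fixes n :: nat
  obtains K where "K > 0" "\<And>w :: real ^ 'd::finite. norm w \<ge> 6 \<Longrightarrow>
    \<bar>lap (\<lambda>w. 1 / norm w ^ n) w - n * (n + 2 - real CARD('d)) / norm w ^ (n + 2)\<bar> \<le> K / norm w ^ (n + 3)"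
proof -
  obtain K where K: "K > 0" "\<And>(w :: real ^ 'd) i s. norm w \<ge> 6 \<Longrightarrow> s = 1 \<or> s = -1 \<Longrightarrow>
     \<bar>norm w ^ n / norm (w + s *\<^sub>R axis i 1) ^ n - step_taylor (n / 2) w i s\<bar> \<le> K / norm w ^ 3"
    using step_taylor_error[of n] by blast
  define \<alpha> :: real where "\<alpha> = n / 2"
  define A where "A = \<alpha> * (\<alpha> + 1) * CARD('d)"
  show thesis
  proof (rule that[of "A + 2 * CARD('d) * K"])
    have "A \<ge> 0" by (simp add: A_def \<alpha>_def)
    then show "A + 2 * CARD('d) * K > 0" using K(1) by (simp add: add_nonneg_pos)
    fix w :: "real ^ 'd" assume w: "norm w \<ge> 6"
    define \<rho> where "\<rho> = norm w"
    have \<rho>: "\<rho> \<ge> 6" using w by (simp add: \<rho>_def)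
    define e where "e i s = \<rho> ^ n / norm (w + s *\<^sub>R axis i 1) ^ n - step_taylor \<alpha> w i s" for i s
    have e: "\<bar>e i s\<bar> \<le> K / \<rho> ^ 3" if "s = 1 \<or> s = -1" for i s
      using K(2)[OF w that] by (simp add: e_def \<rho>_def \<alpha>_def)
    have w0: "w \<noteq> 0" using w by auto
    have "\<rho> ^ n * lap (\<lambda>w. 1 / norm w ^ n) w
      = (\<Sum>i\<in>UNIV. (step_taylor \<alpha> w i 1 + step_taylor \<alpha> w i (-1) - 2) + (e i 1 + e i (-1)))"
      using \<rho> by (simp add: lap_def sum_distrib_left e_def) (auto simp: \<rho>_def field_simps)
    also have "\<dots> = n * (n + 2 - real CARD('d)) / \<rho>\<^sup>2 + A / \<rho> ^ 4 + (\<Sum>i\<in>UNIV. e i 1 + e i (-1))"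
      unfolding sum.distrib[where g="\<lambda>i. step_taylor \<alpha> w i 1 + step_taylor \<alpha> w i (-1) - 2"]
      using sum_step_taylor_even[OF w0, of \<alpha>] by (auto simp: \<rho>_def A_def \<alpha>_def sum.distrib sum_subtractf add.commute)
    finally have eq: "\<rho> ^ n * lap (\<lambda>w. 1 / norm w ^ n) w - n * (n + 2 - real CARD('d)) / \<rho>\<^sup>2
       = A / \<rho> ^ 4 + (\<Sum>i\<in>UNIV. e i 1 + e i (-1))" by simp
    have "\<bar>\<Sum>i\<in>UNIV. e i 1 + e i (-1)\<bar> \<le> (\<Sum>i\<in>(UNIV::'d set). 2 * (K / \<rho> ^ 3))"
      by (intro order_trans[OF sum_abs] sum_mono) (use e in \<open>smt (verit)\<close>)
    moreover have "A / \<rho> ^ 4 \<le> A / \<rho> ^ 3"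
      using \<open>A \<ge> 0\<close> \<rho> by (intro divide_left_mono power_increasing) auto
    moreover have "0 \<le> A / \<rho> ^ 4" using \<open>A \<ge> 0\<close> \<rho> by simp
    ultimately have "\<bar>A / \<rho> ^ 4 + (\<Sum>i\<in>UNIV. e i 1 + e i (-1))\<bar> \<le> (A + 2 * CARD('d) * K) / \<rho> ^ 3"
      by (simp add: add_divide_distrib mult.assoc mult.left_commute[of 2])
    then have "\<bar>\<rho> ^ n * lap (\<lambda>w. 1 / norm w ^ n) w - n * (n + 2 - real CARD('d)) / \<rho>\<^sup>2\<bar> / \<rho> ^ n
         \<le> (A + 2 * CARD('d) * K) / \<rho> ^ 3 / \<rho> ^ n"
      unfolding eq using \<rho> by (intro divide_right_mono) auto
    moreover have "\<bar>\<rho> ^ n * lap (\<lambda>w. 1 / norm w ^ n) w - n * (n + 2 - real CARD('d)) / \<rho>\<^sup>2\<bar> / \<rho> ^ n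
       = \<bar>(\<rho> ^ n * lap (\<lambda>w. 1 / norm w ^ n) w - n * (n + 2 - real CARD('d)) / \<rho>\<^sup>2) / \<rho> ^ n\<bar>"
      using \<rho> by (simp add: abs_divide)
    moreover have "(\<rho> ^ n * lap (\<lambda>w. 1 / norm w ^ n) w - n * (n + 2 - real CARD('d)) / \<rho>\<^sup>2) / \<rho> ^ n
       = lap (\<lambda>w. 1 / norm w ^ n) w - n * (n + 2 - real CARD('d)) / \<rho> ^ (n + 2)"
      using \<rho> by (simp add: diff_divide_distrib power_add power2_eq_square mult.commute)
    moreover have "(A + 2 * CARD('d) * K) / \<rho> ^ 3 / \<rho> ^ n = (A + 2 * CARD('d) * K) / \<rho> ^ (n + 3)"
      by (simp add: power_add mult.commute)
    ultimately show "\<bar>lap (\<lambda>w. 1 / norm w ^ n) w - n * (n + 2 - real CARD('d)) / norm w ^ (n + 2)\<bar>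
        \<le> (A + 2 * CARD('d) * K) / norm w ^ (n + 3)"
      unfolding \<rho>_def by metis
  qed
qed

text \<open>
  The continuum dipole field is harmonic: the even part contributes \<open>2d (w \<bullet> v)/|w|\<^sup>2\<close> and
  the odd part its negative, so that only higher-order terms survive.
\<close>

lemma lap_dipole:
  obtains K where "K > 0" "\<And>w v :: real ^ 'd::finite. norm w \<ge> 6 \<Longrightarrow>
    \<bar>lap (\<lambda>w. (w \<bullet> v) / norm w ^ CARD('d)) w\<bar> \<le> K * norm v / norm w ^ (CARD('d) + 2)"
proof -
  define d where "d = CARD('d)"
  obtain K where K: "K > 0" "\<And>(w :: real ^ 'd) i s. norm w \<ge> 6 \<Longrightarrow> s = 1 \<or> s = -1 \<Longrightarrow>
     \<bar>norm w ^ d / norm (w + s *\<^sub>R axis i 1) ^ d - step_taylor (d / 2) w i s\<bar> \<le> K / norm w ^ 3"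
    using step_taylor_error[of d] by blast
  define \<alpha> :: real where "\<alpha> = d / 2"
  define A where "A = \<alpha> * (\<alpha> + 1) * d + 4 * \<alpha> * (\<alpha> + 1)"
  show thesis
  proof (rule that[of "A + 4 * d * K"])
    have "A \<ge> 0" by (simp add: A_def \<alpha>_def)
    have "d > 0" by (simp add: d_def)
    then show "A + 4 * d * K > 0" using K(1) \<open>A \<ge> 0\<close> by (simp add: add_nonneg_pos)
    fix w v :: "real ^ 'd" assume w: "norm w \<ge> 6"
    define \<rho> where "\<rho> = norm w"
    have \<rho>: "\<rho> \<ge> 6" using w by (simp add: \<rho>_def)
    define e where "e i s = \<rho> ^ d / norm (w + s *\<^sub>R axis i 1) ^ d - step_taylor \<alpha> w i s" for i s
    have e: "\<bar>e i s\<bar> \<le> K / \<rho> ^ 3" if "s = 1 \<or> s = -1" for i s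
      using K(2)[OF w that] by (simp add: e_def \<rho>_def \<alpha>_def)
    have "\<rho> ^ d * lap (\<lambda>w. (w \<bullet> v) / norm w ^ d) w
      = (\<Sum>i\<in>UNIV. (w \<bullet> v + v $ i) * (step_taylor \<alpha> w i 1 + e i 1)
           + (w \<bullet> v - v $ i) * (step_taylor \<alpha> w i (-1) + e i (-1)) - 2 * (w \<bullet> v))"
      using \<rho> by (simp add: lap_def sum_distrib_left e_def inner_add_left inner_diff_left inner_axis inner_commute[of "axis _ 1"])
         (simp add: \<rho>_def algebra_simps)
    also have "\<dots> = (\<Sum>i\<in>UNIV. (w \<bullet> v) * (step_taylor \<alpha> w i 1 + step_taylor \<alpha> w i (-1) - 2)
       + v $ i * (step_taylor \<alpha> w i 1 - step_taylor \<alpha> w i (-1))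
       + ((w \<bullet> v) * (e i 1 + e i (-1)) + v $ i * (e i 1 - e i (-1))))"
      by (intro sum.cong) (auto simp: algebra_simps)
    also have "\<dots> = (w \<bullet> v) * (\<Sum>i\<in>UNIV. step_taylor \<alpha> w i 1 + step_taylor \<alpha> w i (-1) - 2)
       + (\<Sum>i\<in>UNIV. v $ i * (step_taylor \<alpha> w i 1 - step_taylor \<alpha> w i (-1)))
       + (\<Sum>i\<in>UNIV. (w \<bullet> v) * (e i 1 + e i (-1)) + v $ i * (e i 1 - e i (-1)))"
      by (simp only: sum.distrib sum_distrib_left)
    also have "(w \<bullet> v) * (\<Sum>i\<in>UNIV. step_taylor \<alpha> w i 1 + step_taylor \<alpha> w i (-1) - 2)
       + (\<Sum>i\<in>UNIV. v $ i * (step_taylor \<alpha> w i 1 - step_taylor \<alpha> w i (-1)))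
       = (w \<bullet> v) * A / \<rho> ^ 4"
    proof -
      have "w \<noteq> 0" using w by auto
      show ?thesis
        unfolding sum_step_taylor_even[OF \<open>w \<noteq> 0\<close>] sum_step_taylor_odd[OF \<open>w \<noteq> 0\<close>]
        by (simp add: \<rho>_def A_def \<alpha>_def d_def add_divide_distrib algebra_simps)
    qed
    finally have eq: "\<rho> ^ d * lap (\<lambda>w. (w \<bullet> v) / norm w ^ d) w = (w \<bullet> v) * A / \<rho> ^ 4
      + (\<Sum>i\<in>UNIV. (w \<bullet> v) * (e i 1 + e i (-1)) + v $ i * (e i 1 - e i (-1)))" .
    have wv: "\<bar>w \<bullet> v\<bar> \<le> \<rho> * norm v" unfolding \<rho>_def by (rule Cauchy_Schwarz_ineq2)
    have vi: "\<bar>v $ i\<bar> \<le> \<rho> * norm v" for i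
      using component_le_norm_cart[of v i] mult_right_mono[of 1 \<rho> "norm v"] \<rho> by auto
    have "\<bar>(w \<bullet> v) * (e i 1 + e i (-1)) + v $ i * (e i 1 - e i (-1))\<bar> \<le> 4 * (\<rho> * norm v * (K / \<rho> ^ 3))" for i
    proof -
      have "\<bar>(w \<bullet> v) * (e i 1 + e i (-1))\<bar> \<le> \<rho> * norm v * (2 * (K / \<rho> ^ 3))"
        unfolding abs_mult using \<rho> e[of 1 i] e[of "-1" i] by (intro mult_mono wv) auto
      moreover have "\<bar>v $ i * (e i 1 - e i (-1))\<bar> \<le> \<rho> * norm v * (2 * (K / \<rho> ^ 3))"
        unfolding abs_mult using \<rho> e[of 1 i] e[of "-1" i] by (intro mult_mono vi) auto
      ultimately show ?thesis by linarith
    qed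
    then have S: "\<bar>\<Sum>i\<in>UNIV. (w \<bullet> v) * (e i 1 + e i (-1)) + v $ i * (e i 1 - e i (-1))\<bar>
       \<le> (\<Sum>i\<in>(UNIV::'d set). 4 * (\<rho> * norm v * (K / \<rho> ^ 3)))"
      by (intro order_trans[OF sum_abs] sum_mono)
    have wA: "\<bar>(w \<bullet> v) * A / \<rho> ^ 4\<bar> \<le> A * norm v / \<rho>\<^sup>2"
    proof -
      have "\<bar>(w \<bullet> v) * A / \<rho> ^ 4\<bar> = \<bar>w \<bullet> v\<bar> * (A / \<rho> ^ 4)"
        using \<open>A \<ge> 0\<close> \<rho> by (simp add: abs_mult)
      also have "\<dots> \<le> (\<rho> * norm v) * (A / \<rho> ^ 4)"
        using wv \<open>A \<ge> 0\<close> \<rho> by (intro mult_right_mono) auto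
      also have "\<dots> = A * norm v / \<rho> ^ 3"
        using \<rho> by (simp add: eval_nat_numeral)
      also have "\<dots> \<le> A * norm v / \<rho>\<^sup>2"
        using \<open>A \<ge> 0\<close> \<rho> by (intro divide_left_mono power_increasing) auto
      finally show ?thesis .
    qed
    have r: "4 * (\<rho> * norm v * (K / \<rho> ^ 3)) = 4 * K * norm v / \<rho>\<^sup>2"
      using \<rho> by (simp add: eval_nat_numeral)
    have r2: "(\<Sum>i\<in>(UNIV::'d set). 4 * K * norm v / \<rho>\<^sup>2) = (4 * d * K) * norm v / \<rho>\<^sup>2"
      by (simp add: d_def)
    have "(A + 4 * d * K) * norm v / \<rho>\<^sup>2 = A * norm v / \<rho>\<^sup>2 + (4 * d * K) * norm v / \<rho>\<^sup>2"
      by (simp add: add_divide_distrib distrib_right)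
    then have "\<bar>\<rho> ^ d * lap (\<lambda>w. (w \<bullet> v) / norm w ^ d) w\<bar> \<le> (A + 4 * d * K) * norm v / \<rho>\<^sup>2"
      unfolding eq by (intro order_trans[OF abs_triangle_ineq])
        (use add_mono[OF wA S[unfolded r r2]] in linarith)
    then have "\<rho> ^ d * \<bar>lap (\<lambda>w. (w \<bullet> v) / norm w ^ d) w\<bar> \<le> (A + 4 * d * K) * norm v / \<rho>\<^sup>2"
      using \<rho> by (simp add: abs_mult)
    then show "\<bar>lap (\<lambda>w. (w \<bullet> v) / norm w ^ CARD('d)) w\<bar> \<le> (A + 4 * d * K) * norm v / norm w ^ (CARD('d) + 2)"
      using \<rho> unfolding \<rho>_def[symmetric] d_def[symmetric]
      by (simp add: pos_le_divide_eq power_add mult_ac power2_eq_square)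
  qed
qed

section \<open>First-step analysis of the random walk\<close>

lemma sets_srw: "sets (srw x) = sets (\<Pi>\<^sub>M n\<in>(UNIV :: nat set). count_space UNIV)"
  by (simp add: srw_def)

abbreviation "steps_measure \<equiv> (\<Pi>\<^sub>M k\<in>(UNIV :: nat set). measure_pmf (pmf_of_set (unit_steps :: (int ^ 'd::finite) set)))"

lemma measurable_walk:
  "(\<lambda>\<xi> n. x + (\<Sum>k<n. \<xi> k)) \<in> steps_measure \<rightarrow>\<^sub>M (\<Pi>\<^sub>M n\<in>(UNIV :: nat set). count_space (UNIV :: (int ^ 'd::finite) set))"
proof -
  have "(\<lambda>\<xi>. x + (\<Sum>k<n. \<xi> k)) \<in> steps_measure \<rightarrow>\<^sub>M count_space UNIV" for n
  proof (induction n)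
    case 0
    show ?case by simp
  next
    case (Suc n)
    have c: "(\<lambda>\<xi>. \<xi> n) \<in> steps_measure \<rightarrow>\<^sub>M count_space UNIV"
      using measurable_component_singleton[of n UNIV "\<lambda>_. measure_pmf (pmf_of_set unit_steps)"]
      by (simp cong: measurable_cong_sets)
    have "(\<lambda>\<xi>. (\<lambda>z w. z + w) (x + (\<Sum>k<n. \<xi> k)) (\<xi> n)) \<in> steps_measure \<rightarrow>\<^sub>M count_space UNIV"
      by (rule measurable_compose_countable[OF _ Suc.IH])
        (use c in \<open>auto intro: measurable_compose\<close>)
    then show ?case by (simp add: add.assoc)
  qed
  then show ?thesis
    by (intro measurable_PiM_single') (auto simp: space_PiM)
qed

text \<open>
  The step sequence is distributed as an independent first step put in front of a copy of itself
  (\<open>PiM_iter\<close>), and a walk built from \<open>case_nat s \<xi>\<close> is \<open>x\<close> followed by the walk from \<open>x + s\<close>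
  built from \<open>\<xi>\<close>.
\<close>

lemma srw_first_step:
  fixes x :: "int ^ 'd::finite"
  assumes E: "E \<in> sets (\<Pi>\<^sub>M n\<in>(UNIV :: nat set). count_space (UNIV :: (int ^ 'd) set))"
  shows "measure (srw x) E
    = (\<Sum>e\<in>unit_steps. measure (srw (x + e)) {X. case_nat x X \<in> E}) / (2 * CARD('d))"
proof -
  define P where "P = pmf_of_set (unit_steps :: (int ^ 'd) set)"
  define N where "N = (\<Pi>\<^sub>M n\<in>(UNIV :: nat set). count_space (UNIV :: (int ^ 'd) set))"
  define walk where "walk = (\<lambda>(x :: int ^ 'd) (\<xi> :: nat \<Rightarrow> int ^ 'd) n. x + (\<Sum>k<n. \<xi> k))"
  interpret sequence_space "measure_pmf P" by unfold_locales
  have walk [measurable]: "walk z \<in> S \<rightarrow>\<^sub>M N" for z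
    unfolding walk_def N_def P_def by (rule measurable_walk)
  have srw_eq: "srw z = distr S N (walk z)" for z
    by (simp add: srw_def walk_def N_def P_def)
  have spS: "space S = UNIV" by (simp add: space_PiM)
  have E': "E \<in> sets N" using E by (simp add: N_def)
  have step: "walk x (case_nat s \<omega>) = case_nat x (walk (x + s) \<omega>)" for s \<omega>
  proof
    fix n
    show "walk x (case_nat s \<omega>) n = case_nat x (walk (x + s) \<omega>) n"
    proof (cases n)
      case (Suc m)
      have "(\<Sum>k<Suc m. case_nat s \<omega> k) = s + (\<Sum>k<m. \<omega> k)"
        by (subst sum.lessThan_Suc_shift) simp
      then show ?thesis using Suc by (simp add: walk_def add.assoc)
    qed (simp add: walk_def)
  qed
  have cn: "(\<lambda>X. case_nat x X) \<in> N \<rightarrow>\<^sub>M N"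
    unfolding N_def
  proof (intro measurable_PiM_single')
    fix i
    show "(\<lambda>X. case_nat x X i) \<in> (\<Pi>\<^sub>M n\<in>(UNIV :: nat set). count_space UNIV) \<rightarrow>\<^sub>M count_space UNIV"
      by (cases i) auto
  qed (auto simp: space_PiM)
  have E2: "{X. case_nat x X \<in> E} \<in> sets N"
    using measurable_sets[OF cn E'] by (simp add: vimage_def N_def space_PiM)
  have case_meas: "(\<lambda>(s, \<omega>). case_nat s \<omega>) \<in> measure_pmf P \<Otimes>\<^sub>M S \<rightarrow>\<^sub>M S"
    by measurable
  define F where "F = (\<lambda>(s, \<omega>). case_nat s \<omega>) -` (walk x -` E) \<inter> space (measure_pmf P \<Otimes>\<^sub>M S)"
  have wE: "walk x -` E \<in> sets S" using measurable_sets[OF walk E'] spS by simp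
  have Fs: "F \<in> sets (measure_pmf P \<Otimes>\<^sub>M S)"
    unfolding F_def by (rule measurable_sets[OF case_meas wE])
  have "emeasure (srw x) E = emeasure S (walk x -` E)"
    unfolding srw_eq using E' by (simp add: emeasure_distr spS)
  also have "\<dots> = emeasure (distr (measure_pmf P \<Otimes>\<^sub>M S) S (\<lambda>(s, \<omega>). case_nat s \<omega>)) (walk x -` E)"
    by (simp only: PiM_iter)
  also have "\<dots> = emeasure (measure_pmf P \<Otimes>\<^sub>M S) F"
    unfolding F_def by (rule emeasure_distr[OF case_meas wE])
  also have "\<dots> = (\<integral>\<^sup>+ s. emeasure S (Pair s -` F) \<partial>measure_pmf P)"
    by (rule P.emeasure_pair_measure_alt[OF Fs])
  also have "\<dots> = (\<integral>\<^sup>+ s. emeasure (srw (x + s)) {X. case_nat x X \<in> E} \<partial>measure_pmf P)"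
  proof (intro nn_integral_cong)
    fix s
    have "Pair s -` F = walk (x + s) -` {X. case_nat x X \<in> E}"
      by (auto simp: F_def step space_pair_measure spS)
    then show "emeasure S (Pair s -` F) = emeasure (srw (x + s)) {X. case_nat x X \<in> E}"
      unfolding srw_eq using E2 by (simp add: emeasure_distr spS)
  qed
  also have "\<dots> = (\<Sum>s\<in>unit_steps. emeasure (srw (x + s)) {X. case_nat x X \<in> E}) / (2 * CARD('d))"
    unfolding P_def
    by (subst nn_integral_pmf_of_set) (auto simp: unit_steps_nonempty finite_unit_steps card_unit_steps ennreal_of_nat_eq_real_of_nat)
  also have "\<dots> = (\<Sum>s\<in>unit_steps. ennreal (measure (srw (x + s)) {X. case_nat x X \<in> E})) / ennreal (2 * CARD('d))"
    by (simp add: finite_measure.emeasure_eq_measure[OF prob_space.finite_measure[OF prob_space_srw]] ennreal_of_nat_eq_real_of_nat)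
  also have "\<dots> = ennreal ((\<Sum>e\<in>unit_steps. measure (srw (x + e)) {X. case_nat x X \<in> E}) / (2 * CARD('d)))"
    by (simp add: sum_nonneg divide_ennreal)
  finally show ?thesis
    by (simp add: finite_measure.emeasure_eq_measure[OF prob_space.finite_measure[OF prob_space_srw]] sum_nonneg)
qed

lemma sum_unit_steps:
  fixes x :: "int ^ 'd::finite"
  shows "(\<Sum>e\<in>unit_steps. f (x + e)) = (\<Sum>i\<in>UNIV. f (x + axis i 1) + f (x - axis i 1))"
proof -
  have eq: "unit_steps = (\<lambda>(i, s). axis i s :: int ^ 'd) ` (UNIV \<times> {1, -1})"
    unfolding unit_steps_def by auto
  have inj: "inj_on (\<lambda>(i, s). axis i s :: int ^ 'd) (UNIV \<times> {1, -1})"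
    by (auto simp: inj_on_def axis_eq_axis)
  have m: "axis i (-1) = - axis i (1::int)" for i by (simp add: vec_eq_iff axis_def)
  show ?thesis
    unfolding eq sum.reindex[OF inj] sum.cartesian_product[symmetric]
    by (simp add: sum.cartesian_product' m)
qed

lemma lap_eq_unit_steps:
  fixes x :: "int ^ 'd::finite"
  shows "lap f x = 2 * CARD('d) * ((\<Sum>e\<in>unit_steps. f (x + e)) / (2 * CARD('d)) - f x)"
  unfolding sum_unit_steps by (simp add: lap_def sum_subtractf right_diff_distrib)

text \<open>
  The hypothesis says that prepending the starting point \<open>x\<close> does not affect the event.
\<close>

lemma prob_srw_harmonic:
  fixes x :: "int ^ 'd::finite"
  assumes "{X. Q X} \<in> sets (\<Pi>\<^sub>M n\<in>(UNIV :: nat set). count_space (UNIV :: (int ^ 'd) set))"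
    and "\<And>X. Q (case_nat x X) \<longleftrightarrow> Q X"
  shows "lap (\<lambda>z. \<P>(X in srw z. Q X)) x = 0"
  using srw_first_step[OF assms(1), of x] assms(2)
  by (simp add: lap_eq_unit_steps space_srw)

lemma prob_srw_start:
  fixes x :: "int ^ 'd::finite"
  assumes "{X. Q X} \<in> sets (\<Pi>\<^sub>M n\<in>(UNIV :: nat set). count_space (UNIV :: (int ^ 'd) set))"
    and "\<And>X. Q (case_nat x X) \<longleftrightarrow> b"
  shows "\<P>(X in srw x. Q X) = of_bool b"
proof -
  have one: "measure (srw z) UNIV = 1" for z :: "int ^ 'd"
    using prob_space.prob_space[OF prob_space_srw[of z]] by (simp add: space_srw)
  show ?thesis
    using srw_first_step[OF assms(1), of x] assms(2) one
    by (simp add: space_srw card_unit_steps)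
qed

lemma Inf_enat_less: "Inf {enat n | n. Q n} < t \<longleftrightarrow> (\<exists>n. Q n \<and> enat n < t)"
  by (auto simp: Inf_less_iff)

lemma hit_time_finite_iff: "hit_time A X < \<infinity> \<longleftrightarrow> (\<exists>n. X n \<in> A)"
  unfolding hit_time_def Inf_enat_less by simp

lemma enat_less_exit_time_iff: "enat n < exit_time L X \<longleftrightarrow> (\<forall>m\<le>n. X m \<in> lball L)"
proof -
  have "\<not> enat n < exit_time L X \<longleftrightarrow> exit_time L X < enat (Suc n)"
    by (cases "exit_time L X") (auto simp: not_less)
  also have "\<dots> \<longleftrightarrow> (\<exists>m. X m \<notin> lball L \<and> m < Suc n)"
    unfolding exit_time_def Inf_enat_less by simp
  finally show ?thesis by (auto simp: less_Suc_eq_le)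
qed

lemma hit_before_exit_iff:
  "hit_time A X < exit_time L X \<longleftrightarrow> (\<exists>n. X n \<in> A \<and> (\<forall>m\<le>n. X m \<in> lball L))"
  unfolding hit_time_def Inf_enat_less enat_less_exit_time_iff ..

lemma exit_time_eq_iff:
  "exit_time L X = enat n \<longleftrightarrow> X n \<notin> lball L \<and> (\<forall>m<n. X m \<in> lball L)"
proof -
  have "exit_time L X = enat n \<longleftrightarrow> \<not> enat n < exit_time L X \<and> (\<forall>m<n. enat m < exit_time L X)"
  proof (cases "exit_time L X")
    case (enat k)
    then show ?thesis by (auto simp: not_less) (metis le_antisym less_irrefl linorder_not_less)
  qed simp
  also have "\<dots> \<longleftrightarrow> X n \<notin> lball L \<and> (\<forall>m<n. X m \<in> lball L)"
    unfolding enat_less_exit_time_iff by (auto simp: le_less)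
  finally show ?thesis .
qed

lemma ex_nat_case: "(\<exists>n. Q n) \<longleftrightarrow> Q 0 \<or> (\<exists>n. Q (Suc n))"
  by (metis not0_implies_Suc)

lemma all_le_case_nat: "(\<forall>m\<le>Suc n. case_nat x X m \<in> V) \<longleftrightarrow> x \<in> V \<and> (\<forall>m\<le>n. X m \<in> V)"
  unfolding less_Suc_eq_le[symmetric] by (simp add: All_less_Suc2)

lemma all_less_case_nat: "(\<forall>m<Suc n. case_nat x X m \<in> V) \<longleftrightarrow> x \<in> V \<and> (\<forall>m<n. X m \<in> V)"
  by (simp add: All_less_Suc2)

definition hit_prob :: "(int ^ 'd::finite) set \<Rightarrow> int ^ 'd \<Rightarrow> real" where
  "hit_prob A x = \<P>(X in srw x. hit_time A X < \<infinity>)"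

definition hit_inside_prob :: "(int ^ 'd::finite) set \<Rightarrow> real \<Rightarrow> int ^ 'd \<Rightarrow> real" where
  "hit_inside_prob A L x = \<P>(X in srw x. hit_time A X < exit_time L X)"

lemma pred_path [measurable]:
  "Measurable.pred (\<Pi>\<^sub>M n\<in>(UNIV :: nat set). count_space UNIV) (\<lambda>X. X n \<in> A)"
proof -
  have "(\<lambda>X. X n) \<in> (\<Pi>\<^sub>M n\<in>(UNIV :: nat set). count_space UNIV) \<rightarrow>\<^sub>M count_space UNIV" by simp
  then show ?thesis by (rule measurable_compose[where g="\<lambda>z. z \<in> A"]) simp
qed

lemma sets_path_event:
  assumes "Measurable.pred (\<Pi>\<^sub>M n\<in>(UNIV :: nat set). count_space UNIV) Q"
  shows "{X. Q X} \<in> sets (\<Pi>\<^sub>M n\<in>(UNIV :: nat set). count_space UNIV)"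
  using assms by (simp add: pred_def space_PiM)

lemma sets_hit_event: "{X. \<exists>n. X n \<in> A} \<in> sets (\<Pi>\<^sub>M n\<in>(UNIV :: nat set). count_space UNIV)"
  by (intro sets_path_event) measurable

lemma sets_hit_le_event: "{X. \<exists>k\<le>n. X k \<in> A} \<in> sets (\<Pi>\<^sub>M n\<in>(UNIV :: nat set). count_space UNIV)"
  by (intro sets_path_event) measurable

lemma sets_hit_inside_event:
  "{X. \<exists>n. X n \<in> A \<and> (\<forall>m\<le>n. X m \<in> V)} \<in> sets (\<Pi>\<^sub>M n\<in>(UNIV :: nat set). count_space UNIV)"
  by (intro sets_path_event) measurable

lemma sets_exit_event:
  "{X. \<exists>n. X n \<notin> V \<and> (\<forall>m<n. X m \<in> V) \<and> X n \<in> B} \<in> sets (\<Pi>\<^sub>M n\<in>(UNIV :: nat set). count_space UNIV)"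
  by (intro sets_path_event) measurable

lemma hit_prob_eq: "hit_prob A x = \<P>(X in srw x. \<exists>n. X n \<in> A)"
  by (simp only: hit_prob_def hit_time_finite_iff)

lemma hit_inside_prob_eq:
  "hit_inside_prob A L x = \<P>(X in srw x. \<exists>n. X n \<in> A \<and> (\<forall>m\<le>n. X m \<in> lball L))"
  by (simp only: hit_inside_prob_def hit_before_exit_iff)

lemma exit_prob_eq:
  "exit_prob L x y = \<P>(X in srw x. \<exists>n. X n \<notin> lball L \<and> (\<forall>m<n. X m \<in> lball L) \<and> X n \<in> {y})"
  by (simp only: exit_prob_def exit_time_eq_iff conj_assoc singleton_iff)

lemma prob_srw_le_1: "\<P>(X in srw x. Q X) \<le> 1"
  by (rule prob_space.prob_le_1[OF prob_space_srw])

lemma hit_prob_nonneg: "0 \<le> hit_prob A x" and hit_prob_le_1: "hit_prob A x \<le> 1"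
  by (auto simp: hit_prob_def prob_srw_le_1)

lemma hit_inside_prob_le_1: "hit_inside_prob A L x \<le> 1"
  by (simp add: hit_inside_prob_def prob_srw_le_1)

lemma exit_prob_nonneg: "0 \<le> exit_prob L x y"
  by (auto simp: exit_prob_def)

lemma prob_srw_mono:
  assumes "{X. Q' X} \<in> sets (\<Pi>\<^sub>M n\<in>(UNIV :: nat set). count_space (UNIV :: (int ^ 'd::finite) set))"
    and "\<And>X. Q X \<Longrightarrow> Q' X"
  shows "\<P>(X in srw x. Q X) \<le> \<P>(X in srw x. Q' X)"
  using assms by (intro finite_measure.finite_measure_mono[OF prob_space.finite_measure[OF prob_space_srw]])
    (auto simp: space_srw sets_srw)

lemma hit_prob_mono: "A \<subseteq> B \<Longrightarrow> hit_prob A x \<le> hit_prob B x"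
  unfolding hit_prob_eq by (intro prob_srw_mono sets_hit_event) auto

lemma hit_inside_prob_le_hit_prob: "hit_inside_prob A L x \<le> hit_prob A x"
  unfolding hit_prob_eq hit_inside_prob_eq by (intro prob_srw_mono sets_hit_event) auto

lemma hit_prob_harmonic:
  assumes "x \<notin> A"
  shows "lap (hit_prob A) x = 0"
proof -
  have "lap (\<lambda>z. \<P>(X in srw z. \<exists>n. X n \<in> A)) x = 0"
    by (rule prob_srw_harmonic[OF sets_hit_event])
      (subst ex_nat_case, use assms in simp)
  then show ?thesis by (simp add: hit_prob_eq[abs_def])
qed

lemma hit_inside_prob_start:
  assumes "x \<in> A \<or> x \<notin> lball L"
  shows "hit_inside_prob A L x = of_bool (x \<in> lball L)"
  unfolding hit_inside_prob_eq
  by (rule prob_srw_start[OF sets_hit_inside_event])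
    (subst ex_nat_case, use assms in \<open>auto simp: all_le_case_nat\<close>)

lemma hit_inside_prob_harmonic:
  assumes "x \<notin> A" "x \<in> lball L"
  shows "lap (hit_inside_prob A L) x = 0"
proof -
  have "lap (\<lambda>z. \<P>(X in srw z. \<exists>n. X n \<in> A \<and> (\<forall>m\<le>n. X m \<in> lball L))) x = 0"
    by (rule prob_srw_harmonic[OF sets_hit_inside_event])
      (subst ex_nat_case, use assms in \<open>simp add: all_le_case_nat\<close>)
  then show ?thesis by (simp add: hit_inside_prob_eq[abs_def])
qed

lemma exit_prob_start:
  assumes "x \<notin> lball L"
  shows "exit_prob L x y = of_bool (x = y)"
  unfolding exit_prob_eq
  by (rule prob_srw_start[OF sets_exit_event])
    (subst ex_nat_case, use assms in \<open>auto simp: all_less_case_nat\<close>)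

lemma exit_prob_harmonic:
  assumes "x \<in> lball L"
  shows "lap (\<lambda>z. exit_prob L z y) x = 0"
  unfolding exit_prob_eq
  by (rule prob_srw_harmonic[OF sets_exit_event])
    (subst ex_nat_case, use assms in \<open>simp add: all_less_case_nat\<close>)

text \<open>
  Induction on the time horizon bounds the probability of hitting \<open>A\<close> within \<open>n\<close> steps. Passing
  through finite horizons is what handles the unbounded domain: no value at infinity is needed.
\<close>

lemma hit_prob_le_superharmonic:
  fixes A :: "(int ^ 'd::finite) set"
  assumes nn: "\<And>z. z \<notin> A \<Longrightarrow> 0 \<le> f z"
    and super: "\<And>z. z \<notin> A \<Longrightarrow> lap f z \<le> 0"
    and bdry: "\<And>z w. z \<notin> A \<Longrightarrow> w \<in> nbrs z \<Longrightarrow> w \<in> A \<Longrightarrow> 1 \<le> f w"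
    and "x \<notin> A"
  shows "hit_prob A x \<le> f x"
proof -
  define u where "u n z = \<P>(X in srw z. \<exists>k\<le>n. X k \<in> A)" for n and z :: "int ^ 'd"
  have le: "u n z \<le> f z" if "z \<notin> A" for n z
    using that
  proof (induction n arbitrary: z)
    case 0
    have "u 0 z = of_bool (z \<in> A)" unfolding u_def
      by (rule prob_srw_start[OF sets_hit_le_event]) simp
    then show ?case using 0 nn by simp
  next
    case (Suc n)
    have nb: "u n w \<le> f w" if "w \<in> nbrs z" for w
      using Suc.IH[of w] bdry[OF Suc.prems that] prob_srw_le_1[of w "\<lambda>X. \<exists>k\<le>n. X k \<in> A"]
      by (cases "w \<in> A") (auto simp: u_def)
    have "(\<exists>k\<le>Suc n. case_nat z X k \<in> A) \<longleftrightarrow> (\<exists>k\<le>n. X k \<in> A)" for X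
      using Suc.prems unfolding less_Suc_eq_le[symmetric] by (simp add: Ex_less_Suc2)
    then have "u (Suc n) z = (\<Sum>e\<in>unit_steps. u n (z + e)) / (2 * CARD('d))"
      using srw_first_step[OF sets_hit_le_event, of z "Suc n" A] by (simp add: u_def space_srw)
    also have "\<dots> \<le> (\<Sum>e\<in>unit_steps. f (z + e)) / (2 * CARD('d))"
      unfolding sum_unit_steps by (intro divide_right_mono sum_mono add_mono nb) auto
    also have "\<dots> \<le> f z"
      using super[OF Suc.prems] unfolding lap_eq_unit_steps by (simp add: mult_le_0_iff)
    finally show ?case .
  qed
  interpret prob_space "srw x" by (rule prob_space_srw)
  have "(\<lambda>n. measure (srw x) {X. \<exists>k\<le>n. X k \<in> A}) \<longlonglongrightarrow> measure (srw x) (\<Union>n. {X. \<exists>k\<le>n. X k \<in> A})"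
    by (rule finite_Lim_measure_incseq)
      (auto simp: sets_srw sets_hit_le_event incseq_def intro: order_trans)
  moreover have "(\<Union>n::nat. {X. \<exists>k\<le>n. X k \<in> A}) = {X. \<exists>k::nat. X k \<in> A}"
  proof (intro subset_antisym subsetI)
    fix X assume "X \<in> {X. \<exists>k::nat. X k \<in> A}"
    then obtain k :: nat where "X k \<in> A" by blast
    then show "X \<in> (\<Union>n::nat. {X. \<exists>k\<le>n. X k \<in> A})" by (intro UN_I[of k]) auto
  qed auto
  ultimately have "(\<lambda>n. u n x) \<longlonglongrightarrow> hit_prob A x"
    by (simp add: u_def hit_prob_eq space_srw)
  then show ?thesis
    by (rule LIMSEQ_le_const2) (use le[OF \<open>x \<notin> A\<close>] in blast)
qed

section \<open>Hitting a distant ball\<close>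

text \<open>
  The error of \<open>\<rho>\<^sup>-\<^sup>m\<close>, \<open>m = d - 2\<close>, is \<open>O(\<rho>\<^sup>-\<^sup>m\<^sup>-\<^sup>3)\<close>, and the Laplacian of \<open>\<rho>\<^sup>-\<^sup>m\<^sup>-\<^sup>1\<close> is positive
  of exactly this order.
\<close>

lemma radial_barrier:
  assumes "CARD('d::finite) = m + 2" "m \<ge> 1"
  obtains K r where "K \<ge> 1" "r \<ge> 6"
    "\<And>w :: real ^ 'd. norm w \<ge> r \<Longrightarrow> lap (\<lambda>w. 1 / norm w ^ m - K / norm w ^ (m + 1)) w \<le> 0"
    "\<And>w :: real ^ 'd. norm w \<ge> r \<Longrightarrow> 0 \<le> lap (\<lambda>w. 1 / norm w ^ m + K / norm w ^ (m + 1)) w"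
proof -
  obtain K1 where K1: "K1 > 0" "\<And>w :: real ^ 'd. norm w \<ge> 6 \<Longrightarrow>
    \<bar>lap (\<lambda>w. 1 / norm w ^ m) w - m * (m + 2 - real CARD('d)) / norm w ^ (m + 2)\<bar> \<le> K1 / norm w ^ (m + 3)"
    using lap_inverse_power[of m] by blast
  obtain K2 where K2: "K2 > 0" "\<And>w :: real ^ 'd. norm w \<ge> 6 \<Longrightarrow>
    \<bar>lap (\<lambda>w. 1 / norm w ^ (m + 1)) w - real (m + 1) * (real (m + 1 + 2) - real CARD('d)) / norm w ^ (m + 1 + 2)\<bar>
      \<le> K2 / norm w ^ (m + 1 + 3)"
    using lap_inverse_power[of "m + 1"] by blast
  define K where "K = max 1 K1"
  have *: "\<bar>lap (\<lambda>w. 1 / norm w ^ m) w\<bar> \<le> K * lap (\<lambda>w. 1 / norm w ^ (m + 1)) w"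
    if w: "norm w \<ge> max 6 K2" for w :: "real ^ 'd"
  proof -
    define \<rho> where "\<rho> = norm w"
    have \<rho>: "\<rho> \<ge> 6" "\<rho> \<ge> K2" using w by (auto simp: \<rho>_def)
    have "K2 / \<rho> ^ (m + 4) = K2 / \<rho> / \<rho> ^ (m + 3)" using \<rho> by (simp add: eval_nat_numeral)
    also have "\<dots> \<le> 1 / \<rho> ^ (m + 3)" using \<rho> by (intro divide_right_mono) auto
    finally have "K2 / \<rho> ^ (m + 4) \<le> 1 / \<rho> ^ (m + 3)" .
    moreover have "2 / \<rho> ^ (m + 3) \<le> (real m + 1) / \<rho> ^ (m + 3)"
      using assms(2) \<rho> by (intro divide_right_mono) auto
    moreover have "real (m + 1) * (real (m + 3) - real CARD('d)) / \<rho> ^ (m + 3) - K2 / \<rho> ^ (m + 4)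
        \<le> lap (\<lambda>w. 1 / norm w ^ (m + 1)) w"
    proof -
      have e: "m + 1 + 2 = m + 3" "m + 1 + 3 = m + 4" by simp_all
      show ?thesis using K2(2)[of w, unfolded e, folded \<rho>_def, OF \<rho>(1)] by linarith
    qed
    ultimately have "1 / \<rho> ^ (m + 3) \<le> lap (\<lambda>w. 1 / norm w ^ (m + 1)) w"
      using assms(1) by (simp add: add_divide_distrib)
    then have "K * (1 / \<rho> ^ (m + 3)) \<le> K * lap (\<lambda>w. 1 / norm w ^ (m + 1)) w"
      by (intro mult_left_mono) (auto simp: K_def)
    moreover have "K1 / \<rho> ^ (m + 3) \<le> K * (1 / \<rho> ^ (m + 3))"
      using \<rho> by (simp add: divide_right_mono K_def)
    moreover have "\<bar>lap (\<lambda>w. 1 / norm w ^ m) w\<bar> \<le> K1 / \<rho> ^ (m + 3)"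
      using K1(2)[of w] \<rho>(1) assms(1) unfolding \<rho>_def[symmetric] by simp
    ultimately show ?thesis by linarith
  qed
  show thesis
  proof (rule that[of K "max 6 K2"])
    fix w :: "real ^ 'd" assume w: "norm w \<ge> max 6 K2"
    show "lap (\<lambda>w. 1 / norm w ^ m - K / norm w ^ (m + 1)) w \<le> 0"
      using *[OF w] lap_diff[of "\<lambda>w. 1 / norm w ^ m" "\<lambda>w. K * (1 / norm w ^ (m + 1))" w]
      by (simp add: lap_cmult[of K "\<lambda>w. 1 / norm w ^ (m + 1)", simplified])
    show "0 \<le> lap (\<lambda>w. 1 / norm w ^ m + K / norm w ^ (m + 1)) w"
      using *[OF w] lap_add[of "\<lambda>w. 1 / norm w ^ m" "\<lambda>w. K * (1 / norm w ^ (m + 1))" w]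
      by (simp add: lap_cmult[of K "\<lambda>w. 1 / norm w ^ (m + 1)", simplified])
  qed (auto simp: K_def)
qed

text \<open>
  A step from outside the ball lands, if inside it, at distance more than \<open>a - 1 \<ge> a/2\<close> from the
  centre. There the barrier is at least \<open>a\<^sup>-\<^sup>m (1 - 2K/a)\<close>, which is the normalisation used.
\<close>

lemma hit_ball_prob_upper:
  fixes x y :: "int ^ 'd::finite"
  assumes super: "\<And>w :: real ^ 'd. norm w \<ge> r \<Longrightarrow> lap (\<lambda>w. 1 / norm w ^ m - K / norm w ^ (m + 1)) w \<le> 0"
    and K: "K \<ge> 1" and a: "a \<ge> r" "a \<ge> 4 * K" and x: "x \<notin> lball_at a y"
  shows "hit_prob (lball_at a y) x \<le> (a / lnorm (x - y)) ^ m * (1 + 4 * K / a)"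
proof -
  have a4: "a \<ge> 4" using K a(2) by linarith
  define t where "t = 2 * K / a"
  have t: "0 \<le> t" "t \<le> 1 / 2" using K a(2) a4 by (auto simp: t_def field_simps)
  define c where "c = 1 / a ^ m * (1 - t)"
  have c: "c > 0" using t a4 by (simp add: c_def)
  define g where "g w = 1 / norm w ^ m - K / norm w ^ (m + 1)" for w :: "real ^ 'd"
  have g_eq: "g w = 1 / norm w ^ m * (1 - K / norm w)" if "norm w > 0" for w
    using that by (simp add: g_def field_simps)
  have "hit_prob (lball_at a y) x \<le> 1 / c * g (emb x - emb y)"
  proof (rule hit_prob_le_superharmonic[where f="\<lambda>z. 1 / c * g (emb z - emb y)"])
    fix z assume z: "z \<notin> lball_at a y"
    then have \<rho>: "norm (emb z - emb y) > a" by (simp add: mem_lball_at lnorm_diff)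
    then have "K / norm (emb z - emb y) \<le> 1" using K a a4 by (simp add: divide_le_eq)
    moreover have pos: "norm (emb z - emb y) > 0" using \<rho> a4 by linarith
    ultimately show "0 \<le> 1 / c * g (emb z - emb y)" using c unfolding g_eq[OF pos] by simp
    show "lap (\<lambda>z. 1 / c * g (emb z - emb y)) z \<le> 0"
      unfolding lap_cmult using super[of "emb z - emb y", folded g_def] \<rho> a c
      by (simp add: lap_emb_shift[of g] divide_le_0_iff)
    fix w assume w: "w \<in> nbrs z" "w \<in> lball_at a y"
    define \<rho>w where "\<rho>w = norm (emb w - emb y)"
    have w1: "\<rho>w \<le> a" "\<rho>w > a - 1"
      using w(2) \<rho> lnorm_nbr_le[of z w y] w(1) nbrs_sym[of w z] by (auto simp: mem_lball_at lnorm_diff \<rho>w_def)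
    then have w2: "\<rho>w \<ge> a / 2" "\<rho>w > 0" using a4 by linarith+
    have "K / \<rho>w \<le> K / (a / 2)" using w2 K a4 by (intro divide_left_mono) auto
    then have "1 - t \<le> 1 - K / \<rho>w" by (simp add: t_def mult.commute)
    moreover have "1 / a ^ m \<le> 1 / \<rho>w ^ m"
      using w1 w2 by (intro divide_left_mono power_mono) auto
    ultimately have "c \<le> 1 / \<rho>w ^ m * (1 - K / \<rho>w)"
      unfolding c_def using t a4 w2 by (intro mult_mono) auto
    then show "1 \<le> 1 / c * g (emb w - emb y)"
      using g_eq[of "emb w - emb y"] w2 c unfolding \<rho>w_def[symmetric] by (simp add: pos_le_divide_eq)
  qed (use x in auto)
  also have "\<dots> \<le> 1 / c * (1 / lnorm (x - y) ^ m)"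
    using K c by (intro mult_left_mono) (auto simp: g_def lnorm_diff)
  also have "\<dots> = (a / lnorm (x - y)) ^ m * (1 / (1 - t))"
    using a4 by (simp add: c_def power_divide)
  also have "\<dots> \<le> (a / lnorm (x - y)) ^ m * (1 + 2 * t)"
  proof (rule mult_left_mono)
    have "1 \<le> (1 + 2 * t) * (1 - t)" using t mult_nonneg_nonneg[of t "1 - 2 * t"] by (simp add: algebra_simps)
    then show "1 / (1 - t) \<le> 1 + 2 * t" using t by (simp add: divide_le_eq)
    show "0 \<le> (a / lnorm (x - y)) ^ m" using a4 by (simp add: lnorm_def)
  qed
  finally show ?thesis by (simp add: t_def)
qed

text \<open>
  The subharmonic barrier tends to zero at infinity while the hitting probability is nonnegative,
  so the minimum principle applies on a large finite annulus up to an arbitrarily small error.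
\<close>

lemma hit_ball_prob_lower:
  fixes x y :: "int ^ 'd::finite"
  assumes sub: "\<And>w :: real ^ 'd. norm w \<ge> r \<Longrightarrow> 0 \<le> lap (\<lambda>w. 1 / norm w ^ m + K / norm w ^ (m + 1)) w"
    and m: "m \<ge> 1" and K: "K \<ge> 1" and a: "a \<ge> r" "a \<ge> 4 * K" and x: "x \<notin> lball_at a y"
  shows "hit_prob (lball_at a y) x \<ge> (a / lnorm (x - y)) ^ m * (1 - (m + 2 * K) / a)"
proof -
  have a4: "a \<ge> 4" using K a(2) by linarith
  define c where "c = 1 / (a - 1) ^ m * (1 + K / (a - 1))"
  have c: "c > 0" using K a4 by (simp add: c_def add_pos_nonneg)
  define g where "g w = 1 / norm w ^ m + K / norm w ^ (m + 1)" for w :: "real ^ 'd"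
  have g_eq: "g w = 1 / norm w ^ m * (1 + K / norm w)" if "norm w > 0" for w
    using that by (simp add: g_def field_simps)
  have g_small: "g w \<le> (1 + K) / norm w" if w: "norm w \<ge> 1" for w
  proof -
    have w0: "0 < norm w" using w by linarith
    have "1 / norm w ^ m \<le> 1 / norm w ^ 1"
      using w m by (intro divide_left_mono power_increasing mult_pos_pos zero_less_power w0) auto
    moreover have "K / norm w ^ (m + 1) \<le> K / norm w ^ 1"
      using w K by (intro divide_left_mono power_increasing mult_pos_pos zero_less_power w0) auto
    ultimately show ?thesis by (simp add: g_def add_divide_distrib)
  qed
  have "1 / c * g (emb x - emb y) \<le> hit_prob (lball_at a y) x + e" if e: "e > 0" for e
  proof -
    define M where "M = max (lnorm (x - y)) (max 1 ((1 + K) / (c * e)))"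
    define V where "V = lball_at M y - lball_at a y"
    have "0 \<le> (hit_prob (lball_at a y) x + e) - 1 / c * g (emb x - emb y)"
    proof (rule lap_nonneg_minimum_principle[where V=V and h="\<lambda>x. (hit_prob (lball_at a y) x + e) - 1 / c * g (emb x - emb y)"])
      show "finite V" by (simp add: V_def finite_lball_at)
      show "x \<in> V" using x by (simp add: V_def M_def mem_lball_at)
      fix z assume z: "z \<in> V"
      then have \<rho>: "norm (emb z - emb y) > a" by (simp add: V_def mem_lball_at lnorm_diff)
      have "0 \<le> lap g (emb z - emb y)" using sub[of "emb z - emb y"] \<rho> a by (simp add: g_def[abs_def])
      moreover have "lap (hit_prob (lball_at a y)) z = 0" using z by (intro hit_prob_harmonic) (simp add: V_def)
      ultimately show "lap (\<lambda>x. (hit_prob (lball_at a y) x + e) - 1 / c * g (emb x - emb y)) z \<le> 0"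
        using c unfolding lap_diff lap_add lap_cmult lap_const lap_emb_shift by simp
      fix w assume w: "w \<in> nbrs z" "w \<notin> V"
      define \<rho>w where "\<rho>w = norm (emb w - emb y)"
      have w1: "\<rho>w > a - 1"
        using \<rho> lnorm_nbr_le[of z w y] w(1) nbrs_sym[of w z] by (auto simp: lnorm_diff \<rho>w_def)
      show "0 \<le> (hit_prob (lball_at a y) w + e) - 1 / c * g (emb w - emb y)"
      proof (cases "w \<in> lball_at a y")
        case True
        have "K / \<rho>w \<le> K / (a - 1)" using w1 K a4 by (intro divide_left_mono) auto
        moreover have "1 / \<rho>w ^ m \<le> 1 / (a - 1) ^ m"
          using w1 a4 by (intro divide_left_mono power_mono) auto
        ultimately have "1 / \<rho>w ^ m * (1 + K / \<rho>w) \<le> c"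
          unfolding c_def using w1 a4 K by (intro mult_mono add_mono) auto
        then have "g (emb w - emb y) \<le> c" using g_eq[of "emb w - emb y"] w1 a4 unfolding \<rho>w_def[symmetric] by simp
        then have "1 / c * g (emb w - emb y) \<le> 1" using c by simp
        moreover have "hit_prob (lball_at a y) w = 1"
          unfolding hit_prob_eq using prob_srw_start[OF sets_hit_event, of w "lball_at a y" True] True
          by (metis (mono_tags, lifting) nat.case(1) of_bool_eq(2))
        ultimately show ?thesis using e by simp
      next
        case False
        then have "\<rho>w > M" using w(2) by (simp add: V_def mem_lball_at lnorm_diff \<rho>w_def)
        then have big: "\<rho>w \<ge> 1" "\<rho>w \<ge> (1 + K) / (c * e)" by (auto simp: M_def)
        then have "(1 + K) / \<rho>w \<le> c * e" using c e by (simp add: divide_le_eq mult.commute)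
        then have "g (emb w - emb y) \<le> c * e" using g_small[of "emb w - emb y"] big(1) by (simp add: \<rho>w_def)
        then have "1 / c * g (emb w - emb y) \<le> e" using c by (simp add: divide_le_eq mult.commute)
        then show ?thesis using hit_prob_nonneg[of "lball_at a y" w] by linarith
      qed
    qed
    then show ?thesis by simp
  qed
  then have main: "1 / c * g (emb x - emb y) \<le> hit_prob (lball_at a y) x"
    by (rule field_le_epsilon)
  define b where "b = 1 - 1 / a"
  have b: "0 \<le> b" using a4 by (simp add: b_def)
  have "1 - 2 * K / a \<le> 1 - K / (a - 1)"
    using a4 K by (simp add: field_simps)
  also have "\<dots> \<le> 1 / (1 + K / (a - 1))"
    using a4 K by (simp add: field_simps)
  finally have K_le: "1 - 2 * K / a \<le> 1 / (1 + K / (a - 1))" .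
  have "1 - m / a \<le> b ^ m"
    using Bernoulli_inequality[of "- 1 / a" m] a4 by (simp add: b_def)
  then have "(1 - m / a) * (1 - 2 * K / a) \<le> b ^ m * (1 / (1 + K / (a - 1)))"
    using K_le b a K a4 by (intro mult_mono) (auto simp: divide_le_eq)
  moreover have "1 - (m + 2 * K) / a \<le> (1 - m / a) * (1 - 2 * K / a)"
    using K a4 by (simp add: field_simps)
  ultimately have "(a / lnorm (x - y)) ^ m * (1 - (m + 2 * K) / a)
      \<le> (a / lnorm (x - y)) ^ m * (b ^ m * (1 / (1 + K / (a - 1))))"
    using a4 by (intro mult_left_mono) (auto simp: lnorm_def)
  also have "\<dots> = 1 / c * (1 / lnorm (x - y) ^ m)"
  proof -
    have "a * b = a - 1" using a4 by (simp add: b_def field_simps)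
    then have "(a / lnorm (x - y)) ^ m * b ^ m = (a - 1) ^ m / lnorm (x - y) ^ m"
      by (metis power_divide power_mult_distrib times_divide_eq_left)
    then show ?thesis by (simp add: c_def flip: mult.assoc)
  qed
  also have "\<dots> \<le> 1 / c * g (emb x - emb y)"
    using c K by (intro mult_left_mono) (auto simp: g_def lnorm_diff)
  finally show ?thesis using main by linarith
qed

text \<open>
  For \<open>a\<close> below the threshold of the barriers, monotonicity in the ball reduces to the
  threshold radius: there only boundedness of the ratio is needed, as \<open>1/a\<close> is bounded below.
\<close>

lemma hit_ball_prob_asymptotics:
  assumes "CARD('d::finite) \<ge> 3"
  shows "\<exists>C>0. \<forall>(a::real) (x :: int ^ 'd) y. a \<ge> 1 \<and> x \<notin> lball_at a y \<longrightarrow>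
    \<bar>hit_prob (lball_at a y) x - (a / lnorm (x - y)) ^ (CARD('d) - 2)\<bar>
       \<le> C * inverse a * (a / lnorm (x - y)) ^ (CARD('d) - 2)"
proof -
  define m where "m = CARD('d) - 2"
  have m: "CARD('d) = m + 2" "m \<ge> 1" using assms by (auto simp: m_def)
  obtain K r where K: "K \<ge> 1" "r \<ge> 6"
    "\<And>w :: real ^ 'd. norm w \<ge> r \<Longrightarrow> lap (\<lambda>w. 1 / norm w ^ m - K / norm w ^ (m + 1)) w \<le> 0"
    "\<And>w :: real ^ 'd. norm w \<ge> r \<Longrightarrow> 0 \<le> lap (\<lambda>w. 1 / norm w ^ m + K / norm w ^ (m + 1)) w"
    using radial_barrier[OF m] by blast
  define a1 where "a1 = max r (4 * K)"
  have a1: "a1 \<ge> r" "a1 \<ge> 4 * K" "a1 \<ge> 6" using K by (auto simp: a1_def)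
  define C1 where "C1 = m + 4 * K"
  have C1: "C1 \<ge> 0" using K by (simp add: C1_def)
  have large: "\<bar>hit_prob (lball_at a y) x - (a / lnorm (x - y)) ^ m\<bar> \<le> C1 / a * (a / lnorm (x - y)) ^ m"
    if a: "a \<ge> a1" and x: "x \<notin> lball_at a y" for a and x y :: "int ^ 'd"
  proof -
    define T where "T = (a / lnorm (x - y)) ^ m"
    have T: "T \<ge> 0" using a a1 by (simp add: T_def lnorm_def)
    have "hit_prob (lball_at a y) x \<le> T * (1 + 4 * K / a)"
      unfolding T_def using hit_ball_prob_upper[OF K(3,1) _ _ x] a a1 by simp
    moreover have "T * (1 - (m + 2 * K) / a) \<le> hit_prob (lball_at a y) x"
      unfolding T_def using hit_ball_prob_lower[OF K(4) m(2) K(1) _ _ x] a a1 by simp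
    moreover have "T * (4 * K / a) \<le> T * (C1 / a)" "T * ((m + 2 * K) / a) \<le> T * (C1 / a)"
      using T K a a1 by (auto intro!: mult_left_mono divide_right_mono simp: C1_def)
    ultimately show ?thesis unfolding T_def[symmetric] by (simp add: abs_le_iff algebra_simps)
  qed
  define C where "C = max C1 (a1 * (1 + (1 + C1) * a1 ^ m))"
  have C: "C \<ge> C1" "C \<ge> a1 * (1 + (1 + C1) * a1 ^ m)" by (auto simp: C_def)
  have "C > 0"
    by (rule less_le_trans[OF _ C(2)]) (use a1 C1 in \<open>auto intro!: mult_pos_pos add_pos_nonneg\<close>)
  moreover have "\<bar>hit_prob (lball_at a y) x - (a / lnorm (x - y)) ^ m\<bar> \<le> C * inverse a * (a / lnorm (x - y)) ^ m"
    if a: "a \<ge> 1" and x: "x \<notin> lball_at a y" for a and x y :: "int ^ 'd"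
  proof (cases "a \<ge> a1")
    case True
    have "C1 / a * (a / lnorm (x - y)) ^ m \<le> C * inverse a * (a / lnorm (x - y)) ^ m"
      using C(1) a by (intro mult_right_mono) (auto simp: divide_simps lnorm_def)
    then show ?thesis using large[OF True x] by linarith
  next
    case False
    define T where "T = (a / lnorm (x - y)) ^ m"
    have \<rho>: "lnorm (x - y) > a" using x by (simp add: mem_lball_at)
    have T: "T \<ge> 0" using a by (simp add: T_def lnorm_def)
    have scale: "(a1 / lnorm (x - y)) ^ m \<le> a1 ^ m * T"
      unfolding T_def power_mult_distrib[symmetric]
      using \<rho> a a1 by (intro power_mono) (auto simp: divide_simps)
    have "hit_prob (lball_at a y) x \<le> (1 + C1) * (a1 ^ m * T)"
    proof (cases "x \<in> lball_at a1 y")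
      case True
      then have "1 \<le> (a1 / lnorm (x - y)) ^ m"
        using \<rho> a by (intro one_le_power) (auto simp: mem_lball_at)
      then have "1 \<le> a1 ^ m * T" using scale by linarith
      then have "1 * 1 \<le> (1 + C1) * (a1 ^ m * T)" using C1 by (intro mult_mono) auto
      then show ?thesis using hit_prob_le_1[of "lball_at a y" x] by linarith
    next
      case x1: False
      have "hit_prob (lball_at a y) x \<le> hit_prob (lball_at a1 y) x"
        using False by (intro hit_prob_mono) (auto simp: mem_lball_at)
      also have "\<dots> \<le> (1 + C1 / a1) * (a1 / lnorm (x - y)) ^ m"
        using large[OF order_refl x1] by (simp add: abs_le_iff algebra_simps)
      also have "\<dots> \<le> (1 + C1) * (a1 ^ m * T)"
        using scale C1 a1 by (intro mult_mono) (auto simp: divide_le_eq lnorm_def mult_le_cancel_left1)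
      finally show ?thesis .
    qed
    moreover have "0 \<le> hit_prob (lball_at a y) x" by (rule hit_prob_nonneg)
    moreover have "0 \<le> (1 + C1) * (a1 ^ m * T)" using C1 T a1 by simp
    ultimately have "\<bar>hit_prob (lball_at a y) x - T\<bar> \<le> (1 + (1 + C1) * a1 ^ m) * T"
      using T by (simp add: abs_le_iff algebra_simps)
    also have "\<dots> \<le> C * inverse a * T"
    proof (rule mult_right_mono[OF _ T])
      have "a * (1 + (1 + C1) * a1 ^ m) \<le> a1 * (1 + (1 + C1) * a1 ^ m)"
        using False C1 a1 by (intro mult_right_mono) auto
      then show "1 + (1 + C1) * a1 ^ m \<le> C * inverse a"
        using C(2) a by (simp add: divide_simps mult.commute)
    qed
    finally show ?thesis by (simp add: T_def)
  qed
  ultimately show ?thesis unfolding m_def by blast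
qed

section \<open>The Poisson kernel as a barrier\<close>

text \<open>
  Up to a constant, the Poisson kernel of the ball of radius \<open>|v|\<close> with pole at its boundary
  point \<open>v\<close>.
\<close>

definition poisson_kernel :: "real ^ 'd::finite \<Rightarrow> real ^ 'd \<Rightarrow> real" where
  "poisson_kernel v x = ((norm v)\<^sup>2 - (norm x)\<^sup>2) / (norm v * norm (x - v) ^ CARD('d))"

lemma poisson_kernel_factor:
  "poisson_kernel v x = (norm v - norm x) * (norm v + norm x) / norm v / norm (x - v) ^ CARD('d)"
  for x :: "real ^ 'd::finite"
  by (simp add: poisson_kernel_def power2_eq_square algebra_simps)

text \<open>
  Seen from its pole, the Poisson kernel is a point source plus a dipole.
\<close>

lemma poisson_kernel_sources:
  fixes v x :: "real ^ 'd::finite"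
  assumes "CARD('d) = m + 2" "m \<ge> 1"
  shows "poisson_kernel v x
    = (- 1 / norm v) * (1 / norm (x - v) ^ m) - 2 / norm v * (((x - v) \<bullet> v) / norm (x - v) ^ CARD('d))"
proof (cases "x = v")
  case True
  then show ?thesis using assms by (simp add: poisson_kernel_def)
next
  case False
  have "(norm x)\<^sup>2 = (norm (x - v))\<^sup>2 + 2 * ((x - v) \<bullet> v) + (norm v)\<^sup>2"
    by (simp add: power2_norm_eq_inner inner_diff_left inner_diff_right inner_commute)
  then have "poisson_kernel v x = (- (norm (x - v))\<^sup>2 - 2 * ((x - v) \<bullet> v)) / (norm v * norm (x - v) ^ CARD('d))"
    by (simp add: poisson_kernel_def)
  also have "\<dots> = - ((norm (x - v))\<^sup>2 / (norm v * norm (x - v) ^ CARD('d))) - 2 * ((x - v) \<bullet> v) / (norm v * norm (x - v) ^ CARD('d))"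
    by (simp add: diff_divide_distrib)
  also have "(norm (x - v))\<^sup>2 / (norm v * norm (x - v) ^ CARD('d)) = 1 / norm v * (1 / norm (x - v) ^ m)"
    using False assms(1) by (simp add: power_add power2_eq_square)
  finally show ?thesis by simp
qed

text \<open>
  The error of the kernel is \<open>O(\<rho>\<^sup>-\<^sup>d\<^sup>-\<^sup>2)\<close>; the point source contributes \<open>O(\<rho>\<^sup>-\<^sup>d\<^sup>-\<^sup>1 / |v|)\<close>, which is
  of this order because \<open>\<rho> \<le> 3 |v|\<close>. The Laplacian of \<open>\<rho>\<^sup>-\<^sup>d\<close> is about \<open>2d \<rho>\<^sup>-\<^sup>d\<^sup>-\<^sup>2\<close>.
\<close>

lemma poisson_kernel_barrier:
  assumes "CARD('d::finite) = m + 2" "m \<ge> 1"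
  obtains \<kappa> r where "\<kappa> \<ge> 1" "r \<ge> 6"
    "\<And>v x :: real ^ 'd. v \<noteq> 0 \<Longrightarrow> r \<le> norm (x - v) \<Longrightarrow> norm (x - v) \<le> 3 * norm v \<Longrightarrow>
       lap (\<lambda>x. poisson_kernel v x - \<kappa> / norm (x - v) ^ CARD('d)) x \<le> 0"
    "\<And>v x :: real ^ 'd. v \<noteq> 0 \<Longrightarrow> r \<le> norm (x - v) \<Longrightarrow> norm (x - v) \<le> 3 * norm v \<Longrightarrow>
       0 \<le> lap (\<lambda>x. poisson_kernel v x + \<kappa> / norm (x - v) ^ CARD('d)) x"
proof -
  define d where "d = CARD('d)"
  have d: "d = m + 2" using assms by (simp add: d_def)
  obtain K1 where K1: "K1 > 0" "\<And>w :: real ^ 'd. norm w \<ge> 6 \<Longrightarrow>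
    \<bar>lap (\<lambda>w. 1 / norm w ^ m) w - m * (m + 2 - real CARD('d)) / norm w ^ (m + 2)\<bar> \<le> K1 / norm w ^ (m + 3)"
    using lap_inverse_power[of m] by blast
  obtain K2 where K2: "K2 > 0" "\<And>w :: real ^ 'd. norm w \<ge> 6 \<Longrightarrow>
    \<bar>lap (\<lambda>w. 1 / norm w ^ d) w - d * (d + 2 - real CARD('d)) / norm w ^ (d + 2)\<bar> \<le> K2 / norm w ^ (d + 3)"
    using lap_inverse_power[of d] by blast
  obtain K3 where K3: "K3 > 0" "\<And>w v :: real ^ 'd. norm w \<ge> 6 \<Longrightarrow>
    \<bar>lap (\<lambda>w. (w \<bullet> v) / norm w ^ CARD('d)) w\<bar> \<le> K3 * norm v / norm w ^ (CARD('d) + 2)"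
    using lap_dipole by blast
  define \<kappa> where "\<kappa> = 1 + 3 * K1 + 2 * K3"
  have *: "\<bar>lap (poisson_kernel v) x\<bar> \<le> \<kappa> * lap (\<lambda>x. 1 / norm (x - v) ^ d) x"
    if v: "v \<noteq> 0" and x: "max 6 K2 \<le> norm (x - v)" "norm (x - v) \<le> 3 * norm v" for v x :: "real ^ 'd"
  proof -
    define w where "w = x - v"
    define \<rho> where "\<rho> = norm w"
    define R where "R = norm v"
    have \<rho>: "\<rho> \<ge> 6" "\<rho> \<ge> K2" "\<rho> \<le> 3 * R" using x by (auto simp: \<rho>_def w_def R_def)
    have R: "R > 0" using v by (simp add: R_def)
    define h where "h w = (- 1 / R) * (1 / norm w ^ m) - 2 / R * ((w \<bullet> v) / norm w ^ CARD('d))" for w :: "real ^ 'd"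
    have "poisson_kernel v = (\<lambda>x. h (x - v))"
      unfolding h_def R_def using poisson_kernel_sources[OF assms, of v] by blast
    then have "lap (poisson_kernel v) x = lap h w" by (simp add: lap_shift w_def)
    also have "\<dots> = (- 1 / R) * lap (\<lambda>w. 1 / norm w ^ m) w - 2 / R * lap (\<lambda>w. (w \<bullet> v) / norm w ^ CARD('d)) w"
      unfolding h_def[abs_def] lap_diff lap_cmult ..
    finally have "\<bar>lap (poisson_kernel v) x\<bar>
       \<le> \<bar>(- 1 / R) * lap (\<lambda>w. 1 / norm w ^ m) w\<bar> + \<bar>2 / R * lap (\<lambda>w. (w \<bullet> v) / norm w ^ CARD('d)) w\<bar>"
      by linarith
    also have "\<dots> = 1 / R * \<bar>lap (\<lambda>w. 1 / norm w ^ m) w\<bar> + 2 / R * \<bar>lap (\<lambda>w. (w \<bullet> v) / norm w ^ CARD('d)) w\<bar>"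
      using R by (simp add: abs_mult)
    also have "\<dots> \<le> 1 / R * (K1 / \<rho> ^ (m + 3)) + 2 / R * (K3 * R / \<rho> ^ (d + 2))"
    proof (intro add_mono mult_left_mono)
      show "\<bar>lap (\<lambda>w. 1 / norm w ^ m) w\<bar> \<le> K1 / \<rho> ^ (m + 3)"
        using K1(2)[of w] \<rho>(1) assms(1) unfolding \<rho>_def[symmetric] by simp
      show "\<bar>lap (\<lambda>w. (w \<bullet> v) / norm w ^ CARD('d)) w\<bar> \<le> K3 * R / \<rho> ^ (d + 2)"
        using K3(2)[of w v] \<rho>(1) unfolding \<rho>_def[symmetric] R_def d_def by simp
    qed (use R in auto)
    also have "1 / R * (K1 / \<rho> ^ (m + 3)) \<le> 3 / \<rho> * (K1 / \<rho> ^ (m + 3))"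
      using \<rho> R K1(1) by (intro mult_right_mono) (auto simp: divide_simps)
    also have "3 / \<rho> * (K1 / \<rho> ^ (m + 3)) = 3 * K1 * (1 / \<rho> ^ (d + 2))"
      by (simp add: d eval_nat_numeral)
    also have "2 / R * (K3 * R / \<rho> ^ (d + 2)) = 2 * K3 * (1 / \<rho> ^ (d + 2))"
      using R by simp
    also have "3 * K1 * (1 / \<rho> ^ (d + 2)) + 2 * K3 * (1 / \<rho> ^ (d + 2)) \<le> \<kappa> * (1 / \<rho> ^ (d + 2))"
      unfolding distrib_right[symmetric] using \<rho> by (intro mult_right_mono) (auto simp: \<kappa>_def)
    finally have A: "\<bar>lap (poisson_kernel v) x\<bar> \<le> \<kappa> * (1 / \<rho> ^ (d + 2))" by simp
    have "K2 / \<rho> ^ (d + 3) = K2 / \<rho> / \<rho> ^ (d + 2)" using \<rho> by (simp add: eval_nat_numeral)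
    also have "\<dots> \<le> 1 / \<rho> ^ (d + 2)" using \<rho> by (intro divide_right_mono) auto
    finally have B: "K2 / \<rho> ^ (d + 3) \<le> 1 / \<rho> ^ (d + 2)" .
    have "2 / \<rho> ^ (d + 2) \<le> d * (d + 2 - real CARD('d)) / \<rho> ^ (d + 2)"
      using d \<rho> by (intro divide_right_mono) (auto simp: d_def[symmetric])
    then have "1 / \<rho> ^ (d + 2) \<le> lap (\<lambda>w. 1 / norm w ^ d) w"
      using K2(2)[of w] \<rho>(1) B unfolding \<rho>_def[symmetric] by (simp add: abs_le_iff)
    then have "1 / \<rho> ^ (d + 2) \<le> lap (\<lambda>x. 1 / norm (x - v) ^ d) x"
      using lap_shift[of "\<lambda>w. 1 / norm w ^ d" v x] by (simp add: w_def)
    then have "\<kappa> * (1 / \<rho> ^ (d + 2)) \<le> \<kappa> * lap (\<lambda>x. 1 / norm (x - v) ^ d) x"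
      using K1 K3 by (intro mult_left_mono) (auto simp: \<kappa>_def)
    then show ?thesis using A by linarith
  qed
  show thesis
  proof (rule that[of \<kappa> "max 6 K2"])
    fix v x :: "real ^ 'd"
    assume v: "v \<noteq> 0" and x: "max 6 K2 \<le> norm (x - v)" "norm (x - v) \<le> 3 * norm v"
    have e: "(\<lambda>x. \<kappa> / norm (x - v) ^ CARD('d)) = (\<lambda>x. \<kappa> * (1 / norm (x - v) ^ d))"
      by (simp add: d_def)
    show "lap (\<lambda>x. poisson_kernel v x - \<kappa> / norm (x - v) ^ CARD('d)) x \<le> 0"
      using *[OF v x] unfolding lap_diff e lap_cmult by linarith
    show "0 \<le> lap (\<lambda>x. poisson_kernel v x + \<kappa> / norm (x - v) ^ CARD('d)) x"
      using *[OF v x] unfolding lap_add e lap_cmult by linarith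
  qed (use K1 K3 in \<open>auto simp: \<kappa>_def\<close>)
qed

definition poisson_super :: "real \<Rightarrow> real ^ 'd::finite \<Rightarrow> real ^ 'd \<Rightarrow> real" where
  "poisson_super \<kappa> v x = poisson_kernel v x - \<kappa> / norm (x - v) ^ CARD('d)"

text \<open>
  The pole lies at distance \<open>c\<close> outside the ball, so \<open>V\<^sub>L\<close> stays away from it, and at all points
  of norm at most \<open>L + 1\<close>, hence on the outer boundary, the kernel is at least
  \<open>(c - 1) \<rho>\<^sup>-\<^sup>d \<ge> 2\<kappa> \<rho>\<^sup>-\<^sup>d\<close>, twice the correction.
\<close>

lemma lball_poisson_barrier:
  assumes "CARD('d::finite) \<ge> 3"
  obtains c \<kappa> where "c \<ge> 2"
    "\<And>L (v :: real ^ 'd) x. L > 0 \<Longrightarrow> norm v = L + c \<Longrightarrow> x \<in> lball L \<Longrightarrow> lap (\<lambda>z. poisson_super \<kappa> v (emb z)) x \<le> 0"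
    "\<And>L (v :: real ^ 'd) z. L > 0 \<Longrightarrow> norm v = L + c \<Longrightarrow> norm z \<le> L + 1 \<Longrightarrow> (L + c - norm z) / 2 / norm (z - v) ^ CARD('d) \<le> poisson_super \<kappa> v z"
    "\<And>L (v :: real ^ 'd) z. L > 0 \<Longrightarrow> norm v = L + c \<Longrightarrow> norm z \<le> L + 1 \<Longrightarrow> poisson_super \<kappa> v z \<le> 2 * (L + c - norm z) / norm (z - v) ^ CARD('d)"
proof -
  define m where "m = CARD('d) - 2"
  have m: "CARD('d) = m + 2" "m \<ge> 1" using assms by (auto simp: m_def)
  obtain \<kappa> r where \<kappa>: "\<kappa> \<ge> 1" "r \<ge> 6"
    "\<And>v x :: real ^ 'd. v \<noteq> 0 \<Longrightarrow> r \<le> norm (x - v) \<Longrightarrow> norm (x - v) \<le> 3 * norm v \<Longrightarrow>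
       lap (\<lambda>x. poisson_kernel v x - \<kappa> / norm (x - v) ^ CARD('d)) x \<le> 0"
    "\<And>v x :: real ^ 'd. v \<noteq> 0 \<Longrightarrow> r \<le> norm (x - v) \<Longrightarrow> norm (x - v) \<le> 3 * norm v \<Longrightarrow>
       0 \<le> lap (\<lambda>x. poisson_kernel v x + \<kappa> / norm (x - v) ^ CARD('d)) x"
    using poisson_kernel_barrier[OF m] by blast
  define c where "c = max r (2 * \<kappa> + 1)"
  have c: "c \<ge> r" "c \<ge> 2 * \<kappa> + 1" by (auto simp: c_def)
  show thesis
  proof (rule that[of c \<kappa>])
    show "c \<ge> 2" using c \<kappa> by linarith
    fix L :: real and v :: "real ^ 'd" assume L: "L > 0" and v: "norm v = L + c"
    show "lap (\<lambda>z. poisson_super \<kappa> v (emb z)) x \<le> 0" if x: "x \<in> lball L" for x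
    proof -
      have nx: "norm (emb x) \<le> L" using x by (simp add: lball_def lnorm_def)
      have "c \<le> norm (emb x - v)"
        using norm_triangle_ineq2[of v "emb x"] nx v by (simp add: norm_minus_commute)
      moreover have "norm (emb x - v) \<le> 3 * norm v"
        using norm_triangle_ineq4[of "emb x" v] nx v L c \<kappa> by linarith
      moreover have "v \<noteq> 0" using v L c \<kappa> by auto
      ultimately show ?thesis 
        unfolding lap_emb[of "poisson_super \<kappa> v"] unfolding poisson_super_def[abs_def] using \<kappa>(3)[of v "emb x"] c by linarith
    qed
    fix z :: "real ^ 'd" assume z: "norm z \<le> L + 1"
    define P where "P = norm (z - v) ^ CARD('d)"
    have P: "P \<ge> 0" by (simp add: P_def)
    define q where "q = (norm v - norm z) * (norm v + norm z) / norm v"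
    have R: "norm v > 0" "norm v - norm z \<ge> 2 * \<kappa>" using v L c \<kappa> z by auto
    have \<phi>: "poisson_super \<kappa> v z = (q - \<kappa>) / P"
      by (simp add: poisson_super_def poisson_kernel_factor q_def P_def diff_divide_distrib)
    have "(norm v - norm z) * norm v \<le> (norm v - norm z) * (norm v + norm z)"
      using R \<kappa> by (intro mult_left_mono) auto
    then have q1: "norm v - norm z \<le> q" using R by (simp add: q_def pos_le_divide_eq)
    have "(norm v - norm z) * (norm v + norm z) \<le> (norm v - norm z) * (2 * norm v)"
      using R \<kappa> by (intro mult_left_mono) auto
    then have q2: "q \<le> 2 * (norm v - norm z)" using R by (simp add: q_def pos_divide_le_eq mult_ac)
    show "(L + c - norm z) / 2 / norm (z - v) ^ CARD('d) \<le> poisson_super \<kappa> v z"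
      unfolding \<phi> P_def[symmetric] using q1 R v P by (intro divide_right_mono) auto
    show "poisson_super \<kappa> v z \<le> 2 * (L + c - norm z) / norm (z - v) ^ CARD('d)"
      unfolding \<phi> P_def[symmetric] using q2 \<kappa> v P by (intro divide_right_mono) auto
  qed
qed

section \<open>Exit distribution of a lattice ball\<close>

lemma nbrs_if_lnorm_eq_1:
  fixes x y :: "int ^ 'd::finite"
  assumes "lnorm (x - y) = 1"
  shows "x \<in> nbrs y"
proof -
  define z where "z = x - y"
  have s: "(\<Sum>i\<in>UNIV. (z $ i)\<^sup>2) = 1"
  proof -
    have "(norm (emb z))\<^sup>2 = 1" using assms by (simp add: lnorm_def z_def)
    then have "real_of_int (\<Sum>i\<in>UNIV. (z $ i)\<^sup>2) = 1" by (simp add: norm_sq_eq_sum emb_def)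
    then show ?thesis by linarith
  qed
  then have "z \<noteq> 0" by auto
  then obtain i where i: "z $ i \<noteq> 0" by (auto simp: vec_eq_iff)
  have split: "(z $ i)\<^sup>2 + (\<Sum>j\<in>UNIV - {i}. (z $ j)\<^sup>2) = 1"
    using s by (subst (asm) sum.remove[of _ i]) auto
  moreover have rest: "(\<Sum>j\<in>UNIV - {i}. (z $ j)\<^sup>2) \<ge> 0" by (intro sum_nonneg) auto
  moreover have "(z $ i)\<^sup>2 > 0" using i by simp
  ultimately have "(z $ i)\<^sup>2 = 1" "(\<Sum>j\<in>UNIV - {i}. (z $ j)\<^sup>2) = 0" by linarith+
  then have "z $ i = 1 \<or> z $ i = -1" "\<And>j. j \<noteq> i \<Longrightarrow> z $ j = 0"
    by (auto simp: power2_eq_1_iff sum_nonneg_eq_0_iff)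
  then have "z = axis i 1 \<or> z = - axis i 1"
    by (auto simp: vec_eq_iff axis_def)
  then have "x = y + axis i 1 \<or> x = y - axis i 1" by (auto simp: z_def algebra_simps)
  then show ?thesis by (auto simp: nbrs_def)
qed

lemma outer_boundary_lballE:
  fixes y :: "int ^ 'd::finite"
  assumes "y \<in> outer_boundary (lball L)" "L > 0"
  obtains y0 where "y0 \<in> lball L" "y0 \<in> nbrs y" "L < lnorm y" "lnorm y \<le> L + 1"
proof -
  have y: "y \<notin> lball L" "infdist (emb y) (emb ` lball L) = 1"
    using assms by (auto simp: outer_boundary_def)
  have "(0 :: int ^ 'd) \<in> lball L" using assms(2) by (simp add: lball_def lnorm_def emb_def zero_vec_def[symmetric])
  moreover have "closed (emb ` (lball L :: (int ^ 'd) set))"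
    by (intro finite_imp_closed finite_imageI finite_lball)
  ultimately obtain w where "w \<in> emb ` (lball L :: (int ^ 'd) set)" "infdist (emb y) (emb ` lball L) = dist (emb y) w"
    by (metis empty_iff image_is_empty infdist_attains_inf)
  then obtain y0 where y0: "y0 \<in> lball L" "dist (emb y) (emb y0) = 1"
    using y(2) by auto
  then have "lnorm (y0 - y) = 1" by (simp add: lnorm_diff dist_norm norm_minus_commute)
  moreover have "lnorm y \<le> L + 1"
    using norm_triangle_ineq2[of "emb y" "emb y0"] y0 by (simp add: lball_def lnorm_def dist_norm)
  ultimately show thesis using y0(1) y(1) by (intro that[of y0] nbrs_if_lnorm_eq_1) (auto simp: lball_def)
qed

text \<open>
  The barrier with pole at distance at most \<open>c\<close> from \<open>y\<close> is bounded below by a constant at \<open>y\<close>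
  and nonnegative at the other boundary points.
\<close>

lemma exit_prob_upper:
  assumes "CARD('d::finite) \<ge> 3"
  obtains C where "C > 0" "\<And>L (x :: int ^ 'd) y. L > 0 \<Longrightarrow> x \<in> lball L \<Longrightarrow> y \<in> outer_boundary (lball L) \<Longrightarrow>
      exit_prob L x y \<le> C * (max 1 (bdist L x) / lnorm (x - y) ^ CARD('d))"
proof -
  obtain c \<kappa> where c: "c \<ge> 2"
    and super: "\<And>L (v :: real ^ 'd) x. L > 0 \<Longrightarrow> norm v = L + c \<Longrightarrow> x \<in> lball L \<Longrightarrow> lap (\<lambda>z. poisson_super \<kappa> v (emb z)) x \<le> 0"
    and lower: "\<And>L (v :: real ^ 'd) z. L > 0 \<Longrightarrow> norm v = L + c \<Longrightarrow> norm z \<le> L + 1 \<Longrightarrow> (L + c - norm z) / 2 / norm (z - v) ^ CARD('d) \<le> poisson_super \<kappa> v z"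
    and upper: "\<And>L (v :: real ^ 'd) z. L > 0 \<Longrightarrow> norm v = L + c \<Longrightarrow> norm z \<le> L + 1 \<Longrightarrow> poisson_super \<kappa> v z \<le> 2 * (L + c - norm z) / norm (z - v) ^ CARD('d)"
    using lball_poisson_barrier[OF assms] by blast
  define d where "d = CARD('d)"
  define C where "C = 2 * c ^ d * (2 * (1 + c)) * 2 ^ d"
  have "C > 0" using c by (auto simp: C_def intro!: mult_pos_pos)
  moreover have "exit_prob L x y \<le> C * (max 1 (bdist L x) / lnorm (x - y) ^ CARD('d))"
    if L: "L > 0" and x: "x \<in> lball L" and y: "y \<in> outer_boundary (lball L)" for L and x y :: "int ^ 'd"
  proof -
    obtain y0 where y0: "y0 \<in> lball L" "y0 \<in> nbrs y" and ny: "L < lnorm y" "lnorm y \<le> L + 1"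
      by (rule outer_boundary_lballE[OF y L])
    define v where "v = ((L + c) / lnorm y) *\<^sub>R emb y"
    have v: "norm v = L + c" using ny L c by (auto simp: v_def lnorm_def)
    have vy: "norm (emb y - v) = L + c - lnorm y"
    proof -
      have "emb y \<noteq> 0" using ny L by (auto simp: lnorm_def)
      then show ?thesis
        using norm_diff_radial_rescale[of "emb y" "L + c"] ny c by (simp add: v_def lnorm_def)
    qed
    define a where "a = 2 * c ^ d"
    have \<phi>_nonneg: "poisson_super \<kappa> v z \<ge> 0" if "norm z \<le> L + 1" for z
      using c that by (intro order_trans[OF _ lower[OF L v that]]) auto
    have \<phi>_y: "1 \<le> a * poisson_super \<kappa> v (emb y)"
    proof -
      define s where "s = L + c - lnorm y"
      have s: "1 \<le> s" "s \<le> c" using ny c by (auto simp: s_def)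
      have "1 \<le> c ^ d * (s / s ^ d)"
      proof -
        have "s ^ d \<le> c ^ d * s" using s mult_mono[OF power_mono[of s c d] s(1)] by auto
        then show ?thesis using s by (simp add: pos_le_divide_eq)
      qed
      also have "c ^ d * (s / s ^ d) = a * (s / 2 / s ^ d)" by (simp add: a_def)
      also have "\<dots> \<le> a * poisson_super \<kappa> v (emb y)"
        using lower[OF L v, of "emb y"] ny c unfolding vy s_def d_def
        by (intro mult_left_mono) (auto simp: a_def lnorm_def)
      finally show ?thesis .
    qed
    have "0 \<le> a * poisson_super \<kappa> v (emb x) - exit_prob L x y"
    proof (rule lap_nonneg_minimum_principle[OF finite_lball _ _ x])
      fix z :: "int ^ 'd" assume z: "z \<in> lball L"
      show "lap (\<lambda>x. a * poisson_super \<kappa> v (emb x) - exit_prob L x y) z \<le> 0"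
        unfolding lap_diff lap_cmult exit_prob_harmonic[OF z]
        using super[OF L v z] c by (simp add: a_def mult_le_0_iff)
      fix w assume w: "w \<in> nbrs z" "w \<notin> lball L"
      have "norm (emb w) \<le> L + 1"
        using lnorm_nbr_le[OF w(1), of 0] z by (simp add: lball_def lnorm_def)
      then have "poisson_super \<kappa> v (emb w) \<ge> 0" by (rule \<phi>_nonneg)
      then show "0 \<le> a * poisson_super \<kappa> v (emb w) - exit_prob L w y"
        using exit_prob_start[OF w(2), of y] \<phi>_y c by (cases "w = y") (auto simp: a_def)
    qed
    then have "exit_prob L x y \<le> a * poisson_super \<kappa> v (emb x)" by simp
    also have "\<dots> \<le> a * (2 * (L + c - lnorm x) / norm (emb x - v) ^ d)"
      using upper[OF L v, of "emb x"] x c by (intro mult_left_mono) (auto simp: a_def d_def lball_def lnorm_def)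
    also have "\<dots> \<le> a * (2 * (1 + c) * max 1 (bdist L x) * (2 ^ d / lnorm (x - y) ^ d))"
    proof (rule mult_left_mono)
      define \<rho> where "\<rho> = norm (emb x - v)"
      have nx: "norm (emb x) \<le> L" using x by (simp add: lball_def lnorm_def)
      have "c \<le> \<rho>"
        using norm_triangle_ineq2[of v "emb x"] nx v by (simp add: norm_minus_commute \<rho>_def)
      moreover have "lnorm (x - y) \<le> \<rho> + c"
        using norm_triangle_ineq4[of "emb x - v" "emb y - v"] vy ny by (simp add: lnorm_diff \<rho>_def)
      ultimately have \<rho>: "lnorm (x - y) \<le> 2 * \<rho>" "\<rho> > 0" using c by linarith+
      have xy: "lnorm (x - y) > 0"
      proof -
        have "x \<noteq> y" using x ny by (auto simp: lball_def)
        then show ?thesis using lnorm_ge_1[of "x - y"] by simp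
      qed
      have "1 / \<rho> ^ d \<le> 2 ^ d / lnorm (x - y) ^ d"
        using power_mono[OF \<rho>(1), of d] \<rho>(2) xy by (simp add: divide_simps power_mult_distrib lnorm_def)
      moreover have "L + c - lnorm x \<le> (1 + c) * max 1 (bdist L x)"
      proof -
        have "L + c - lnorm x \<le> max 1 (bdist L x) + c * 1" by (simp add: bdist_def)
        also have "\<dots> \<le> max 1 (bdist L x) + c * max 1 (bdist L x)" using c by (intro add_left_mono mult_left_mono) auto
        finally show ?thesis by (simp add: distrib_right)
      qed
      ultimately have "2 * (L + c - lnorm x) * (1 / \<rho> ^ d) \<le> 2 * ((1 + c) * max 1 (bdist L x)) * (2 ^ d / lnorm (x - y) ^ d)"
        using c \<rho> nx by (intro mult_mono) (auto simp: lnorm_def)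
      then show "2 * (L + c - lnorm x) / norm (emb x - v) ^ d \<le> 2 * (1 + c) * max 1 (bdist L x) * (2 ^ d / lnorm (x - y) ^ d)"
        by (simp only: \<rho>_def[symmetric] mult.assoc mult_1_right times_divide_eq_right)
    qed (use c in \<open>auto simp: a_def\<close>)
    finally show ?thesis by (simp add: C_def a_def d_def mult_ac)
  qed
  ultimately show thesis by (rule that)
qed

text \<open>
  From within bounded distance the walk reaches a neighbour of \<open>y\<close> inside the ball, and then
  \<open>y\<close>, along a path of bounded length.
\<close>

lemma exit_prob_connected:
  fixes M :: real
  obtains \<eta> where "\<eta> > 0"
    "\<And>L (x :: int ^ 'd::finite) y. L > 0 \<Longrightarrow> x \<in> lball L \<Longrightarrow> y \<in> outer_boundary (lball L) \<Longrightarrow>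
       lnorm (x - y) \<le> M \<Longrightarrow> \<eta> \<le> exit_prob L x y"
proof -
  define n where "n = nat \<lceil>CARD('d) * (M + 1)\<rceil>"
  define D :: real where "D = 2 * CARD('d)"
  have D: "D > 0" by (simp add: D_def)
  show thesis
  proof (rule that[of "1 / D ^ (n + 1)"])
    show "1 / D ^ (n + 1) > 0" using D by simp
    fix L and x y :: "int ^ 'd"
    assume L: "L > 0" and x: "x \<in> lball L" and y: "y \<in> outer_boundary (lball L)" and M: "lnorm (x - y) \<le> M"
    obtain y0 where y0: "y0 \<in> lball L" "y0 \<in> nbrs y" and ny: "L < lnorm y"
      by (rule outer_boundary_lballE[OF y L])
    have "lnorm (x - y0) \<le> M + 1"
      using lnorm_nbr_le[OF y0(2), of x] M lnorm_minus_commute[of x y] lnorm_minus_commute[of x y0] by linarith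
    then have "CARD('d) * lnorm (x - y0) \<le> CARD('d) * (M + 1)" by (intro mult_left_mono) auto
    then have "real_of_int (dist1 x y0) \<le> CARD('d) * (M + 1)" using dist1_le_lnorm[of x y0] by linarith
    then have dist: "dist1 x y0 \<le> int n" unfolding n_def by linarith
    have "1 = exit_prob L y y" using exit_prob_start[of y L y] ny by (simp add: lball_def)
    also have "\<dots> \<le> D * exit_prob L y0 y"
      unfolding D_def using harmonic_ge_nbr[of "\<lambda>z. exit_prob L z y" y0 y] y0 nbrs_sym[of y y0]
      by (simp add: exit_prob_nonneg exit_prob_harmonic)
    also have "\<dots> \<le> D * (D ^ n * exit_prob L x y)"
      using harnack_lball[of "\<lambda>z. exit_prob L z y" L x y0 n] x y0 dist D
      by (intro mult_left_mono) (auto simp: exit_prob_nonneg exit_prob_harmonic D_def)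
    finally show "1 / D ^ (n + 1) \<le> exit_prob L x y" using D by (simp add: pos_divide_le_eq mult_ac)
  qed
qed

lemma poisson_ratio_le_1:
  fixes x y :: "int ^ 'd::finite"
  assumes "x \<in> lball L" "L < lnorm y"
  shows "1 \<le> lnorm (x - y)" "bdist L x / lnorm (x - y) ^ CARD('d) \<le> 1"
proof -
  have "x \<noteq> y" using assms by (auto simp: lball_def)
  then show 1: "1 \<le> lnorm (x - y)" using lnorm_ge_1[of "x - y"] by simp
  have "bdist L x \<le> lnorm (x - y)"
    using assms norm_triangle_ineq2[of "emb y" "emb x"] by (simp add: bdist_def lnorm_def lnorm_diff norm_minus_commute emb_diff)
  also have "\<dots> \<le> lnorm (x - y) ^ CARD('d)" using 1 power_increasing[of 1 "CARD('d)" "lnorm (x - y)"] by simp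
  finally show "bdist L x / lnorm (x - y) ^ CARD('d) \<le> 1" using 1 by (simp add: divide_le_eq)
qed

text \<open>
  The pole \<open>v\<close> of the subharmonic barrier lies inside the ball, at distance between \<open>c\<close> and
  \<open>c + 1\<close> from \<open>y\<close>. Outside \<open>V\<^sub>L\<close> the kernel of the smaller ball is at most \<open>- c \<rho>\<^sup>-\<^sup>d\<close>, which absorbs the
  correction when \<open>c = \<kappa>\<close>; near the pole the exit probability is bounded below by
  \<open>exit_prob_connected\<close>, while the barrier is bounded from distance
  \<open>r \<ge> 1\<close> to the pole on.
\<close>

lemma exit_prob_lower_inner:
  assumes "CARD('d::finite) \<ge> 3"
  obtains \<eta> c where "\<eta> > 0" "c \<ge> 1"
    "\<And>L (x :: int ^ 'd) y. L \<ge> 4 * c \<Longrightarrow> x \<in> lball L \<Longrightarrow> bdist L x \<ge> 2 * c \<Longrightarrow> y \<in> outer_boundary (lball L) \<Longrightarrow>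
       \<eta> * (bdist L x / lnorm (x - y) ^ CARD('d)) \<le> exit_prob L x y"
proof -
  define d where "d = CARD('d)"
  define m where "m = CARD('d) - 2"
  have m: "CARD('d) = m + 2" "m \<ge> 1" using assms by (auto simp: m_def)
  obtain \<kappa> r where \<kappa>: "\<kappa> \<ge> 1" "r \<ge> 6"
    "\<And>v x :: real ^ 'd. v \<noteq> 0 \<Longrightarrow> r \<le> norm (x - v) \<Longrightarrow> norm (x - v) \<le> 3 * norm v \<Longrightarrow>
       lap (\<lambda>x. poisson_kernel v x - \<kappa> / norm (x - v) ^ CARD('d)) x \<le> 0"
    "\<And>v x :: real ^ 'd. v \<noteq> 0 \<Longrightarrow> r \<le> norm (x - v) \<Longrightarrow> norm (x - v) \<le> 3 * norm v \<Longrightarrow>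
       0 \<le> lap (\<lambda>x. poisson_kernel v x + \<kappa> / norm (x - v) ^ CARD('d)) x"
    using poisson_kernel_barrier[OF m] by blast
  define c where "c = \<kappa>"
  have c: "c \<ge> 1" using \<kappa> by (simp add: c_def)
  obtain \<eta>1 where \<eta>1: "\<eta>1 > 0"
    "\<And>L (x :: int ^ 'd) y. L > 0 \<Longrightarrow> x \<in> lball L \<Longrightarrow> y \<in> outer_boundary (lball L) \<Longrightarrow>
       lnorm (x - y) \<le> r + 1 + c + 1 \<Longrightarrow> \<eta>1 \<le> exit_prob L x y"
    using exit_prob_connected[of "r + 1 + c + 1"] by blast
  define s where "s = \<eta>1 / (3 + \<kappa>)"
  have s: "s > 0" using \<eta>1 \<kappa> by (simp add: s_def)
  define \<eta> where "\<eta> = min \<eta>1 (s / 2 / (c + 2) ^ d)"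
  show thesis
  proof (rule that[of \<eta> c])
    show "\<eta> > 0" using \<eta>1 s c by (simp add: \<eta>_def)
    show "c \<ge> 1" by (rule c)
    fix L and x y :: "int ^ 'd"
    assume L4: "L \<ge> 4 * c" and x: "x \<in> lball L" and dx: "bdist L x \<ge> 2 * c" and y: "y \<in> outer_boundary (lball L)"
    have L: "L > 0" using L4 c by linarith
    obtain y0 where ny: "L < lnorm y" "lnorm y \<le> L + 1"
      by (rule outer_boundary_lballE[OF y L])
    \<comment> \<open>The kernel of this smaller ball is negative outside \<open>V\<^sub>L\<close>.\<close>
    define R where "R = L - c"
    have R: "R > 0" "L \<le> 2 * R" using L4 c by (auto simp: R_def)
    define v where "v = (R / lnorm y) *\<^sub>R emb y"
    have v: "norm v = R" using ny L R by (auto simp: v_def lnorm_def)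
    have vy: "norm (emb y - v) \<le> c + 1"
    proof -
      have "emb y \<noteq> 0" using ny L by (auto simp: lnorm_def)
      then show ?thesis
        using norm_diff_radial_rescale[of "emb y" R] ny c by (simp add: v_def lnorm_def R_def)
    qed
    define \<rho> where "\<rho> z = norm (emb z - v)" for z :: "int ^ 'd"
    define \<phi> where "\<phi> z = poisson_kernel v z + \<kappa> / norm (z - v) ^ CARD('d)" for z
    have \<phi>_eq: "\<phi> (emb z) = ((R - lnorm z) * ((R + lnorm z) / R) + \<kappa>) / \<rho> z ^ d" for z
      by (simp only: \<phi>_def poisson_kernel_factor v \<rho>_def d_def lnorm_def add_divide_distrib[of _ \<kappa>] times_divide_eq_right)
    have near: "\<eta>1 \<le> exit_prob L z y" if "z \<in> lball L" "\<rho> z \<le> r + 1" for z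
    proof -
      have "lnorm (z - y) \<le> r + 1 + c + 1"
        using norm_triangle_ineq4[of "emb z - v" "emb y - v"] vy that by (simp add: lnorm_diff \<rho>_def)
      then show ?thesis using \<eta>1(2)[OF L that(1) y] by blast
    qed
    show "\<eta> * (bdist L x / lnorm (x - y) ^ CARD('d)) \<le> exit_prob L x y"
    proof (cases "\<rho> x \<le> r + 1")
      case True
      have "\<eta> * (bdist L x / lnorm (x - y) ^ CARD('d)) \<le> \<eta>1 * 1"
        using poisson_ratio_le_1[OF x ny(1)] \<eta>1 dx c
        by (intro mult_mono) (auto simp: \<eta>_def)
      then show ?thesis using near[OF x True] by simp
    next
      case False
      define V where "V = lball L \<inter> {z. \<rho> z > r + 1}"
      have "0 \<le> exit_prob L x y - s * \<phi> (emb x)"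
      proof (rule lap_nonneg_minimum_principle[where V=V and h="\<lambda>x. exit_prob L x y - s * \<phi> (emb x)"])
        show "finite V" by (simp add: V_def finite_lball)
        show "x \<in> V" using x False by (simp add: V_def)
        fix z assume z: "z \<in> V"
        have zL: "z \<in> lball L" and z\<rho>: "\<rho> z > r + 1" using z by (auto simp: V_def)
        have "norm (emb z - v) \<le> 3 * norm v"
          using norm_triangle_ineq4[of "emb z" v] zL v R by (simp add: lball_def lnorm_def)
        then have "0 \<le> lap \<phi> (emb z)"
          unfolding \<phi>_def[abs_def] using \<kappa>(4)[of v "emb z"] v R z\<rho> by (auto simp: \<rho>_def)
        then show "lap (\<lambda>x. exit_prob L x y - s * \<phi> (emb x)) z \<le> 0"
          unfolding lap_diff lap_cmult exit_prob_harmonic[OF zL] lap_emb using s by simp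
        fix w assume w: "w \<in> nbrs z" "w \<notin> V"
        have w\<rho>: "\<rho> w > r"
        proof -
          have "norm (emb z - emb w) = 1"
            using lnorm_nbr[OF w(1)] by (simp add: lnorm_diff norm_minus_commute)
          then show ?thesis
            using norm_triangle_ineq[of "emb z - emb w" "emb w - v"] z\<rho> by (simp add: \<rho>_def)
        qed
        have \<rho>1: "1 \<le> \<rho> w ^ d" "\<rho> w > 0" using w\<rho> \<kappa> by auto
        show "0 \<le> exit_prob L w y - s * \<phi> (emb w)"
        proof (cases "w \<in> lball L")
          case True
          then have "\<rho> w \<le> r + 1" using w(2) by (simp add: V_def)
          then have e: "\<eta>1 \<le> exit_prob L w y" by (rule near[OF True])
          have "(R - lnorm w) * ((R + lnorm w) / R) \<le> \<rho> w * 3"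
          proof (cases "R - lnorm w \<ge> 0")
            case True
            have "R - lnorm w \<le> \<rho> w"
              using norm_triangle_ineq2[of v "emb w"] v by (simp add: \<rho>_def lnorm_def norm_minus_commute)
            moreover have "(R + lnorm w) / R \<le> 3" using True R by (simp add: divide_le_eq)
            ultimately show ?thesis using True R by (intro mult_mono) (auto simp: lnorm_def)
          next
            case False
            then have "(R - lnorm w) * ((R + lnorm w) / R) \<le> 0"
              using R by (intro mult_nonpos_nonneg) (auto simp: lnorm_def)
            then show ?thesis using \<rho>1 by linarith
          qed
          then have "\<phi> (emb w) \<le> (3 * \<rho> w + \<kappa>) / \<rho> w ^ d"
            unfolding \<phi>_eq using \<rho>1 by (intro divide_right_mono) auto
          also have "\<dots> \<le> (3 + \<kappa>) * \<rho> w / \<rho> w ^ d"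
            using w\<rho> \<kappa> \<rho>1 mult_left_mono[of 1 "\<rho> w" \<kappa>] by (intro divide_right_mono) (auto simp: algebra_simps)
          also have "\<dots> \<le> 3 + \<kappa>"
          proof -
            have "\<rho> w \<le> \<rho> w ^ d"
              using power_increasing[of 1 d "\<rho> w"] w\<rho> \<kappa> by (simp add: d_def)
            then show ?thesis using \<rho>1 \<kappa> by (simp add: pos_divide_le_eq)
          qed
          finally have "s * \<phi> (emb w) \<le> s * (3 + \<kappa>)" using s by (intro mult_left_mono) auto
          then have "s * \<phi> (emb w) \<le> \<eta>1" using \<kappa>(1) by (simp add: s_def)
          then show ?thesis using e by linarith
        next
          case False
          then have "lnorm w > L" by (simp add: lball_def)
          then have "c * 1 \<le> (lnorm w - R) * ((R + lnorm w) / R)"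
            using R c by (intro mult_mono) (auto simp: R_def)
          then have "(R - lnorm w) * ((R + lnorm w) / R) + \<kappa> \<le> 0"
            unfolding c_def minus_diff_eq[symmetric, of "lnorm w"] mult_minus_left by linarith
          then have "\<phi> (emb w) \<le> 0" unfolding \<phi>_eq using \<rho>1 by (intro divide_nonpos_nonneg) auto
          then have "s * \<phi> (emb w) \<le> 0" using s by (simp add: mult_le_0_iff)
          then show ?thesis using exit_prob_nonneg[of L w y] by linarith
        qed
      qed
      then have main: "s * \<phi> (emb x) \<le> exit_prob L x y" by simp
      have \<rho>x: "\<rho> x > 0" using False \<kappa> by simp
      have xy: "1 \<le> lnorm (x - y)" by (rule poisson_ratio_le_1[OF x ny(1)])
      have "\<rho> x \<le> lnorm (x - y) + (c + 1)"
        using norm_triangle_ineq[of "emb x - emb y" "emb y - v"] vy by (simp add: \<rho>_def lnorm_diff)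
      also have "\<dots> \<le> lnorm (x - y) + (c + 1) * lnorm (x - y)"
        using xy c mult_left_mono[of 1 "lnorm (x - y)" "c + 1"] by simp
      finally have "\<rho> x \<le> (c + 2) * lnorm (x - y)" by (simp add: algebra_simps)
      then have "\<rho> x ^ d \<le> (c + 2) ^ d * lnorm (x - y) ^ d"
        using power_mono[of "\<rho> x" "(c + 2) * lnorm (x - y)" d] \<rho>x by (simp add: power_mult_distrib)
      then have inv: "1 / ((c + 2) ^ d * lnorm (x - y) ^ d) \<le> 1 / \<rho> x ^ d"
        using \<rho>x xy c by (intro divide_left_mono) auto
      have "bdist L x / 2 * 1 \<le> (R - lnorm x) * ((R + lnorm x) / R)"
        using R dx c by (intro mult_mono) (auto simp: bdist_def R_def lnorm_def)
      then have q: "bdist L x / 2 \<le> (R - lnorm x) * ((R + lnorm x) / R) + \<kappa>" using \<kappa> by simp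
      then have q0: "0 \<le> (R - lnorm x) * ((R + lnorm x) / R) + \<kappa>" using dx c by linarith
      have "\<eta> * (bdist L x / lnorm (x - y) ^ d) \<le> s / 2 / (c + 2) ^ d * (bdist L x / lnorm (x - y) ^ d)"
        using dx c xy by (intro mult_right_mono) (auto simp: \<eta>_def)
      also have "\<dots> = s * (bdist L x / 2 * (1 / ((c + 2) ^ d * lnorm (x - y) ^ d)))" by simp
      also have "\<dots> \<le> s * (((R - lnorm x) * ((R + lnorm x) / R) + \<kappa>) * (1 / \<rho> x ^ d))"
        using s q q0 inv dx c xy \<rho>x by (intro mult_left_mono mult_mono) auto
      also have "\<dots> = s * \<phi> (emb x)" by (simp add: \<phi>_eq)
      finally show ?thesis using main by (simp add: d_def)
    qed
  qed
qed

text \<open>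
  Rounding the coordinates of \<open>t x\<close> towards zero gives a point of norm at most \<open>t |x|\<close>.
\<close>

lemma exists_scaled_lattice_point:
  fixes x :: "int ^ 'd::finite"
  assumes t: "0 \<le> t" "t \<le> 1"
  obtains x' :: "int ^ 'd" where "lnorm x' \<le> t * lnorm x" "dist1 x' x \<le> CARD('d) * ((1 - t) * lnorm x + 1)"
proof -
  define x' :: "int ^ 'd" where "x' = (\<chi> i. sgn (x $ i) * \<lfloor>t * \<bar>real_of_int (x $ i)\<bar>\<rfloor>)"
  have fl: "0 \<le> \<lfloor>t * \<bar>real_of_int (x $ i)\<bar>\<rfloor>" for i using t by simp
  have a: "\<bar>x' $ i\<bar> = \<lfloor>t * \<bar>real_of_int (x $ i)\<bar>\<rfloor>" for i
    using fl[of i] by (simp add: x'_def abs_mult sgn_if)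
  have b: "\<bar>x' $ i - x $ i\<bar> = \<bar>x $ i\<bar> - \<lfloor>t * \<bar>real_of_int (x $ i)\<bar>\<rfloor>" for i
  proof -
    have "t * \<bar>real_of_int (x $ i)\<bar> \<le> \<bar>real_of_int (x $ i)\<bar>" using t by (simp add: mult_left_le_one_le)
    then have "\<lfloor>t * \<bar>real_of_int (x $ i)\<bar>\<rfloor> \<le> \<bar>x $ i\<bar>" by linarith
    then show ?thesis using fl[of i] by (auto simp: x'_def sgn_if)
  qed
  have "lnorm x' \<le> norm (t *\<^sub>R emb x)"
    unfolding lnorm_def
  proof (rule norm_le_componentwise_cart)
    fix i
    have "\<bar>real_of_int (x' $ i)\<bar> \<le> t * \<bar>real_of_int (x $ i)\<bar>"
      using a[of i] by (metis of_int_abs of_int_floor_le)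
    then show "norm (emb x' $ i) \<le> norm ((t *\<^sub>R emb x) $ i)" using t by (simp add: emb_def abs_mult)
  qed
  moreover have "dist1 x' x \<le> (\<Sum>i\<in>(UNIV::'d set). (1 - t) * lnorm x + 1)"
    unfolding dist1_def of_int_sum
  proof (rule sum_mono)
    fix i
    have "real_of_int \<bar>x' $ i - x $ i\<bar> \<le> \<bar>real_of_int (x $ i)\<bar> - t * \<bar>real_of_int (x $ i)\<bar> + 1"
      unfolding b by linarith
    also have "\<dots> = (1 - t) * \<bar>real_of_int (x $ i)\<bar> + 1" by (simp add: algebra_simps)
    also have "\<dots> \<le> (1 - t) * lnorm x + 1"
      using t component_le_lnorm[of x i] by (intro add_right_mono mult_left_mono) auto
    finally show "real_of_int \<bar>x' $ i - x $ i\<bar> \<le> (1 - t) * lnorm x + 1" .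
  qed
  ultimately show thesis using t by (intro that[of x']) (auto simp: lnorm_def)
qed

text \<open>
  A point within \<open>2c\<close> of the boundary is joined by a Harnack chain of bounded length to a point
  at depth \<open>2c\<close>; balls of radius below \<open>4c\<close> are covered by \<open>exit_prob_connected\<close> alone.
\<close>

lemma exit_prob_lower:
  assumes "CARD('d::finite) \<ge> 3"
  obtains \<eta> where "\<eta> > 0"
    "\<And>L (x :: int ^ 'd) y. L > 0 \<Longrightarrow> x \<in> lball L \<Longrightarrow> y \<in> outer_boundary (lball L) \<Longrightarrow>
       \<eta> * (bdist L x / lnorm (x - y) ^ CARD('d)) \<le> exit_prob L x y"
proof -
  define d where "d = CARD('d)"
  obtain \<eta>0 c where \<eta>0: "\<eta>0 > 0" "c \<ge> 1"
    "\<And>L (x :: int ^ 'd) y. L \<ge> 4 * c \<Longrightarrow> x \<in> lball L \<Longrightarrow> bdist L x \<ge> 2 * c \<Longrightarrow> y \<in> outer_boundary (lball L) \<Longrightarrow>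
       \<eta>0 * (bdist L x / lnorm (x - y) ^ CARD('d)) \<le> exit_prob L x y"
    using exit_prob_lower_inner[OF assms] by blast
  obtain \<eta>1 where \<eta>1: "\<eta>1 > 0"
    "\<And>L (x :: int ^ 'd) y. L > 0 \<Longrightarrow> x \<in> lball L \<Longrightarrow> y \<in> outer_boundary (lball L) \<Longrightarrow>
       lnorm (x - y) \<le> 8 * c + 1 \<Longrightarrow> \<eta>1 \<le> exit_prob L x y"
    using exit_prob_connected[of "8 * c + 1"] by blast
  define M where "M = d * (2 * c + 1)"
  define n where "n = nat \<lceil>M\<rceil>"
  define D :: real where "D = 2 * CARD('d)"
  have D: "D > 0" by (simp add: D_def)
  have M: "M \<ge> 0" using \<eta>0 by (simp add: M_def)
  define \<eta>2 where "\<eta>2 = \<eta>0 / (D ^ n * (M + 1) ^ d)"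
  have \<eta>2: "\<eta>2 > 0" using \<eta>0 D M by (simp add: \<eta>2_def)
  define \<eta> where "\<eta> = min \<eta>0 (min \<eta>1 \<eta>2)"
  show thesis
  proof (rule that[of \<eta>])
    show "\<eta> > 0" using \<eta>0 \<eta>1 \<eta>2 by (simp add: \<eta>_def)
    fix L and x y :: "int ^ 'd"
    assume L: "L > 0" and x: "x \<in> lball L" and y: "y \<in> outer_boundary (lball L)"
    obtain y0 where ny: "L < lnorm y" "lnorm y \<le> L + 1"
      by (rule outer_boundary_lballE[OF y L])
    note xy = poisson_ratio_le_1[OF x ny(1)]
    have nx: "lnorm x \<le> L" using x by (simp add: lball_def)
    define B where "B = bdist L x / lnorm (x - y) ^ CARD('d)"
    have B: "0 \<le> B" "B \<le> 1" using xy nx by (auto simp: B_def bdist_def)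
    show "\<eta> * (bdist L x / lnorm (x - y) ^ CARD('d)) \<le> exit_prob L x y"
    proof (cases "L \<ge> 4 * c")
      case False
      have "lnorm (x - y) \<le> lnorm x + lnorm y"
        using norm_triangle_ineq4[of "emb x" "emb y"] unfolding lnorm_diff by (simp add: lnorm_def)
      then have "\<eta>1 \<le> exit_prob L x y" using \<eta>1(2)[OF L x y] nx ny False by linarith
      moreover have "\<eta> * B \<le> \<eta>1 * 1" using B \<eta>1 by (intro mult_mono) (auto simp: \<eta>_def)
      ultimately show ?thesis by (simp add: B_def)
    next
      case L4: True
      show ?thesis
      proof (cases "bdist L x \<ge> 2 * c")
        case True
        have "\<eta> * B \<le> \<eta>0 * B" using B by (intro mult_right_mono) (auto simp: \<eta>_def)
        then show ?thesis using \<eta>0(3)[OF L4 x True y] by (simp add: B_def)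
      next
        case False
        define t where "t = (L - 2 * c) / L"
        have t: "0 \<le> t" "t \<le> 1" "t * L = L - 2 * c" "(1 - t) * L = 2 * c"
          using L4 \<eta>0(2) L by (auto simp: t_def field_simps)
        obtain x' :: "int ^ 'd" where x': "lnorm x' \<le> t * lnorm x" "dist1 x' x \<le> CARD('d) * ((1 - t) * lnorm x + 1)"
          using exists_scaled_lattice_point[OF t(1,2)] by blast
        have "t * lnorm x \<le> L - 2 * c" using mult_left_mono[OF nx t(1)] t(3) by linarith
        then have x'2: "bdist L x' \<ge> 2 * c" "x' \<in> lball L" using x'(1) \<eta>0(2) by (auto simp: bdist_def lball_def)
        have "(1 - t) * lnorm x \<le> 2 * c" using mult_left_mono[OF nx, of "1 - t"] t(2,4) by linarith
        then have "CARD('d) * ((1 - t) * lnorm x + 1) \<le> M" unfolding M_def d_def by (intro mult_left_mono) auto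
        then have dist: "real_of_int (dist1 x' x) \<le> M" using x'(2) by linarith
        have xx': "lnorm (x' - x) \<le> M"
        proof -
          have "lnorm (x' - x) \<le> (\<Sum>i\<in>UNIV. \<bar>emb (x' - x) $ i\<bar>)"
            unfolding lnorm_def by (rule norm_le_l1_cart)
          also have "\<dots> = real_of_int (dist1 x' x)" by (simp add: dist1_def emb_def)
          finally show ?thesis using dist by linarith
        qed
        have "lnorm (x' - y) \<le> M + lnorm (x - y)" using lnorm_triangle[of x' y x] xx' by linarith
        also have "\<dots> \<le> (M + 1) * lnorm (x - y)" using mult_left_mono[OF xy(1) M] by (simp add: algebra_simps)
        finally have "lnorm (x' - y) \<le> (M + 1) * lnorm (x - y)" .
        then have "lnorm (x' - y) ^ d \<le> (M + 1) ^ d * lnorm (x - y) ^ d"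
          using power_mono[of "lnorm (x' - y)" "(M + 1) * lnorm (x - y)" d] by (simp add: power_mult_distrib lnorm_def)
        moreover have "1 \<le> lnorm (x' - y)" by (rule poisson_ratio_le_1[OF x'2(2) ny(1)])
        ultimately have inv: "1 / ((M + 1) ^ d * lnorm (x - y) ^ d) \<le> 1 / lnorm (x' - y) ^ d"
          using xy(1) M by (intro divide_left_mono mult_pos_pos zero_less_power) auto
        have "\<eta> * B \<le> \<eta>2 * B" using B by (intro mult_right_mono) (auto simp: \<eta>_def)
        also have "\<dots> = \<eta>0 / D ^ n * (bdist L x * (1 / ((M + 1) ^ d * lnorm (x - y) ^ d)))"
          by (simp add: \<eta>2_def B_def d_def)
        also have "\<dots> \<le> \<eta>0 / D ^ n * (bdist L x' * (1 / lnorm (x' - y) ^ d))"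
          using inv False x'2 \<eta>0 D xy M nx by (intro mult_left_mono mult_mono) (auto simp: bdist_def)
        also have "\<dots> = \<eta>0 * (bdist L x' / lnorm (x' - y) ^ CARD('d)) / D ^ n" by (simp add: d_def)
        also have "\<dots> \<le> exit_prob L x' y / D ^ n"
          using \<eta>0(3)[OF L4 x'2(2,1) y] D by (intro divide_right_mono) auto
        also have "\<dots> \<le> exit_prob L x y"
        proof -
          have "dist1 x x' \<le> int n" using dist unfolding n_def dist1_commute[of x] by linarith
          then have "exit_prob L x' y \<le> D ^ n * exit_prob L x y"
            unfolding D_def using harnack_lball[of "\<lambda>z. exit_prob L z y" L x x' n] x x'2
            by (simp add: exit_prob_nonneg exit_prob_harmonic)
          then show ?thesis using D by (simp add: pos_divide_le_eq mult.commute)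
        qed
        finally show ?thesis by (simp add: B_def)
      qed
    qed
  qed
qed

section \<open>Hitting a ball before leaving a larger ball\<close>

lemma lap_norm_sq: "lap (\<lambda>x. (norm (x - v))\<^sup>2) x = 2 * CARD('d)" for x v :: "real ^ 'd::finite"
proof -
  have "(norm (w + axis i 1))\<^sup>2 + (norm (w - axis i 1))\<^sup>2 - 2 * (norm w)\<^sup>2 = 2" for w :: "real ^ 'd" and i
    using norm_unit_step[of 1 w i] norm_unit_step[of "-1" w i] by simp
  then have "lap (\<lambda>w. (norm w)\<^sup>2) (x - v) = (\<Sum>i\<in>(UNIV::'d set). 2)"
    unfolding lap_def by (intro sum.cong refl)
  then show ?thesis using lap_shift[of "\<lambda>w. (norm w)\<^sup>2" v x] by simp
qed

text \<open>
  The properties of a hitting probability of \<open>V\<^sub>b(y)\<close> before exit from \<open>V\<^sub>L\<close> that the estimates use. The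
  bound by one is required from distance \<open>b/2\<close> on only: for a probability of hitting a smaller
  ball, divided by a bound for its size from distance \<open>b/2\<close> on, it may fail near \<open>y\<close>.
\<close>

definition killed_harmonic :: "real \<Rightarrow> real \<Rightarrow> int ^ 'd::finite \<Rightarrow> (int ^ 'd \<Rightarrow> real) \<Rightarrow> bool" where
  "killed_harmonic L b y u \<longleftrightarrow>
     (\<forall>z. b / 2 \<le> lnorm (z - y) \<longrightarrow> u z \<le> 1) \<and>
     (\<forall>z. z \<notin> lball L \<longrightarrow> u z = 0) \<and>
     (\<forall>z \<in> lball L. z \<notin> lball_at b y \<longrightarrow> lap u z = 0)"

text \<open>
  Exterior-ball barrier at scale \<open>b\<close>: with \<open>v\<close> at distance \<open>b + 1\<close> outside \<open>V\<^sub>L\<close> on the ray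
  through \<open>x\<close>, the function \<open>A (1 - (b/|z - v|)\<^sup>d\<^sup>-\<^sup>1) + |z - x|\<^sup>2/b\<^sup>2\<close> is superharmonic for large \<open>A\<close>
  because the Laplacian of the power is of order \<open>1/b\<^sup>2\<close>. It is at least one at distance \<open>b\<close>
  from \<open>x\<close>, and at \<open>x\<close> itself it is at most of order \<open>max 1 d\<^sub>L / b\<close>.
\<close>

lemma killed_harmonic_boundary_decay:
  assumes "CARD('d::finite) \<ge> 3"
  obtains C where "C > 0"
    "\<And>L b (y :: int ^ 'd) u x. L > 0 \<Longrightarrow> b \<ge> 1 \<Longrightarrow> y \<in> lball L \<Longrightarrow> killed_harmonic L b y u \<Longrightarrow> x \<in> lball L \<Longrightarrow>
       lnorm (x - y) \<ge> 2 * b \<Longrightarrow> u x \<le> C * (max 1 (bdist L x) / b)"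
proof -
  define d where "d = CARD('d)"
  define n where "n = d - 1"
  have n: "d = n + 1" "n \<ge> 2" using assms by (auto simp: n_def d_def)
  obtain K where K: "K > 0" "\<And>w :: real ^ 'd. norm w \<ge> 6 \<Longrightarrow>
    \<bar>lap (\<lambda>w. 1 / norm w ^ n) w - n * (n + 2 - real CARD('d)) / norm w ^ (n + 2)\<bar> \<le> K / norm w ^ (n + 3)"
    using lap_inverse_power[of n] by blast
  define r where "r = max 6 K"
  have r: "r \<ge> 6" "r \<ge> K" by (auto simp: r_def)
  have radial: "1 / norm w ^ (n + 2) \<le> lap (\<lambda>w. 1 / norm w ^ n) w" if "norm w \<ge> r" for w :: "real ^ 'd"
  proof -
    define \<rho> where "\<rho> = norm w"
    have \<rho>: "\<rho> \<ge> 6" "\<rho> \<ge> K" using that r by (auto simp: \<rho>_def)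
    have "K / \<rho> ^ (n + 3) = K / \<rho> / \<rho> ^ (n + 2)" using \<rho> by (simp add: eval_nat_numeral)
    also have "\<dots> \<le> 1 / \<rho> ^ (n + 2)" using \<rho> by (intro divide_right_mono) auto
    finally have A: "K / \<rho> ^ (n + 3) \<le> 1 / \<rho> ^ (n + 2)" .
    have e: "real (n + 2) - real CARD('d) = 1" using n by (simp add: d_def)
    have "n / \<rho> ^ (n + 2) - K / \<rho> ^ (n + 3) \<le> lap (\<lambda>w. 1 / norm w ^ n) w"
      using K(2)[of w, unfolded e, folded \<rho>_def, OF \<rho>(1)] by linarith
    moreover have "2 / \<rho> ^ (n + 2) \<le> n / \<rho> ^ (n + 2)" using n \<rho> by (intro divide_right_mono) auto
    moreover have "2 / \<rho> ^ (n + 2) = 1 / \<rho> ^ (n + 2) + 1 / \<rho> ^ (n + 2)" by simp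
    ultimately show ?thesis using A unfolding \<rho>_def by linarith
  qed
  define A :: real where "A = 2 * d * 4 ^ (n + 2)"
  have A: "A > 0" unfolding A_def of_nat_0_less_iff using n by simp
  define C where "C = max r (2 * A * n)"
  have C: "C \<ge> r" "C \<ge> 2 * A * n" "C > 0" using r by (auto simp: C_def)
  show thesis
  proof (rule that[of C])
    show "C > 0" by (rule C(3))
    fix L b :: real and x0 y :: "int ^ 'd" and u
    assume L: "L > 0" and b: "b \<ge> 1" and y: "y \<in> lball L" and u: "killed_harmonic L b y u"
      and x0: "x0 \<in> lball L" and far: "lnorm (x0 - y) \<ge> 2 * b"
    have u1: "u z \<le> 1" if "b / 2 \<le> lnorm (z - y)" for z using u that by (simp add: killed_harmonic_def)
    have u0: "u z = 0" if "z \<notin> lball L" for z using u that by (simp add: killed_harmonic_def)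
    have uh: "lap u z = 0" if "z \<in> lball L" "z \<notin> lball_at b y" for z using u that by (simp add: killed_harmonic_def)
    define \<delta> where "\<delta> = bdist L x0"
    have \<delta>: "\<delta> \<ge> 0" "\<delta> = L - lnorm x0" using x0 by (auto simp: \<delta>_def bdist_def lball_def)
    show "u x0 \<le> C * (max 1 (bdist L x0) / b)"
    \<comment> \<open>If \<open>b\<close> is bounded or \<open>x0\<close> is at depth at least \<open>b\<close>, the trivial bound \<open>u \<le> 1\<close> suffices.\<close>
    proof (cases "r \<le> b \<and> \<delta> < b")
      case False
      have "1 * b \<le> C * max 1 \<delta>"
      proof (cases "b \<le> r")
        case True
        then have "b * 1 \<le> C * max 1 \<delta>" using C r by (intro mult_mono) auto
        then show ?thesis by simp
      next
        case False
        then have "b \<le> \<delta>" using \<open>\<not> (r \<le> b \<and> \<delta> < b)\<close> by auto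
        then show ?thesis using C r b by (intro mult_mono) auto
      qed
      then have "1 \<le> C * (max 1 \<delta> / b)" using b by (simp add: pos_le_divide_eq)
      moreover have "u x0 \<le> 1" using u1[of x0] far b by simp
      ultimately show ?thesis unfolding \<delta>_def by linarith
    next
      case True
      then have br: "r \<le> b" and \<delta>b: "\<delta> < b" by auto
      have x0_pos: "lnorm x0 > 0"
      proof -
        have "lnorm (x0 - y) \<le> lnorm x0 + lnorm y"
          using norm_triangle_ineq4[of "emb x0" "emb y"] unfolding lnorm_diff by (simp add: lnorm_def)
        then show ?thesis using far y \<delta> \<delta>b b by (simp add: lball_def)
      qed
      define v where "v = ((L + 1 + b) / lnorm x0) *\<^sub>R emb x0"
      have v: "norm v = L + 1 + b" using x0_pos L b by (simp add: v_def lnorm_def)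
      have vx0: "norm (emb x0 - v) = 1 + b + \<delta>"
        using norm_diff_radial_rescale[of "emb x0" "L + 1 + b"] x0_pos b \<delta>
        by (auto simp: v_def lnorm_def)
      define H where "H z = (A - A * b ^ n * (1 / norm (z - v) ^ n)) + 1 / b\<^sup>2 * (norm (z - emb x0))\<^sup>2" for z
      have outside: "b \<le> norm (z - v)" if "norm z \<le> L + 1" for z
        using norm_triangle_ineq2[of v z] that v by (simp add: norm_minus_commute)
      have H_ge: "H z \<ge> 1 / b\<^sup>2 * (norm (z - emb x0))\<^sup>2" if "norm z \<le> L + 1" for z
      proof -
        have "b ^ n * (1 / norm (z - v) ^ n) \<le> 1"
          using power_mono[OF outside[OF that], of n] b outside[OF that] by (simp add: divide_le_eq)
        then have "A * (b ^ n * (1 / norm (z - v) ^ n)) \<le> A * 1" using A by (intro mult_left_mono) auto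
        then show ?thesis by (simp add: H_def)
      qed
      define V where "V = lball L \<inter> {z. lnorm (z - x0) < b}"
      have "0 \<le> H (emb x0) - u x0"
      proof (rule lap_nonneg_minimum_principle[where V=V and h="\<lambda>z. H (emb z) - u z"])
        show "finite V" by (simp add: V_def finite_lball)
        show "x0 \<in> V" using x0 b by (simp add: V_def lnorm_diff)
        fix z assume z: "z \<in> V"
        have zL: "z \<in> lball L" and zx: "lnorm (z - x0) < b" using z by (auto simp: V_def)
        have "z \<notin> lball_at b y"
          using lnorm_triangle[of x0 y z] far zx lnorm_minus_commute[of x0 z] by (simp add: mem_lball_at)
        then have hz: "lap u z = 0" using uh zL by blast
        define \<rho> where "\<rho> = norm (emb z - v)"
        have \<rho>: "b \<le> \<rho>" using outside[of "emb z"] zL by (simp add: \<rho>_def lball_def lnorm_def)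
        have "\<rho> \<le> lnorm (z - x0) + norm (emb x0 - v)"
          using norm_triangle_ineq[of "emb z - emb x0" "emb x0 - v"] by (simp add: \<rho>_def lnorm_diff)
        then have \<rho>2: "\<rho> \<le> 4 * b" using zx vx0 \<delta>b b by linarith
        have "1 / (4 * b) ^ (n + 2) \<le> 1 / \<rho> ^ (n + 2)"
          using \<rho> \<rho>2 b by (intro divide_left_mono power_mono) auto
        also have "\<dots> \<le> lap (\<lambda>z. 1 / norm (z - v) ^ n) (emb z)"
          using radial[of "emb z - v"] \<rho> br lap_shift[of "\<lambda>w. 1 / norm w ^ n" v "emb z"] by (simp add: \<rho>_def)
        finally have "A * b ^ n * (1 / (4 * b) ^ (n + 2)) \<le> A * b ^ n * lap (\<lambda>z. 1 / norm (z - v) ^ n) (emb z)"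
          using A b by (intro mult_left_mono) auto
        moreover have "A * b ^ n * (1 / (4 * b) ^ (n + 2)) = 1 / b\<^sup>2 * (2 * d)"
          using b by (simp add: A_def power_mult_distrib power_add power2_eq_square)
        ultimately have "lap H (emb z) \<le> 0"
          unfolding H_def[abs_def] lap_add lap_diff lap_cmult lap_const lap_norm_sq d_def by linarith
        then show "lap (\<lambda>z. H (emb z) - u z) z \<le> 0" unfolding lap_diff lap_emb hz by simp
        fix w assume w: "w \<in> nbrs z" "w \<notin> V"
        have wL: "norm (emb w) \<le> L + 1"
          using lnorm_nbr_le[OF w(1), of 0] zL by (simp add: lball_def lnorm_def)
        show "0 \<le> H (emb w) - u w"
        proof (cases "w \<in> lball L")
          case False
          have "0 \<le> 1 / b\<^sup>2 * (norm (emb w - emb x0))\<^sup>2" by simp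
          then show ?thesis using H_ge[OF wL] u0[OF False] by linarith
        next
          case True
          then have wx: "b \<le> lnorm (w - x0)" using w(2) by (simp add: V_def)
          have "lnorm (w - x0) \<le> b + 1" using lnorm_nbr_le[OF w(1), of x0] zx by linarith
          then have "lnorm (w - y) \<ge> b / 2"
            using lnorm_triangle[of x0 y w] far lnorm_minus_commute[of x0 w] br r by linarith
          then have "u w \<le> 1" by (rule u1)
          moreover have "1 \<le> 1 / b\<^sup>2 * (norm (emb w - emb x0))\<^sup>2"
            using wx b power_mono[of b "norm (emb w - emb x0)" 2] by (simp add: lnorm_diff)
          ultimately show ?thesis using H_ge[OF wL] by linarith
        qed
      qed
      then have "u x0 \<le> A - A * (b ^ n * (1 / (1 + b + \<delta>) ^ n))" by (simp add: H_def vx0)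
      also have "b ^ n * (1 / (1 + b + \<delta>) ^ n) = (1 + - ((1 + \<delta>) / (1 + b + \<delta>))) ^ n"
      proof -
        have "1 + - ((1 + \<delta>) / (1 + b + \<delta>)) = b / (1 + b + \<delta>)" using b \<delta> by (simp add: field_simps)
        then show ?thesis by (simp add: power_divide)
      qed
      also have "A - A * (1 + - ((1 + \<delta>) / (1 + b + \<delta>))) ^ n \<le> A - A * (1 + n * - ((1 + \<delta>) / (1 + b + \<delta>)))"
        using A b \<delta> by (intro diff_left_mono mult_left_mono Bernoulli_inequality) auto
      also have "\<dots> = A * n * ((1 + \<delta>) / (1 + b + \<delta>))" by (simp add: algebra_simps)
      also have "\<dots> \<le> A * n * (2 * max 1 \<delta> / b)"
      proof (intro mult_left_mono frac_le)
        show "1 + \<delta> \<le> 2 * max 1 \<delta>" by (simp add: max_def)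
      qed (use A b \<delta>(1) in auto)
      also have "\<dots> = 2 * A * n * (max 1 \<delta> / b)" by simp
      also have "\<dots> \<le> C * (max 1 \<delta> / b)" using C(2) b by (intro mult_right_mono) auto
      finally show ?thesis by (simp add: \<delta>_def)
    qed
  qed
qed

text \<open>
  At distance about \<open>3b\<close> from \<open>y\<close> the decay bound is of order \<open>max 1 d\<^sub>L / b\<close>, and \<open>b\<^sup>d\<^sup>-\<^sup>1\<close> times
  the Poisson barrier is at least of this order, since its pole is at distance \<open>O(b)\<close> from \<open>y\<close>. The minimum principle
  propagates the comparison to all larger distances.
\<close>

lemma killed_harmonic_bound:
  assumes "CARD('d::finite) \<ge> 3"
  obtains C where "C > 0"
    "\<And>L b (y :: int ^ 'd) u x. L > 0 \<Longrightarrow> b \<ge> 1 \<Longrightarrow> y \<in> lball L \<Longrightarrow> bdist L y \<le> 4 * b \<Longrightarrow>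
       killed_harmonic L b y u \<Longrightarrow> x \<in> lball L \<Longrightarrow> lnorm (x - y) \<ge> 2 * b \<Longrightarrow>
       u x \<le> C * (b ^ (CARD('d) - 1) * max 1 (bdist L x) / lnorm (x - y) ^ CARD('d))"
proof -
  define d where "d = CARD('d)"
  have d: "d = Suc (d - 1)" by (simp add: d_def)
  obtain C1 where C1: "C1 > 0"
    "\<And>L b (y :: int ^ 'd) u x. L > 0 \<Longrightarrow> b \<ge> 1 \<Longrightarrow> y \<in> lball L \<Longrightarrow> killed_harmonic L b y u \<Longrightarrow> x \<in> lball L \<Longrightarrow>
       lnorm (x - y) \<ge> 2 * b \<Longrightarrow> u x \<le> C1 * (max 1 (bdist L x) / b)"
    using killed_harmonic_boundary_decay[OF assms] by blast
  obtain c \<kappa> where c: "c \<ge> 2"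
    and super: "\<And>L (v :: real ^ 'd) x. L > 0 \<Longrightarrow> norm v = L + c \<Longrightarrow> x \<in> lball L \<Longrightarrow> lap (\<lambda>z. poisson_super \<kappa> v (emb z)) x \<le> 0"
    and lower: "\<And>L (v :: real ^ 'd) z. L > 0 \<Longrightarrow> norm v = L + c \<Longrightarrow> norm z \<le> L + 1 \<Longrightarrow> (L + c - norm z) / 2 / norm (z - v) ^ CARD('d) \<le> poisson_super \<kappa> v z"
    and upper: "\<And>L (v :: real ^ 'd) z. L > 0 \<Longrightarrow> norm v = L + c \<Longrightarrow> norm z \<le> L + 1 \<Longrightarrow> poisson_super \<kappa> v z \<le> 2 * (L + c - norm z) / norm (z - v) ^ CARD('d)"
    using lball_poisson_barrier[OF assms] by blast
  \<comment> \<open>The pole is within \<open>(4 + c) b\<close> of \<open>y\<close>, so beyond distance \<open>M b\<close> the distances to \<open>y\<close> and to the pole are comparable.\<close>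
  define M where "M = 2 * (4 + c)"
  define C3 where "C3 = 2 * C1 * (7 + c) ^ d"
  have C3: "C3 > 0" using C1 c by (simp add: C3_def)
  define C where "C = max (C1 * M ^ d) (C3 * (2 * (1 + c)) * 2 ^ d)"
  show thesis
  proof (rule that[of C])
    have "C1 * M ^ d > 0" using C1 c by (simp add: M_def)
    then show "C > 0" by (simp add: C_def)
    fix L b :: real and x y :: "int ^ 'd" and u
    assume L: "L > 0" and b: "b \<ge> 1" and y: "y \<in> lball L" and dy: "bdist L y \<le> 4 * b"
      and u: "killed_harmonic L b y u" and x: "x \<in> lball L" and far: "lnorm (x - y) \<ge> 2 * b"
    have u0: "u z = 0" if "z \<notin> lball L" for z using u that by (simp add: killed_harmonic_def)
    have uh: "lap u z = 0" if "z \<in> lball L" "z \<notin> lball_at b y" for z using u that by (simp add: killed_harmonic_def)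
    have decay: "u z \<le> C1 * (max 1 (bdist L z) / b)" if "z \<in> lball L" "lnorm (z - y) \<ge> 2 * b" for z
      using C1(2)[OF L b y u that] .
    have xy: "lnorm (x - y) > 0" using far b by linarith
    define B where "B = b ^ (d - 1) * (max 1 (bdist L x) / lnorm (x - y) ^ d)"
    have B: "B \<ge> 0" using b xy by (simp add: B_def)
    have "u x \<le> C * B"
    proof (cases "lnorm (x - y) \<le> M * b")
      case True
      have "lnorm (x - y) ^ d \<le> M ^ d * b ^ d" using power_mono[OF True, of d] xy by (simp add: power_mult_distrib)
      also have "\<dots> = M ^ d * b ^ (d - 1) * b" by (subst d) simp
      finally have "1 / b \<le> M ^ d * b ^ (d - 1) / lnorm (x - y) ^ d"
        using b xy by (simp add: divide_simps)
      then have "C1 * max 1 (bdist L x) * (1 / b) \<le> C1 * max 1 (bdist L x) * (M ^ d * b ^ (d - 1) / lnorm (x - y) ^ d)"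
        using C1 by (intro mult_left_mono) auto
      then have "u x \<le> C1 * M ^ d * B" using decay[OF x far] by (simp add: B_def mult_ac)
      also have "\<dots> \<le> C * B" using B by (intro mult_right_mono) (auto simp: C_def)
      finally show ?thesis .
    next
      case False
      then have big: "lnorm (x - y) > M * b" by simp
      have M8: "M * b \<ge> 8 * b" using c b by (intro mult_right_mono) (auto simp: M_def)
      have y_pos: "lnorm y > 0"
      proof -
        have "lnorm (x - y) \<le> lnorm x + lnorm y"
          using norm_triangle_ineq4[of "emb x" "emb y"] unfolding lnorm_diff by (simp add: lnorm_def)
        then show ?thesis using big M8 dy x b unfolding lball_def bdist_def mem_Collect_eq by linarith
      qed
      have ny: "lnorm y \<le> L" using y by (simp add: lball_def)
      define v where "v = ((L + c) / lnorm y) *\<^sub>R emb y"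
      have v: "norm v = L + c" using y_pos L c by (simp add: v_def lnorm_def)
      have vy: "norm (emb y - v) \<le> (4 + c) * b"
      proof -
        have "norm (emb y - v) = L + c - lnorm y"
          using norm_diff_radial_rescale[of "emb y" "L + c"] y_pos ny c
          by (auto simp: v_def lnorm_def)
        also have "\<dots> \<le> 4 * b + c * 1" using dy by (simp add: bdist_def)
        also have "\<dots> \<le> 4 * b + c * b" using b c by (intro add_left_mono mult_left_mono) auto
        finally show ?thesis by (simp add: distrib_right)
      qed
      define a where "a = C3 * b ^ (d - 1)"
      have a: "a > 0" using C3 b by (simp add: a_def)
      define V where "V = lball L \<inter> {z. lnorm (z - y) > 3 * b}"
      have "0 \<le> a * poisson_super \<kappa> v (emb x) - u x"
      proof (rule lap_nonneg_minimum_principle[where V=V and h="\<lambda>z. a * poisson_super \<kappa> v (emb z) - u z"])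
        show "finite V" by (simp add: V_def finite_lball)
        have "3 * b < lnorm (x - y)" using big M8 b by linarith
        then show "x \<in> V" using x by (simp add: V_def)
        fix z assume z: "z \<in> V"
        have zL: "z \<in> lball L" and zy: "lnorm (z - y) > 3 * b" using z by (auto simp: V_def)
        have hz: "lap u z = 0" using uh[OF zL] zy b by (simp add: mem_lball_at)
        show "lap (\<lambda>z. a * poisson_super \<kappa> v (emb z) - u z) z \<le> 0"
          unfolding lap_diff lap_cmult hz using super[OF L v zL] a by (simp add: mult_le_0_iff)
        fix w assume w: "w \<in> nbrs z" "w \<notin> V"
        have wL: "norm (emb w) \<le> L + 1"
          using lnorm_nbr_le[OF w(1), of 0] zL by (simp add: lball_def lnorm_def)
        define \<rho> where "\<rho> = norm (emb w - v)"
        have \<rho>: "\<rho> > 0"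
          using norm_triangle_ineq2[of v "emb w"] wL v c norm_minus_commute[of v "emb w"] unfolding \<rho>_def by linarith
        have low: "(L + c - norm (emb w)) / 2 / \<rho> ^ d \<le> poisson_super \<kappa> v (emb w)"
          using lower[OF L v wL] by (simp add: \<rho>_def d_def)
        show "0 \<le> a * poisson_super \<kappa> v (emb w) - u w"
        proof (cases "w \<in> lball L")
          case False
          have "0 \<le> (L + c - norm (emb w)) / 2 / \<rho> ^ d" using wL c \<rho> by simp
          then have "0 \<le> poisson_super \<kappa> v (emb w)" using low by linarith
          then show ?thesis using a u0[OF False] by simp
        next
          case True
          then have w3: "lnorm (w - y) \<le> 3 * b" using w(2) by (simp add: V_def)
          have w2: "lnorm (w - y) \<ge> 2 * b"
            using lnorm_nbr_le[of z w y] w(1) nbrs_sym[of w z] zy b by auto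
          have "\<rho> \<le> lnorm (w - y) + norm (emb y - v)"
            using norm_triangle_ineq[of "emb w - emb y" "emb y - v"] by (simp add: \<rho>_def lnorm_diff)
          then have "\<rho> \<le> (7 + c) * b" using w3 vy by (simp add: distrib_right)
          then have "\<rho> ^ d \<le> (7 + c) ^ d * b ^ d"
            using power_mono[of \<rho> "(7 + c) * b" d] \<rho> by (simp add: power_mult_distrib)
          also have "\<dots> = (7 + c) ^ d * b ^ (d - 1) * b" by (subst d) simp
          finally have pw: "1 / b \<le> (7 + c) ^ d * b ^ (d - 1) / \<rho> ^ d"
            using b \<rho> by (simp add: divide_simps)
          define t where "t = max 1 (bdist L w)"
          have t: "t \<le> L + c - norm (emb w)" "t > 0"
            using True c by (auto simp: t_def bdist_def lball_def lnorm_def)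
          have "u w \<le> C1 * t * (1 / b)" using decay[OF True w2] by (simp add: t_def)
          also have "\<dots> \<le> C1 * t * ((7 + c) ^ d * b ^ (d - 1) / \<rho> ^ d)"
            using pw C1 t by (intro mult_left_mono) auto
          also have "\<dots> = a * (t / 2 / \<rho> ^ d)" by (simp add: a_def C3_def)
          also have "\<dots> \<le> a * ((L + c - norm (emb w)) / 2 / \<rho> ^ d)"
            using a t \<rho> by (intro mult_left_mono divide_right_mono) auto
          also have "\<dots> \<le> a * poisson_super \<kappa> v (emb w)" using low a by (intro mult_left_mono) auto
          finally show ?thesis by simp
        qed
      qed
      then have "u x \<le> a * poisson_super \<kappa> v (emb x)" by simp
      also have "\<dots> \<le> a * (2 * ((1 + c) * max 1 (bdist L x)) * (2 ^ d / lnorm (x - y) ^ d))"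
      proof (rule mult_left_mono)
        define \<rho> where "\<rho> = norm (emb x - v)"
        have nx: "norm (emb x) \<le> L" using x by (simp add: lball_def lnorm_def)
        have "lnorm (x - y) \<le> \<rho> + (4 + c) * b"
          using norm_triangle_ineq4[of "emb x - v" "emb y - v"] vy by (simp add: lnorm_diff \<rho>_def)
        moreover have "(4 + c) * b = M * b / 2" by (simp add: M_def)
        ultimately have \<rho>: "lnorm (x - y) \<le> 2 * \<rho>" "\<rho> > 0" using big xy by linarith+
        have inv: "1 / \<rho> ^ d \<le> 2 ^ d / lnorm (x - y) ^ d"
          using power_mono[OF \<rho>(1), of d] \<rho>(2) xy by (simp add: divide_simps power_mult_distrib)
        have "L + c - lnorm x \<le> max 1 (bdist L x) + c * 1" by (simp add: bdist_def)
        also have "\<dots> \<le> max 1 (bdist L x) + c * max 1 (bdist L x)" using c by (intro add_left_mono mult_left_mono) auto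
        finally have "L + c - lnorm x \<le> (1 + c) * max 1 (bdist L x)" by (simp add: distrib_right)
        then have "2 * (L + c - lnorm x) * (1 / \<rho> ^ d) \<le> 2 * ((1 + c) * max 1 (bdist L x)) * (2 ^ d / lnorm (x - y) ^ d)"
          using inv c \<rho> nx by (intro mult_mono) (auto simp: lnorm_def)
        then show "poisson_super \<kappa> v (emb x) \<le> 2 * ((1 + c) * max 1 (bdist L x)) * (2 ^ d / lnorm (x - y) ^ d)"
          using upper[OF L v, of "emb x"] nx by (simp add: \<rho>_def d_def lnorm_def)
      qed (use a in auto)
      also have "\<dots> = C3 * (2 * (1 + c)) * 2 ^ d * B" by (simp add: a_def B_def)
      also have "\<dots> \<le> C * B" using B by (intro mult_right_mono) (auto simp: C_def)
      finally show ?thesis .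
    qed
    then show "u x \<le> C * (b ^ (CARD('d) - 1) * max 1 (bdist L x) / lnorm (x - y) ^ CARD('d))"
      by (simp add: B_def d_def)
  qed
qed

text \<open>
  If \<open>|x - y| < 2b\<close> then \<open>b = d\<^sub>L(y)/4\<close>, both points have depth at least \<open>|x - y|\<close>, and the bound
  follows from the one for the walk without killing.
\<close>

lemma hit_inside_prob_upper:
  assumes "CARD('d::finite) \<ge> 3"
  shows "\<exists>C>0. \<forall>L a (x :: int ^ 'd) y. L > 0 \<and> a \<ge> 1 \<and> x \<notin> lball_at a y \<and> x \<in> lball L \<and> y \<in> lball L \<and> lnorm (x - y) > 7 * a \<longrightarrow>
     hit_inside_prob (lball_at a y) L x
       \<le> C * (a ^ (CARD('d) - 2) * max a (bdist L y) * max 1 (bdist L x) / lnorm (x - y) ^ CARD('d))"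
proof -
  define m where "m = CARD('d) - 2"
  have m: "CARD('d) = m + 2" "CARD('d) - 1 = Suc m" using assms by (auto simp: m_def)
  obtain C0 where C0: "C0 > 0" "\<And>a (x :: int ^ 'd) y. a \<ge> 1 \<Longrightarrow> x \<notin> lball_at a y \<Longrightarrow>
    \<bar>hit_prob (lball_at a y) x - (a / lnorm (x - y)) ^ m\<bar> \<le> C0 * inverse a * (a / lnorm (x - y)) ^ m"
    using hit_ball_prob_asymptotics[OF assms] unfolding m_def by blast
  have free: "hit_inside_prob (lball_at a y) L x \<le> (1 + C0) * (a / lnorm (x - y)) ^ m"
    if "a \<ge> 1" "x \<notin> lball_at a y" for a L and x y :: "int ^ 'd"
  proof -
    define T where "T = (a / lnorm (x - y)) ^ m"
    have T: "T \<ge> 0" using that by (simp add: T_def lnorm_def)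
    have "C0 * inverse a * T \<le> C0 * 1 * T"
      using C0(1) that T by (intro mult_right_mono mult_left_mono) (auto simp: inverse_le_1_iff)
    moreover have "hit_prob (lball_at a y) x \<le> T + C0 * inverse a * T"
      using C0(2)[OF that] unfolding T_def by linarith
    ultimately show ?thesis
      using hit_inside_prob_le_hit_prob[of "lball_at a y" L x] unfolding T_def[symmetric] by (simp add: algebra_simps)
  qed
  obtain C2 where C2: "C2 > 0"
    "\<And>L b (y :: int ^ 'd) u x. L > 0 \<Longrightarrow> b \<ge> 1 \<Longrightarrow> y \<in> lball L \<Longrightarrow> bdist L y \<le> 4 * b \<Longrightarrow>
       killed_harmonic L b y u \<Longrightarrow> x \<in> lball L \<Longrightarrow> lnorm (x - y) \<ge> 2 * b \<Longrightarrow>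
       u x \<le> C2 * (b ^ (CARD('d) - 1) * max 1 (bdist L x) / lnorm (x - y) ^ CARD('d))"
    using killed_harmonic_bound[OF assms] by blast
  define K where "K = (1 + C0) * 2 ^ m"
  have K: "K > 0" using C0 by (simp add: K_def)
  define C where "C = max (1 + C0) (K * C2)"
  have C: "C > 0" using C0 by (simp add: C_def)
  moreover have "hit_inside_prob (lball_at a y) L x
       \<le> C * (a ^ m * max a (bdist L y) * max 1 (bdist L x) / lnorm (x - y) ^ CARD('d))"
    if L: "L > 0" and a: "a \<ge> 1" and xa: "x \<notin> lball_at a y" and x: "x \<in> lball L" and y: "y \<in> lball L"
      and far: "lnorm (x - y) > 7 * a" for L a and x y :: "int ^ 'd"
  proof -
    define b where "b = max a (bdist L y / 4)"
    have b: "b \<ge> 1" "b \<ge> a" "bdist L y \<le> 4 * b" using a by (auto simp: b_def)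
    have b_le: "b \<le> max a (bdist L y)" using a by (auto simp: b_def)
    define R where "R = lnorm (x - y)"
    have R: "R > 0" using far a by (simp add: R_def)
    define B where "B = a ^ m * max a (bdist L y) * max 1 (bdist L x) / R ^ CARD('d)"
    have B: "B \<ge> 0" using a R by (simp add: B_def)
    have "hit_inside_prob (lball_at a y) L x \<le> C * B"
    proof (cases "R \<ge> 2 * b")
      case True
      define k where "k = K * (a / b) ^ m"
      have k: "k > 0" using K a b by (simp add: k_def)
      have "killed_harmonic L b y (\<lambda>z. 1 / k * hit_inside_prob (lball_at a y) L z)"
        unfolding killed_harmonic_def
      proof (intro conjI allI ballI impI)
        fix z assume z: "b / 2 \<le> lnorm (z - y)"
        have "hit_inside_prob (lball_at a y) L z \<le> k"
        proof (cases "z \<in> lball_at a y")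
          case True
          then have "1 \<le> 2 * (a / b)" using z b by (simp add: mem_lball_at pos_le_divide_eq)
          then have "1 \<le> (2 * (a / b)) ^ m" by (rule one_le_power)
          then have "1 * 1 \<le> (1 + C0) * (2 * (a / b)) ^ m" using C0 by (intro mult_mono) auto
          then have "1 \<le> k" by (simp add: k_def K_def power_mult_distrib power_divide)
          then show ?thesis using hit_inside_prob_le_1[of "lball_at a y" L z] by linarith
        next
          case False
          have "a / lnorm (z - y) \<le> a / (b / 2)"
            using z a b by (intro divide_left_mono) auto
          then have "(a / lnorm (z - y)) ^ m \<le> (a / (b / 2)) ^ m"
            using a by (intro power_mono) (auto simp: lnorm_def)
          also have "(a / (b / 2)) ^ m = 2 ^ m * (a / b) ^ m"
            by (simp add: power_mult_distrib power_divide)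
          finally have "(1 + C0) * (a / lnorm (z - y)) ^ m \<le> k"
            unfolding k_def K_def mult.assoc using C0 by (intro mult_left_mono) auto
          then show ?thesis using free[OF a False, of L] by linarith
        qed
        then show "1 / k * hit_inside_prob (lball_at a y) L z \<le> 1" using k by simp
      next
        fix z :: "int ^ 'd" assume "z \<notin> lball L"
        then show "1 / k * hit_inside_prob (lball_at a y) L z = 0" by (simp add: hit_inside_prob_start)
      next
        fix z assume z: "z \<in> lball L" "z \<notin> lball_at b y"
        then have "z \<notin> lball_at a y" using b by (simp add: mem_lball_at)
        then show "lap (\<lambda>z. 1 / k * hit_inside_prob (lball_at a y) L z) z = 0"
          unfolding lap_cmult using hit_inside_prob_harmonic[OF _ z(1)] by simp
      qed
      then have "1 / k * hit_inside_prob (lball_at a y) L x \<le> C2 * (b ^ (CARD('d) - 1) * max 1 (bdist L x) / R ^ CARD('d))"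
        unfolding R_def using True by (intro C2(2)[OF L b(1) y b(3) _ x]) (auto simp: R_def)
      then have "hit_inside_prob (lball_at a y) L x \<le> k * (C2 * (b ^ (CARD('d) - 1) * max 1 (bdist L x) / R ^ CARD('d)))"
        using k by (simp add: pos_divide_le_eq mult.commute)
      also have "\<dots> = K * C2 * (a ^ m * b * max 1 (bdist L x) / R ^ CARD('d))"
        unfolding k_def m(2) using b(1) by (simp add: power_divide)
      also have "\<dots> \<le> K * C2 * B"
        unfolding B_def using K C2 a R b_le by (intro mult_left_mono mult_right_mono divide_right_mono) auto
      also have "\<dots> \<le> C * B" using B by (intro mult_right_mono) (auto simp: C_def)
      finally show ?thesis .
    next
      case False
      then have D: "R < bdist L y / 2" using far a by (auto simp: b_def R_def max_def split: if_splits)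
      have "lnorm x \<le> lnorm y + R"
        using norm_triangle_ineq2[of "emb x" "emb y"] by (simp add: R_def lnorm_diff lnorm_def emb_diff)
      then have "R \<le> bdist L x" using D by (simp add: bdist_def)
      then have "R * R \<le> max a (bdist L y) * max 1 (bdist L x)"
        using D R a by (intro mult_mono) auto
      then have "a ^ m * (R * R) / R ^ CARD('d) \<le> B"
        unfolding B_def mult.assoc using a R by (intro divide_right_mono mult_left_mono) auto
      moreover have "a ^ m * (R * R) / R ^ CARD('d) = (a / R) ^ m"
        using R by (simp add: m(1) power_divide)
      ultimately have "(1 + C0) * (a / R) ^ m \<le> (1 + C0) * B" using C0 by (intro mult_left_mono) auto
      also have "\<dots> \<le> C * B" using B by (intro mult_right_mono) (auto simp: C_def)
      finally show ?thesis using free[OF a xa, of L] by (simp add: R_def)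
    qed
    then show ?thesis by (simp add: B_def R_def)
  qed
  ultimately show ?thesis unfolding m_def by blast
qed

theorem lemma4p2:
  assumes "CARD('d::finite) \<ge> 3"
  shows
    "(\<exists>C>0. \<forall>(a::real) (x :: int ^ 'd) y. a \<ge> 1 \<and> x \<notin> lball_at a y \<longrightarrow>
        (\<exists>\<epsilon>. \<bar>\<epsilon>\<bar> \<le> C * inverse a \<and>
          \<P>(X in srw x. hit_time (lball_at a y) X < \<infinity>)
            = (a / lnorm (x - y)) ^ (CARD('d) - 2) * (1 + \<epsilon>))) \<and>
     (\<exists>C>0. \<forall>(L::real) (a::real) (x :: int ^ 'd) y.
        L > 0 \<and> a \<ge> 1 \<and> x \<notin> lball_at a y \<and> x \<in> lball L \<and> y \<in> lball L \<and> lnorm (x - y) > 7 * a \<longrightarrow>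
          \<P>(X in srw x. hit_time (lball_at a y) X < exit_time L X)
            \<le> C * (a ^ (CARD('d) - 2) * max a (bdist L y) * max 1 (bdist L x)
                    / lnorm (x - y) ^ CARD('d))) \<and>
     (\<exists>C>0. \<forall>(L::real) (x :: int ^ 'd) y.
        L > 0 \<and> x \<in> lball L \<and> y \<in> outer_boundary (lball L) \<longrightarrow>
          inverse C * (bdist L x / lnorm (x - y) ^ CARD('d)) \<le> exit_prob L x y \<and>
          exit_prob L x y \<le> C * (max 1 (bdist L x) / lnorm (x - y) ^ CARD('d)))"
proof (intro conjI)
  obtain C where C: "C > 0" "\<And>a (x :: int ^ 'd) y. a \<ge> 1 \<Longrightarrow> x \<notin> lball_at a y \<Longrightarrow>
    \<bar>hit_prob (lball_at a y) x - (a / lnorm (x - y)) ^ (CARD('d) - 2)\<bar>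
       \<le> C * inverse a * (a / lnorm (x - y)) ^ (CARD('d) - 2)"
    using hit_ball_prob_asymptotics[OF assms] by blast
  have "\<exists>\<epsilon>. \<bar>\<epsilon>\<bar> \<le> C * inverse a \<and>
      \<P>(X in srw x. hit_time (lball_at a y) X < \<infinity>) = (a / lnorm (x - y)) ^ (CARD('d) - 2) * (1 + \<epsilon>)"
    if a: "a \<ge> 1" and x: "x \<notin> lball_at a y" for a and x y :: "int ^ 'd"
  proof -
    define T where "T = (a / lnorm (x - y)) ^ (CARD('d) - 2)"
    have "lnorm (x - y) > 0" using a x by (simp add: mem_lball_at)
    then have T: "T > 0" using a by (simp add: T_def)
    define e where "e = (hit_prob (lball_at a y) x - T) / T"
    have "\<bar>e\<bar> \<le> C * inverse a"
      using C(2)[OF a x] T unfolding T_def[symmetric] by (simp add: e_def pos_divide_le_eq)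
    moreover have "hit_prob (lball_at a y) x = T * (1 + e)" using T by (simp add: e_def field_simps)
    ultimately show ?thesis unfolding hit_prob_def T_def by blast
  qed
  then show "\<exists>C>0. \<forall>(a::real) (x :: int ^ 'd) y. a \<ge> 1 \<and> x \<notin> lball_at a y \<longrightarrow>
        (\<exists>\<epsilon>. \<bar>\<epsilon>\<bar> \<le> C * inverse a \<and>
          \<P>(X in srw x. hit_time (lball_at a y) X < \<infinity>)
            = (a / lnorm (x - y)) ^ (CARD('d) - 2) * (1 + \<epsilon>))"
    using C(1) by blast
next
  show "\<exists>C>0. \<forall>(L::real) (a::real) (x :: int ^ 'd) y.
        L > 0 \<and> a \<ge> 1 \<and> x \<notin> lball_at a y \<and> x \<in> lball L \<and> y \<in> lball L \<and> lnorm (x - y) > 7 * a \<longrightarrow>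
          \<P>(X in srw x. hit_time (lball_at a y) X < exit_time L X)
            \<le> C * (a ^ (CARD('d) - 2) * max a (bdist L y) * max 1 (bdist L x)
                    / lnorm (x - y) ^ CARD('d))"
    using hit_inside_prob_upper[OF assms] unfolding hit_inside_prob_def .
next
  obtain C1 where C1: "C1 > 0" "\<And>L (x :: int ^ 'd) y. L > 0 \<Longrightarrow> x \<in> lball L \<Longrightarrow> y \<in> outer_boundary (lball L) \<Longrightarrow>
      exit_prob L x y \<le> C1 * (max 1 (bdist L x) / lnorm (x - y) ^ CARD('d))"
    using exit_prob_upper[OF assms] by blast
  obtain \<eta> where \<eta>: "\<eta> > 0"
    "\<And>L (x :: int ^ 'd) y. L > 0 \<Longrightarrow> x \<in> lball L \<Longrightarrow> y \<in> outer_boundary (lball L) \<Longrightarrow>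
       \<eta> * (bdist L x / lnorm (x - y) ^ CARD('d)) \<le> exit_prob L x y"
    using exit_prob_lower[OF assms] by blast
  define C where "C = max C1 (1 / \<eta>)"
  have C: "C > 0" "C \<ge> C1" using C1 by (auto simp: C_def)
  have "1 / C \<le> 1 / (1 / \<eta>)" using C \<eta>(1) by (intro divide_left_mono) (auto simp: C_def)
  then have "inverse C \<le> \<eta>" by (simp add: inverse_eq_divide)
  have "inverse C * (bdist L x / lnorm (x - y) ^ CARD('d)) \<le> exit_prob L x y \<and>
          exit_prob L x y \<le> C * (max 1 (bdist L x) / lnorm (x - y) ^ CARD('d))"
    if L: "L > 0" and x: "x \<in> lball L" and y: "y \<in> outer_boundary (lball L)" for L and x y :: "int ^ 'd"
  proof
    have "inverse C * (bdist L x / lnorm (x - y) ^ CARD('d)) \<le> \<eta> * (bdist L x / lnorm (x - y) ^ CARD('d))"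
      using \<open>inverse C \<le> \<eta>\<close> x by (intro mult_right_mono) (auto simp: bdist_def lball_def lnorm_def)
    then show "inverse C * (bdist L x / lnorm (x - y) ^ CARD('d)) \<le> exit_prob L x y"
      using \<eta>(2)[OF L x y] by linarith
    have "C1 * (max 1 (bdist L x) / lnorm (x - y) ^ CARD('d)) \<le> C * (max 1 (bdist L x) / lnorm (x - y) ^ CARD('d))"
      using C(2) by (intro mult_right_mono) (auto simp: lnorm_def)
    then show "exit_prob L x y \<le> C * (max 1 (bdist L x) / lnorm (x - y) ^ CARD('d))"
      using C1(2)[OF L x y] by linarith
  qed
  then show "\<exists>C>0. \<forall>(L::real) (x :: int ^ 'd) y.
        L > 0 \<and> x \<in> lball L \<and> y \<in> outer_boundary (lball L) \<longrightarrow>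
          inverse C * (bdist L x / lnorm (x - y) ^ CARD('d)) \<le> exit_prob L x y \<and>
          exit_prob L x y \<le> C * (max 1 (bdist L x) / lnorm (x - y) ^ CARD('d))"
    using C(1) by blast
qed

end
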